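(* Let $k\geq 3$ and let $P:\{0,1\}^k\to\{0,1\}$ be a symmetric predicate other than $k$-EQU. Then for any $\epsilon>0$, there exist $\delta>0$ and $d\geq 1$ such that every $(|P^{-1}(0)|/2^k-\epsilon)$-tester for CSP($P$) with degree bound $d$ requires $\Omega(n^{1/2+\delta})$ queries, where $n$ is the number of variables and $\delta=O(1/\log(k/\epsilon^2))$.
   Context: All predicates satisfy $|P^{-1}(1)|>0$. A predicate $P:\{0,1\}^k\to\{0,1\}$ is symmetric if (i) $P(x)=P(y)$ whenever $x,y$ have the same Hamming weight and (ii) $P(x)=P(\overline{x})$ for all $x$, where $\overline{x}=(1,\dots,1)-x$. $k$-EQU is the predicate satisfied iff all $k$ inputs are equal. An instance of CSP($P$) consists of Boolean variables and constraints, each on a $k$-tuple of variables $(x_1,\dots,x_k)$ and of the form $P(x_1+b_1,\dots,x_k+b_k)=1$ for some $b\in\{0,1\}^k$ (addition mod 2). Bounded-degree model with degree bound $d$: each variable appears in at most $d$ constraints; an algorithm accesses the instance only via an oracle that, given a variable $x$ and an index $1\le i\le d$, returns the $i$-th constraint containing $x$ (or a special symbol if none exists); query complexity is the number of oracle calls. An instance is $\epsilon$-far from satisfiability if at least $\epsilon dn/k$ constraints must be removed to make it satisfiable. An $\epsilon$-tester is a randomized algorithm that accepts every satisfiable instance with probability at least $2/3$ and rejects every instance $\epsilon$-far from satisfiability with probability at least $2/3$. *)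

theory Defs
  imports "HOL-Probability.Probability"
begin

text \<open>The cube of 0/1-strings of length k is rendered as the bool lists of length \<open>k\<close>, with 1 as
  \<^const>\<open>True\<close>; the values of a predicate at lists of any other length are irrelevant.\<close>

definition cube :: "nat \<Rightarrow> bool list set" where
  "cube k = {x. length x = k}"

definition sat_inputs :: "nat \<Rightarrow> (bool list \<Rightarrow> bool) \<Rightarrow> bool list set" where
  "sat_inputs k P = {x \<in> cube k. P x}"

definition unsat_inputs :: "nat \<Rightarrow> (bool list \<Rightarrow> bool) \<Rightarrow> bool list set" where
  "unsat_inputs k P = {x \<in> cube k. \<not> P x}"

definition hamming_weight :: "bool list \<Rightarrow> nat" where
  "hamming_weight x = length (filter (\<lambda>b. b) x)"

definition symmetric_predicate :: "nat \<Rightarrow> (bool list \<Rightarrow> bool) \<Rightarrow> bool" where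
  "symmetric_predicate k P \<longleftrightarrow>
     (\<forall>x\<in>cube k. \<forall>y\<in>cube k. hamming_weight x = hamming_weight y \<longrightarrow> P x = P y) \<and>
     (\<forall>x\<in>cube k. P x = P (map Not x))"

definition EQU :: "bool list \<Rightarrow> bool" where
  "EQU x \<longleftrightarrow> (\<forall>i<length x. \<forall>j<length x. x ! i = x ! j)"

text \<open>The constraint \<open>(vs, bs)\<close> stands for \<open>P (vs\<^sub>1 + bs\<^sub>1, \<dots>, vs\<^sub>k + bs\<^sub>k) = 1\<close>.\<close>

type_synonym cstr = "nat list \<times> bool list"

definition cstr_sat :: "(bool list \<Rightarrow> bool) \<Rightarrow> (nat \<Rightarrow> bool) \<Rightarrow> cstr \<Rightarrow> bool" where
  "cstr_sat P a c \<longleftrightarrow> P (map2 (\<lambda>v b. a v \<noteq> b) (fst c) (snd c))"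

definition satisfiable :: "(bool list \<Rightarrow> bool) \<Rightarrow> cstr set \<Rightarrow> bool" where
  "satisfiable P C \<longleftrightarrow> (\<exists>a. \<forall>c\<in>C. cstr_sat P a c)"

text \<open>The variables are \<open>0, \<dots>, nvars - 1\<close>. Besides its constraints, an instance carries, for every
  variable, the (arbitrary) order in which the oracle lists the constraints containing it.\<close>

record csp =
  nvars :: nat
  cstrs :: "cstr set"
  incidence :: "nat \<Rightarrow> cstr list"

definition csp_instances :: "nat \<Rightarrow> nat \<Rightarrow> nat \<Rightarrow> csp set" where
  "csp_instances k d n = {I.
     nvars I = n \<and>
     (\<forall>(vs, bs)\<in>cstrs I. length vs = k \<and> length bs = k \<and> set vs \<subseteq> {..<n}) \<and>
     (\<forall>x<n. distinct (incidence I x) \<and>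
            set (incidence I x) = {c \<in> cstrs I. x \<in> set (fst c)} \<and>
            length (incidence I x) \<le> d)}"

definition far :: "nat \<Rightarrow> (bool list \<Rightarrow> bool) \<Rightarrow> nat \<Rightarrow> real \<Rightarrow> csp \<Rightarrow> bool" where
  "far k P d \<epsilon> I \<longleftrightarrow>
     (\<forall>R. R \<subseteq> cstrs I \<and> satisfiable P (cstrs I - R) \<longrightarrow>
        real (card R) \<ge> \<epsilon> * real d * real (nvars I) / real k)"

definition oracle_answer :: "csp \<Rightarrow> nat \<Rightarrow> nat \<Rightarrow> cstr option" where
  "oracle_answer I x i =
     (if x < nvars I \<and> 1 \<le> i \<and> i \<le> length (incidence I x)
      then Some (incidence I x ! (i - 1)) else None)"

text \<open>Deterministic algorithms are adaptive decision trees. A randomized algorithm is a probability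
  distribution on them; as there are only finitely many oracle answers for given parameters, nothing
  is lost by taking the distribution to be discrete.\<close>

datatype dtree = Output bool | Query nat nat "cstr option \<Rightarrow> dtree"

primrec accepts :: "csp \<Rightarrow> dtree \<Rightarrow> bool" where
  "accepts I (Output b) = b"
| "accepts I (Query x i next) = accepts I (next (oracle_answer I x i))"

primrec queries :: "csp \<Rightarrow> dtree \<Rightarrow> nat" where
  "queries I (Output b) = 0"
| "queries I (Query x i next) = Suc (queries I (next (oracle_answer I x i)))"

definition tester ::
  "nat \<Rightarrow> (bool list \<Rightarrow> bool) \<Rightarrow> nat \<Rightarrow> real \<Rightarrow> nat \<Rightarrow> dtree pmf \<Rightarrow> bool" where
  "tester k P d \<epsilon> n A \<longleftrightarrow>
     (\<forall>I\<in>csp_instances k d n.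
        (satisfiable P (cstrs I) \<longrightarrow> measure_pmf.prob A {t. accepts I t} \<ge> 2/3) \<and>
        (far k P d \<epsilon> I \<longrightarrow> measure_pmf.prob A {t. \<not> accepts I t} \<ge> 2/3))"

definition query_complexity :: "nat \<Rightarrow> nat \<Rightarrow> nat \<Rightarrow> dtree pmf \<Rightarrow> enat" where
  "query_complexity k d n A =
     (SUP I\<in>csp_instances k d n. SUP t\<in>set_pmf A. enat (queries I t))"

end

theory Submission
  imports Defs "HOL-Combinatorics.Permutations"
begin

text \<open>The constraints form \<open>d\<close> random perfect matchings between \<open>k\<close> classes of \<open>m\<close> variables. With
  uniformly random negations such an instance is far from satisfiable. The competing distribution
  plants a random assignment and gives each constraint a hidden random type \<open>t < k\<close>, which splits its
  positions into the pair \<open>t\<close>, \<open>t + 1\<close> and the rest. The planted input is a fixed pattern with the two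
  blocks flipped by independent fair coins; because \<open>P\<close> is symmetric and not \<open>k\<close>-EQU, the pattern can
  be chosen so that all four outcomes satisfy \<open>P\<close>. Hence only variables in the same block are
  correlated, and for two given positions of a constraint this happens with probability at most
  \<open>1 - 1/k\<close>.

  An algorithm sees a difference only when a new constraint meets variables seen before (a collision)
  and one of these is joined to the anchor or to an earlier collision by a path all of whose
  steps stay within blocks. Few variables are near a given one because degrees are bounded, and long
  paths of this kind are polynomially unlikely. So each of the about \<open>n\<close> to the power \<open>2\<delta>\<close> collisions
  helps only with probability polynomially small in \<open>n\<close>, which is where the gain over the birthday
  bound comes from.\<close>

text \<open>The comparison is one-sided. Both distributions share the law of the matchings, so a
  list of revealed constraints (a state) differs in probability only through its negations. Given
  the hidden types, the planted negations are exactly uniform as long as every collision was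
  harmless (\<open>clean\<close>); the other type choices are simply dropped, all weights being
  nonnegative. So a state is planted with at least \<open>1 - dirty_frac\<close> times its random
  probability, and only the expected \<open>dirty_frac\<close> at a leaf has to be bounded, under
  the random law alone.

  Uniformity comes from symmetries: flipping the assignment on a component preserves the past and
  toggles one new negation. At the anchor no such shift is available in general; there the
  constraint's own coin toggles the whole block.

  Taking the pair from a cycle makes correlation decay: no two positions are joined under all types,
  which needs three positions. A union bound over \<open>2 ^ (k * m)\<close> assignments makes
  \<open>d\<close> of order k/\<epsilon>^2. Neighbourhoods of radius \<open>2 * R\<close> must stay
  polynomially small, so \<open>R\<close> is of order ln n / ln (k d), and the decay over
  \<open>R\<close> steps is the power of n that limits \<delta>.\<close>

section \<open>Counting functions and permutations with prescribed values\<close>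

lemma card_PiE_coordinate:
  assumes "finite I" "i \<in> I"
  shows "card {f \<in> PiE I S. f i \<in> T} * card (S i) = card (S i \<inter> T) * card (PiE I S)"
proof -
  have eq: "{f \<in> PiE I S. f i \<in> T} = PiE I (S(i := S i \<inter> T))"
    using assms(2) by (auto simp: PiE_iff extensional_def split: if_splits)
  have "(\<Prod>j\<in>I - {i}. card ((S(i := S i \<inter> T)) j)) = (\<Prod>j\<in>I - {i}. card (S j))"
    by (rule prod.cong) auto
  then show ?thesis
    unfolding eq using assms by (simp add: card_PiE prod.remove)
qed

lemma card_PiE_coordinate2:
  assumes "finite I" "i \<in> I" "j \<in> I" "i \<noteq> j"
  shows "card {f \<in> PiE I S. f i \<in> T \<and> f j \<in> U} * (card (S i) * card (S j))
    = card (S i \<inter> T) * card (S j \<inter> U) * card (PiE I S)"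
proof -
  have eq: "{f \<in> PiE I S. f i \<in> T} = PiE I (S(i := S i \<inter> T))"
    using assms(2) by (auto simp: PiE_iff extensional_def split: if_splits)
  have "{f \<in> PiE I S. f i \<in> T \<and> f j \<in> U} = {f \<in> PiE I (S(i := S i \<inter> T)). f j \<in> U}"
    using eq by blast
  moreover have "card {f \<in> PiE I (S(i := S i \<inter> T)). f j \<in> U} * card (S j)
      = card (S j \<inter> U) * card (PiE I (S(i := S i \<inter> T)))"
    using card_PiE_coordinate[OF assms(1,3), of "S(i := S i \<inter> T)" U] assms(4) by simp
  moreover have "card (PiE I (S(i := S i \<inter> T))) * card (S i) = card (S i \<inter> T) * card (PiE I S)"
    using card_PiE_coordinate[OF assms(1,2), of S T] unfolding eq .
  ultimately have "card {f \<in> PiE I S. f i \<in> T \<and> f j \<in> U} * card (S j) * card (S i)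
      = card (S j \<inter> U) * (card (S i \<inter> T) * card (PiE I S))"
    by (metis mult.assoc)
  then show ?thesis
    by (simp add: ac_simps)
qed

text \<open>Composition with one fixed permutation \<open>p0\<close> extending \<open>g\<close> maps
  the permutations of \<open>A - S\<close> bijectively onto the extensions of
  \<open>g\<close>.\<close>

lemma card_permutes_extending_on:
  assumes "finite A" "S \<subseteq> A" "inj_on g S" "g ` S \<subseteq> A"
  shows "card {p. p permutes A \<and> (\<forall>x\<in>S. p x = g x)} = fact (card A - card S)"
proof -
  have fin: "finite S" using assms(1,2) finite_subset by blast
  have "card (A - S) = card (A - g ` S)"
    using assms fin by (simp add: card_Diff_subset card_image)
  then obtain h where h: "bij_betw h (A - S) (A - g ` S)"
    using assms(1) by (meson finite_Diff finite_same_card_bij)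
  define p0 where "p0 x = (if x \<in> S then g x else if x \<in> A then h x else x)" for x
  have "bij_betw p0 S (g ` S)"
    using assms(3) by (simp add: bij_betw_def p0_def inj_on_def image_def)
  moreover have "bij_betw p0 (A - S) (A - g ` S)"
    using h by (rule bij_betw_cong[THEN iffD1, rotated]) (auto simp: p0_def)
  ultimately have "bij_betw p0 (S \<union> (A - S)) (g ` S \<union> (A - g ` S))"
    by (rule bij_betw_combine) auto
  moreover have "S \<union> (A - S) = A" "g ` S \<union> (A - g ` S) = A" using assms by auto
  ultimately have p0: "p0 permutes A"
    using assms(2) by (intro bij_imp_permutes) (auto simp: p0_def)
  have "bij_betw (\<lambda>q. p0 \<circ> q) {q. q permutes (A - S)} {p. p permutes A \<and> (\<forall>x\<in>S. p x = g x)}"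
  proof (rule bij_betwI[where g = "\<lambda>p. inv p0 \<circ> p"])
    show "(\<lambda>q. p0 \<circ> q) \<in> {q. q permutes (A - S)} \<rightarrow> {p. p permutes A \<and> (\<forall>x\<in>S. p x = g x)}"
    proof
      fix q assume "q \<in> {q. q permutes (A - S)}"
      then have q: "q permutes (A - S)" by simp
      then have "q permutes A" by (rule permutes_subset) auto
      then have "p0 \<circ> q permutes A" using p0 permutes_compose by blast
      moreover have "(p0 \<circ> q) x = g x" if "x \<in> S" for x
        using that permutes_not_in[OF q, of x] by (simp add: p0_def)
      ultimately show "p0 \<circ> q \<in> {p. p permutes A \<and> (\<forall>x\<in>S. p x = g x)}" by simp
    qed
    show "(\<lambda>p. inv p0 \<circ> p) \<in> {p. p permutes A \<and> (\<forall>x\<in>S. p x = g x)} \<rightarrow> {q. q permutes (A - S)}"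
    proof
      fix p assume "p \<in> {p. p permutes A \<and> (\<forall>x\<in>S. p x = g x)}"
      then have p: "p permutes A" and e: "\<And>x. x \<in> S \<Longrightarrow> p x = p0 x" by (auto simp: p0_def)
      have c: "inv p0 \<circ> p permutes A"
        using p p0 permutes_compose permutes_inv by blast
      have "(inv p0 \<circ> p) x = x" if "x \<in> S" for x
        using e[OF that] permutes_inverses(2)[OF p0] by simp
      then show "inv p0 \<circ> p \<in> {q. q permutes (A - S)}"
        using permutes_superset[OF c, of "A - S"] by auto
    qed
  qed (simp_all add: permutes_inverses[OF p0] o_assoc[symmetric] fun_eq_iff)
  from bij_betw_same_card[OF this]
  have "card {p. p permutes A \<and> (\<forall>x\<in>S. p x = g x)} = card {q. q permutes (A - S)}"
    by simp
  also have "\<dots> = fact (card A - card S)"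
    using assms fin by (subst card_permutations[OF refl]) (auto simp: card_Diff_subset)
  finally show ?thesis .
qed

lemma card_permutes_extending_list:
  assumes "finite A" "set (map fst xs) \<subseteq> A" "set (map snd xs) \<subseteq> A"
    and "distinct (map fst xs)" "distinct (map snd xs)"
  shows "card {p. p permutes A \<and> (\<forall>(x, y)\<in>set xs. p x = y)} = fact (card A - length xs)"
proof -
  define g where "g x = the (map_of xs x)" for x
  have g: "g x = y" if "(x, y) \<in> set xs" for x y
    using that assms(4) by (simp add: g_def)
  have inj: "inj_on g (set (map fst xs))"
  proof (rule inj_onI)
    fix x x' assume "x \<in> set (map fst xs)" "x' \<in> set (map fst xs)" and e: "g x = g x'"
    then obtain y y' where y: "(x, y) \<in> set xs" "(x', y') \<in> set xs" by auto
    then have "y = y'" using e g by simp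
    then show "x = x'" using y assms(5)
      by (metis distinct_map fst_conv inj_on_contraD snd_conv)
  qed
  have im: "g ` set (map fst xs) \<subseteq> A"
    using assms(3) g by fastforce
  have "{p. p permutes A \<and> (\<forall>(x, y)\<in>set xs. p x = y)}
      = {p. p permutes A \<and> (\<forall>x\<in>set (map fst xs). p x = g x)}"
    by (auto simp: g)
  moreover have "card (set (map fst xs)) = length xs"
    using assms(4) distinct_card by fastforce
  ultimately show ?thesis
    using card_permutes_extending_on[OF assms(1,2) inj im] by simp
qed

section \<open>Hypermatchings and exploration states\<close>

text \<open>A revealed constraint; \<open>tup\<close> gives the index of each of its variables
  within the class of that position. The anchor is the position through which the constraint was
  queried: the only one chosen by the algorithm and not by chance.\<close>

datatype entry = Entry (matching: nat) (anchor: nat) (tup: "nat \<Rightarrow> nat") (flips: "nat set")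

locale hypermatchings =
  fixes k d m :: nat
  assumes k3: "3 \<le> k" and m_pos: "0 < m" and d_pos: "0 < d"
begin

text \<open>Class \<open>l\<close> occupies the \<open>m\<close> consecutive numbers from
  \<open>l * m\<close> on, so \<open>div m\<close> and \<open>mod m\<close> recover class and
  index.\<close>

definition var :: "entry \<Rightarrow> nat \<Rightarrow> nat" where
  "var e l = l * m + tup e l"

definition vars :: "entry \<Rightarrow> nat set" where
  "vars e = var e ` {..<k}"

abbreviation anchor_var :: "entry \<Rightarrow> nat" where
  "anchor_var e \<equiv> var e (anchor e)"

definition touched :: "entry list \<Rightarrow> nat set" where
  "touched s = (\<Union>e\<in>set s. vars e)"

definition hits :: "entry \<Rightarrow> entry list \<Rightarrow> nat set" where
  "hits e s = {l. l < k \<and> l \<noteq> anchor e \<and> var e l \<in> touched s}"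

text \<open>All variables of a colliding entry count, not only those that were hit: such an entry
  couples components in a way the labels do not record, so later arguments must leave all of it
  unshifted.\<close>

primrec collision_vars :: "entry list \<Rightarrow> nat set" where
  "collision_vars [] = {}"
| "collision_vars (e # s) = (if hits e s = {} then collision_vars s else collision_vars s \<union> vars e)"

definition free_slots :: "entry list \<Rightarrow> nat \<Rightarrow> nat \<Rightarrow> nat set" where
  "free_slots s j l = {..<m} - {tup e l | e. e \<in> set s \<and> matching e = j}"

definition tuple_choices :: "entry list \<Rightarrow> nat \<Rightarrow> nat \<Rightarrow> (nat \<Rightarrow> nat) set" where
  "tuple_choices s x j =
     PiE {..<k} (\<lambda>l. if l = x div m then {x mod m} else free_slots s j l)"

text \<open>The possible answers to a query at a variable not yet covered by matching
  \<open>j\<close>. By \<open>state_prob_extension\<close> a random instance makes them equally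
  likely.\<close>

definition extensions :: "entry list \<Rightarrow> nat \<Rightarrow> nat \<Rightarrow> entry set" where
  "extensions s x j = (\<lambda>(v, B). Entry j (x div m) v B) ` (tuple_choices s x j \<times> Pow {..<k})"

definition covers :: "nat \<Rightarrow> nat \<Rightarrow> entry \<Rightarrow> bool" where
  "covers x j e \<longleftrightarrow> matching e = j \<and> tup e (x div m) = x mod m"

inductive valid :: "entry list \<Rightarrow> bool" where
  Nil: "valid []"
| Cons: "valid s \<Longrightarrow> x < k * m \<Longrightarrow> j < d \<Longrightarrow> \<forall>e'\<in>set s. \<not> covers x j e' \<Longrightarrow>
    e \<in> extensions s x j \<Longrightarrow> valid (e # s)"

definition block :: "nat \<Rightarrow> nat set" where
  "block t = {t, Suc t mod k}"

definition linked :: "nat \<Rightarrow> nat \<Rightarrow> nat \<Rightarrow> bool" where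
  "linked t l l' \<longleftrightarrow> (l \<in> block t \<longleftrightarrow> l' \<in> block t)"

text \<open>States list the revealed constraints newest first; in typed states each carries its hidden type.
  A new variable in the block of the anchor joins the component of the anchor, except that a collision
  starts new components: what it correlates is accounted for by \<open>collision_vars\<close> instead.\<close>

primrec lab :: "(entry \<times> nat) list \<Rightarrow> nat \<Rightarrow> nat" where
  "lab [] u = 0"
| "lab (et # ls) u = (case et of (e, t) \<Rightarrow>
     if u \<in> vars e - touched (map fst ls) then
       if linked t (u div m) (anchor e) then
         if hits e (map fst ls) = {} \<and> anchor_var e \<in> touched (map fst ls)
         then lab ls (anchor_var e) else 2 * length ls
       else 2 * length ls + 1
     else lab ls u)"

text \<open>The number of steps from \<open>u\<close> back to the entry that founded its component,
  each step leading from a new variable to the anchor of its entry. Every step needs a type linking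
  the two positions, which makes large depths rare.\<close>

primrec open_depth :: "(entry \<times> nat) list \<Rightarrow> nat \<Rightarrow> nat" where
  "open_depth [] u = 0"
| "open_depth (et # ls) u = (case et of (e, t) \<Rightarrow>
     if u \<in> vars e - touched (map fst ls) then
       if linked t (u div m) (anchor e) \<and> hits e (map fst ls) = {} \<and>
          anchor_var e \<in> touched (map fst ls)
       then Suc (open_depth ls (anchor_var e)) else 0
     else open_depth ls u)"

text \<open>A single hit is harmless if its component can be shifted without touching the anchor or
  any earlier collision. The intersection with \<open>touched\<close> matters because
  \<open>lab\<close> gives untouched variables the default 0, which is also a genuine label.\<close>

definition benign :: "entry \<Rightarrow> (entry \<times> nat) list \<Rightarrow> bool" where
  "benign e ls \<longleftrightarrow> hits e (map fst ls) = {} \<or>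
     (\<exists>l. hits e (map fst ls) = {l} \<and>
        lab ls (var e l) \<notin> lab ls ` ((insert (anchor_var e) (collision_vars (map fst ls))) \<inter> touched (map fst ls)))"

primrec clean :: "(entry \<times> nat) list \<Rightarrow> bool" where
  "clean [] \<longleftrightarrow> True"
| "clean (et # ls) \<longleftrightarrow> clean ls \<and> benign (fst et) ls"

text \<open>The adjacency relation of the revealed constraints. It has a loop at every touched
  variable, so a path can be padded to any larger length.\<close>

definition comember :: "entry list \<Rightarrow> (nat \<times> nat) set" where
  "comember s = {(u, w). \<exists>e\<in>set s. u \<in> vars e \<and> w \<in> vars e}"

lemma touched_simps [simp]: "touched [] = {}" "touched (e # s) = vars e \<union> touched s"
  by (auto simp: touched_def)

lemma extensionsD:
  assumes "e \<in> extensions s x j" "x < k * m"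
  shows "matching e = j" "anchor e = x div m" "anchor e < k" "tup e \<in> tuple_choices s x j"
    "flips e \<subseteq> {..<k}" "tup e (x div m) = x mod m" "l < k \<Longrightarrow> tup e l < m"
    "tup e \<in> extensional {..<k}" "anchor_var e = x"
    "\<lbrakk>l < k; l \<noteq> x div m\<rbrakk> \<Longrightarrow> tup e l \<in> free_slots s j l"
proof -
  obtain v B where v: "v \<in> tuple_choices s x j" "B \<subseteq> {..<k}" and e: "e = Entry j (x div m) v B"
    using assms(1) by (auto simp: extensions_def)
  have x: "x div m < k" using assms(2) by (simp add: less_mult_imp_div_less)
  then have vx: "v (x div m) = x mod m"
    using PiE_mem[OF v(1)[unfolded tuple_choices_def], of "x div m"] by simp
  have fr: "v l \<in> free_slots s j l" if "l < k" "l \<noteq> x div m" for l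
    using PiE_mem[OF v(1)[unfolded tuple_choices_def], of l] that by simp
  show "matching e = j" "anchor e = x div m" "anchor e < k" "tup e \<in> tuple_choices s x j"
    "flips e \<subseteq> {..<k}" "tup e (x div m) = x mod m" "anchor_var e = x"
    using v vx x by (auto simp: e var_def)
  show "l < k \<Longrightarrow> tup e l < m"
    using vx fr[of l] m_pos by (cases "l = x div m") (auto simp: e free_slots_def)
  show "tup e \<in> extensional {..<k}"
    using v(1) by (auto simp: e tuple_choices_def PiE_def)
  show "\<lbrakk>l < k; l \<noteq> x div m\<rbrakk> \<Longrightarrow> tup e l \<in> free_slots s j l"
    using fr by (simp add: e)
qed

lemma valid_entry:
  assumes "valid s" "e \<in> set s"
  shows "matching e < d \<and> anchor e < k \<and> flips e \<subseteq> {..<k} \<and> tup e \<in> extensional {..<k} \<and> (\<forall>l<k. tup e l < m)"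
  using assms
proof (induction arbitrary: e)
  case (Cons s x j e')
  then show ?case using extensionsD[OF Cons.hyps(5,2)] by auto
qed simp

lemma var_div [simp]: "tup e l < m \<Longrightarrow> var e l div m = l"
  by (simp add: var_def)

lemma var_mod [simp]: "tup e l < m \<Longrightarrow> var e l mod m = tup e l"
  by (simp add: var_def)

lemma new_entry_disjoint:
  assumes "valid s" "x < k * m" "\<forall>e'\<in>set s. \<not> covers x j e'" "e \<in> extensions s x j"
    and "e' \<in> set s" "matching e' = j" "l < k"
  shows "tup e' l \<noteq> tup e l"
proof (cases "l = x div m")
  case True
  then show ?thesis using assms extensionsD(6)[OF assms(4,2)] by (auto simp: covers_def)
next
  case False
  then show ?thesis
    using extensionsD(10)[OF assms(4,2,7)] assms(5,6) by (auto simp: free_slots_def)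
qed

lemma valid_distinct_tups:
  assumes "valid s" "l < k"
  shows "distinct (map (\<lambda>e. (matching e, tup e l)) s)"
  using assms
proof induction
  case (Cons s x j e)
  then show ?case
    using new_entry_disjoint[OF Cons.hyps(1,2,4,5)] extensionsD(1)[OF Cons.hyps(5,2)] by fastforce
qed simp

lemma card_vars_le: "card (vars e) \<le> k"
  unfolding vars_def using card_image_le[of "{..<k}" "var e"] by simp

lemma finite_vars [simp]: "finite (vars e)"
  by (simp add: vars_def)

lemma finite_touched [simp]: "finite (touched s)"
  by (simp add: touched_def)

lemma card_touched_le: "card (touched s) \<le> k * length s"
proof (induction s)
  case (Cons e s)
  have "card (touched (e # s)) \<le> card (vars e) + card (touched s)"
    by (simp add: card_Un_le)
  then show ?case using Cons card_vars_le[of e] by simp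
qed simp

lemma collision_vars_subset: "collision_vars s \<subseteq> touched s"
  by (induction s) auto

text \<open>An entry founds at most two components, labelled by twice its position in the state and
  the next number. This bound is what makes those labels fresh.\<close>

lemma lab_less: "u \<in> touched (map fst ls) \<Longrightarrow> lab ls u < 2 * length ls"
proof (induction ls arbitrary: u)
  case (Cons et ls)
  obtain e t where [simp]: "et = (e, t)" by (cases et)
  show ?case
    using Cons.IH[of u] Cons.IH[of "anchor_var e"] Cons.prems by auto
qed simp

lemma lab_old:
  "u \<in> touched (map fst ls) \<Longrightarrow> lab (et # ls) u = lab ls u"
  by (auto split: prod.splits)

lemma open_depth_old:
  "u \<in> touched (map fst ls) \<Longrightarrow> open_depth (et # ls) u = open_depth ls u"
  by (auto split: prod.splits)

lemma comember_mono: "comember s \<subseteq> comember (e # s)"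
  by (auto simp: comember_def)

lemma relpow_mono_le:
  fixes R S :: "('b \<times> 'b) set"
  assumes "R \<subseteq> S"
  shows "R ^^ n \<subseteq> S ^^ n"
  by (induction n) (use assms in auto)

lemma comember_sym: "sym (comember s)"
  by (auto simp: comember_def sym_def)

lemma sym_relpow: "sym R \<Longrightarrow> (u, w) \<in> R ^^ n \<Longrightarrow> (w, u) \<in> R ^^ n"
proof (induction n arbitrary: u w)
  case (Suc n)
  then obtain v where "(u, v) \<in> R ^^ n" "(v, w) \<in> R" by auto
  then have "(v, u) \<in> R ^^ n" "(w, v) \<in> R" using Suc by (auto simp: sym_def)
  then show ?case by (meson relpow_Suc_I2)
qed simp

text \<open>Equal labels mean that both variables trace back, through anchors, to the same founding
  entry. The path climbs from \<open>u\<close>, crosses that entry in one step (the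
  \<open>+ 1\<close>) and descends to \<open>w\<close>; when the traces meet earlier, loops supply
  the missing steps.\<close>

lemma lab_eq_imp_near:
  assumes "valid (map fst ls)" "u \<in> touched (map fst ls)" "w \<in> touched (map fst ls)"
    and "lab ls u = lab ls w"
  shows "(u, w) \<in> comember (map fst ls) ^^ (open_depth ls u + open_depth ls w + 1)"
  using assms
proof (induction ls arbitrary: u w)
  case (Cons et ls)
  obtain e t where et [simp]: "et = (e, t)" by (cases et)
  let ?s = "map fst ls"
  have v: "valid ?s" using Cons.prems(1) by (auto elim: valid.cases)
  have ae: "anchor e < k" using valid_entry[OF Cons.prems(1), of e] by simp
  then have av: "anchor_var e \<in> vars e" by (simp add: vars_def)
  have new: "(u, w) \<in> comember (map fst (et # ls)) ^^ (open_depth (et # ls) u + open_depth (et # ls) w + 1)"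
    if u: "u \<in> vars e - touched ?s" and w: "w \<in> vars e \<union> touched ?s"
      and leq: "lab (et # ls) u = lab (et # ls) w" for u w
  proof (cases "linked t (u div m) (anchor e) \<and> hits e ?s = {} \<and> anchor_var e \<in> touched ?s")
    case True
    then have lu: "lab (et # ls) u = lab ls (anchor_var e)"
      and ou: "open_depth (et # ls) u = Suc (open_depth ls (anchor_var e))"
      using u by simp_all
    have w': "w \<in> touched ?s \<or> lab (et # ls) w = lab ls (anchor_var e)
        \<and> open_depth (et # ls) w = Suc (open_depth ls (anchor_var e)) \<and> w \<in> vars e"
    proof (cases "w \<in> touched ?s")
      case wt: False
      then have wv: "w \<in> vars e" using w by simp
      \<comment> \<open>An old label lies below the fresh ones, so a new \<open>w\<close> carrying
        it must be linked to the anchor as well.\<close>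
      have "lab ls (anchor_var e) < 2 * length ls" using lab_less True by blast
      then have "linked t (w div m) (anchor e)"
        using leq lu wt wv by (cases "linked t (w div m) (anchor e)") simp_all
      then show ?thesis
        using True wt wv by simp
    qed simp
    show ?thesis
    proof (cases "w \<in> touched ?s")
      case wt: True
      then have "lab ls (anchor_var e) = lab ls w"
        using leq lu lab_old[OF wt, of et] by simp
      then have "(anchor_var e, w) \<in> comember ?s ^^ (open_depth ls (anchor_var e) + open_depth ls w + 1)"
        using Cons.IH v True wt by blast
      then have "(anchor_var e, w) \<in> comember (e # ?s) ^^ (open_depth ls (anchor_var e) + open_depth ls w + 1)"
        using relpow_mono_le[OF comember_mono] by blast
      moreover have "(u, anchor_var e) \<in> comember (e # ?s)"
        using u av by (auto simp: comember_def)
      ultimately have "(u, w) \<in> comember (e # ?s) ^^ Suc (open_depth ls (anchor_var e) + open_depth ls w + 1)"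
        by (meson relpow_Suc_I2)
      then show ?thesis using ou open_depth_old[OF wt, of et] by simp
    next
      case False
      then have *: "open_depth (et # ls) w = Suc (open_depth ls (anchor_var e))" "w \<in> vars e"
        using w' False by blast+
      have uw: "(u, w) \<in> comember (e # ?s)" using u * by (auto simp: comember_def)
      have uu: "(u, u) \<in> comember (e # ?s)" using u by (auto simp: comember_def)
      have "(u, u) \<in> comember (e # ?s) ^^ n" for n
        by (induction n) (use uu in auto)
      then have "(u, w) \<in> comember (e # ?s) ^^ Suc n" for n
        using uw by auto
      then show ?thesis by simp
    qed
  next
    case False
    then have lu: "lab (et # ls) u \<ge> 2 * length ls"
      using u by auto
    then have wn: "w \<notin> touched ?s" using leq lab_less[of w ls] lab_old[of w ls et] by auto
    have uw: "(u, w) \<in> comember (e # ?s)" using u w wn by (auto simp: comember_def)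
    have uu: "(u, u) \<in> comember (e # ?s)" using u by (auto simp: comember_def)
    have "(u, u) \<in> comember (e # ?s) ^^ n" for n
      by (induction n) (use uu in auto)
    then have "(u, w) \<in> comember (e # ?s) ^^ Suc n" for n
      using uw by auto
    then show ?thesis by simp
  qed
  consider "u \<in> vars e - touched ?s" | "w \<in> vars e - touched ?s" | "u \<in> touched ?s" "w \<in> touched ?s"
    using Cons.prems(2,3) by auto
  then show ?case
  proof cases
    case 1
    then show ?thesis using new[of u w] Cons.prems by simp
  next
    case 2
    then have "(w, u) \<in> comember (map fst (et # ls)) ^^ (open_depth (et # ls) w + open_depth (et # ls) u + 1)"
      using new[of w u] Cons.prems by simp
    then show ?thesis
      by (metis sym_relpow[OF comember_sym] add.commute)
  next
    case 3
    have "(u, w) \<in> comember ?s ^^ (open_depth ls u + open_depth ls w + 1)"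
      using Cons.IH[OF v 3] Cons.prems(4) lab_old[OF 3(1), of et] lab_old[OF 3(2), of et] by simp
    then have "(u, w) \<in> comember (e # ?s) ^^ (open_depth ls u + open_depth ls w + 1)"
      using relpow_mono_le[OF comember_mono] by blast
    then show ?thesis
      using open_depth_old[OF 3(1), of et] open_depth_old[OF 3(2), of et] by simp
  qed
qed simp

text \<open>An entry without collision gives one label to the block of its anchor and one to the
  rest. Absence of a collision is expressed by \<open>vars e\<close> not lying inside
  \<open>collision_vars s\<close>, a condition that passes to shorter states in the
  induction.\<close>

lemma lab_constant_on_blocks:
  assumes "valid s" "e \<in> set s" "map fst ls = s" "\<not> vars e \<subseteq> collision_vars s"
    and "(e, t) \<in> set ls" "l < k" "l' < k" "linked t l l'"
  shows "lab ls (var e l) = lab ls (var e l')"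
  using assms
proof (induction ls arbitrary: s)
  case (Cons et ls)
  let ?s = "map fst ls"
  obtain e1 t1 where et: "et = (e1, t1)" by (cases et)
  have s: "s = e1 # ?s" using Cons.prems(3) et by simp
  have v: "valid ?s" using Cons.prems(1) s by (auto elim: valid.cases)
  have vin: "var e l \<in> vars e" "var e l' \<in> vars e" using Cons.prems(6,7) by (auto simp: vars_def)
  show ?case
  proof (cases "(e, t) \<in> set ls")
    case True
    then have e: "e \<in> set ?s" by force
    have "\<not> vars e \<subseteq> collision_vars ?s" using Cons.prems(4) s by (auto split: if_splits)
    then have "lab ls (var e l) = lab ls (var e l')"
      using Cons.IH[OF v e refl _ True] Cons.prems(6,7,8) by blast
    moreover have "var e l \<in> touched ?s" "var e l' \<in> touched ?s"
      using e vin by (auto simp: touched_def)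
    ultimately show ?thesis using lab_old by metis
  next
    case False
    then have e: "e1 = e" "t1 = t" using Cons.prems(5) et by auto
    have h: "hits e ?s = {}" using Cons.prems(4) s e by (auto split: if_splits)
    have ve: "\<forall>l<k. tup e l < m" "anchor e < k" using valid_entry[OF Cons.prems(1,2)] by auto
    have old: "var e i \<in> touched ?s \<longleftrightarrow> i = anchor e \<and> anchor_var e \<in> touched ?s" if "i < k" for i
      using h that by (auto simp: hits_def)
    have L: "lab (et # ls) (var e i) = (if linked t i (anchor e) then
        if anchor_var e \<in> touched ?s then lab ls (anchor_var e) else 2 * length ls
        else 2 * length ls + 1)" if i: "i < k" for i
    proof -
      have "var e i div m = i" using ve i by simp
      moreover have "var e i \<in> vars e" using i by (simp add: vars_def)
      moreover have "linked t i i" by (simp add: linked_def)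
      ultimately show ?thesis using old[OF i] h by (auto simp: et e)
    qed
    have "linked t l (anchor e) \<longleftrightarrow> linked t l' (anchor e)"
      using Cons.prems(8) by (auto simp: linked_def)
    then show ?thesis using L Cons.prems(6,7) by simp
  qed
qed simp

end

section \<open>Uniformity of planted negations\<close>

text \<open>The toggles reach the empty set from every \<open>B\<close>: if \<open>r\<close> belongs
  to \<open>B\<close>, toggling \<open>K\<close> removes it, and the remaining elements differ from
  \<open>r\<close> and go one at a time.\<close>

lemma sym_diff_invariant_imp_const:
  fixes h :: "'b set \<Rightarrow> 'c"
  assumes fin: "finite U" and r: "r \<in> K" "K \<subseteq> U"
    and K: "\<And>B. B \<subseteq> U \<Longrightarrow> h (sym_diff B K) = h B"
    and single: "\<And>B l. B \<subseteq> U \<Longrightarrow> l \<in> U \<Longrightarrow> l \<noteq> r \<Longrightarrow> h (sym_diff B {l}) = h B"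
    and B: "B \<subseteq> U"
  shows "h B = h {}"
proof -
  have avoid: "h F = h {}" if "finite F" "F \<subseteq> U - {r}" for F
    using that
  proof induction
    case (insert x F)
    then have "sym_diff F {x} = insert x F" by auto
    then show ?case using single[of F x] insert by auto
  qed simp
  show ?thesis
  proof (cases "r \<in> B")
    case True
    have "sym_diff B K \<subseteq> U - {r}" using True r B by auto
    moreover from this have "finite (sym_diff B K)" using fin by (meson finite_Diff finite_subset)
    ultimately show ?thesis using avoid K[OF B] by metis
  next
    case False
    then have "B \<subseteq> U - {r}" using B by auto
    then show ?thesis using avoid fin B finite_subset by metis
  qed
qed

locale planted_hypermatchings = hypermatchings +
  fixes z :: "nat \<Rightarrow> nat \<Rightarrow> bool"
begin

definition coin :: "nat \<Rightarrow> bool \<times> bool \<Rightarrow> nat \<Rightarrow> bool" where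
  "coin t c l = (if l \<in> block t then fst c else snd c)"

definition planted_flips :: "nat set \<Rightarrow> entry \<Rightarrow> nat \<Rightarrow> bool \<times> bool \<Rightarrow> nat set" where
  "planted_flips a e t c = {l. l < k \<and> ((var e l \<in> a) \<noteq> (z t l \<noteq> coin t c l))}"

text \<open>Four times the probability, over the two coins, that the planted negations of
  \<open>e\<close> are \<open>B\<close>. Accordingly \<open>weight\<close> is an unnormalised
  probability of all negations of a state, given assignment and types.\<close>

definition coin_choices :: "nat set \<Rightarrow> entry \<Rightarrow> nat \<Rightarrow> nat set \<Rightarrow> nat" where
  "coin_choices a e t B = card {c. planted_flips a e t c = B}"

definition weight :: "nat set \<Rightarrow> (entry \<times> nat) list \<Rightarrow> nat" where
  "weight a ls = prod_list (map (\<lambda>(e, t). coin_choices a e t (flips e)) ls)"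

lemma planted_flips_shift:
  "planted_flips (sym_diff a X) e t c = sym_diff (planted_flips a e t c) {l. l < k \<and> var e l \<in> X}"
  by (auto simp: planted_flips_def)

lemma coin_choices_shift:
  assumes "F = {l. l < k \<and> var e l \<in> X}"
  shows "coin_choices (sym_diff a X) e t (sym_diff B F) = coin_choices a e t B"
proof -
  have "sym_diff A F = sym_diff B F \<longleftrightarrow> A = B" for A by auto
  then show ?thesis
    unfolding coin_choices_def planted_flips_shift assms[symmetric] by simp
qed

text \<open>Adding \<open>f\<close> to the pair of coins is an involution on the outcomes and
  changes the planted negations by exactly \<open>f'\<close>. Hence a whole block can be toggled for
  free.\<close>

lemma coin_choices_coin_flip:
  assumes "f' = {l. l < k \<and> coin t f l}"
  shows "coin_choices a e t (sym_diff B f') = coin_choices a e t B"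
proof -
  define g where "g c = (fst c \<noteq> fst f, snd c \<noteq> snd f)" for c :: "bool \<times> bool"
  have g: "planted_flips a e t (g c) = sym_diff (planted_flips a e t c) f'" for c
    by (auto simp: planted_flips_def g_def coin_def assms split: if_splits)
  have gg: "g (g c) = c" for c by (cases c) (auto simp: g_def)
  have iff: "planted_flips a e t (g c) = sym_diff B f' \<longleftrightarrow> planted_flips a e t c = B" for c
    unfolding g by auto
  have "bij_betw g {c. planted_flips a e t c = B} {c. planted_flips a e t c = sym_diff B f'}"
  proof (rule bij_betwI[where g = g])
    show "g \<in> {c. planted_flips a e t c = B} \<rightarrow> {c. planted_flips a e t c = sym_diff B f'}"
      using iff by blast
    show "g \<in> {c. planted_flips a e t c = sym_diff B f'} \<rightarrow> {c. planted_flips a e t c = B}"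
    proof
      fix c assume "c \<in> {c. planted_flips a e t c = sym_diff B f'}"
      then show "g c \<in> {c. planted_flips a e t c = B}"
        using iff[of "g c"] unfolding gg by simp
    qed
  qed (simp_all add: gg)
  then show ?thesis
    unfolding coin_choices_def by (rule bij_betw_same_card[symmetric])
qed

text \<open>A shift of the assignment that is constant on each block of \<open>e\<close> can be
  undone by the coins of \<open>e\<close>.\<close>

lemma coin_choices_blockwise_shift:
  assumes "\<And>l l'. l < k \<Longrightarrow> l' < k \<Longrightarrow> linked t l l' \<Longrightarrow> var e l \<in> X \<longleftrightarrow> var e l' \<in> X"
  shows "coin_choices (sym_diff a X) e t B = coin_choices a e t B"
proof -
  define F where "F = {l. l < k \<and> var e l \<in> X}"
  define f where "f = (\<exists>l<k. l \<in> block t \<and> var e l \<in> X, \<exists>l<k. l \<notin> block t \<and> var e l \<in> X)"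
  have "F = {l. l < k \<and> coin t f l}"
    using assms by (auto simp: F_def f_def coin_def linked_def)
  then have "coin_choices (sym_diff a X) e t (sym_diff B F) = coin_choices (sym_diff a X) e t B"
    by (rule coin_choices_coin_flip)
  then show ?thesis using coin_choices_shift[OF F_def, of a t B] by simp
qed

lemma sum_coin_choices: "(\<Sum>B\<in>Pow {..<k}. coin_choices a e t B) = 4"
proof -
  have "(\<Sum>B\<in>Pow {..<k}. coin_choices a e t B) = card (\<Union>B\<in>Pow {..<k}. {c. planted_flips a e t c = B})"
    unfolding coin_choices_def by (subst card_UN_disjoint) auto
  also have "(\<Union>B\<in>Pow {..<k}. {c. planted_flips a e t c = B}) = UNIV"
  proof -
    have "planted_flips a e t c \<subseteq> {..<k}" for c by (auto simp: planted_flips_def)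
    then show ?thesis by blast
  qed
  also have "card (UNIV :: (bool \<times> bool) set) = 4"
    by (simp add: card_UNIV_bool flip: UNIV_Times_UNIV)
  finally show ?thesis .
qed

lemma var_less:
  assumes "l < k" "tup e l < m"
  shows "var e l < k * m"
proof -
  have "var e l < Suc l * m" using assms(2) by (simp add: var_def)
  also have "\<dots> \<le> k * m" using assms(1) by (intro mult_le_mono1) simp
  finally show ?thesis .
qed

lemma touched_subset: "valid s \<Longrightarrow> touched s \<subseteq> {..<k * m}"
  using valid_entry var_less by (fastforce simp: touched_def vars_def)

lemma weight_shift:
  assumes "\<And>e t l l'. (e, t) \<in> set ls \<Longrightarrow> l < k \<Longrightarrow> l' < k \<Longrightarrow> linked t l l' \<Longrightarrow> var e l \<in> X \<longleftrightarrow> var e l' \<in> X"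
  shows "weight (sym_diff a X) ls = weight a ls"
proof -
  have "coin_choices (sym_diff a X) e t (flips e) = coin_choices a e t (flips e)" if "(e, t) \<in> set ls" for e t
    using assms[OF that] by (rule coin_choices_blockwise_shift)
  then show ?thesis
    unfolding weight_def by (intro arg_cong[where f = prod_list] map_cong) auto
qed

text \<open>If the variable at \<open>l\<close> is new, no past entry sees it and it is shifted
  alone. Otherwise its whole component is shifted: this is a union of blocks on entries without
  collision and misses the colliding entries, and benignity keeps both the anchor and any second hit
  out of it.\<close>

lemma shift_class_exists:
  assumes v: "valid (e # map fst ls)" and b: "benign e ls" and l: "l < k" "l \<noteq> anchor e"
  obtains X where "X \<subseteq> {..<k * m}" "\<And>a. weight (sym_diff a X) ls = weight a ls"
    "{l'. l' < k \<and> var e l' \<in> X} = {l}"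
proof -
  let ?s = "map fst ls"
  have vs: "valid ?s" using v by (auto elim: valid.cases)
  have e: "anchor e < k" "\<And>l. l < k \<Longrightarrow> tup e l < m" using valid_entry[OF v, of e] by auto
  have inj: "l1 = l2" if "l1 < k" "l2 < k" "var e l1 = var e l2" for l1 l2
    using that var_div[OF e(2)] by metis
  show thesis
  proof (cases "var e l \<in> touched ?s")
    case False
    show thesis
    proof (rule that[of "{var e l}"])
      show "{var e l} \<subseteq> {..<k * m}" using var_less l e by simp
      show "weight (sym_diff a {var e l}) ls = weight a ls" for a
      proof (rule weight_shift)
        fix e' t i i' assume "(e', t) \<in> set ls" "i < k" "i' < k"
        then have "var e' i \<in> touched ?s" "var e' i' \<in> touched ?s"
          by (force simp: touched_def vars_def)+
        then show "var e' i \<in> {var e l} \<longleftrightarrow> var e' i' \<in> {var e l}" using False by auto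
      qed
      show "{l'. l' < k \<and> var e l' \<in> {var e l}} = {l}" using inj l by auto
    qed
  next
    case True
    then have lh: "l \<in> hits e ?s" using l by (simp add: hits_def)
    then have h: "hits e ?s = {l}"
      and nl: "lab ls (var e l) \<notin> lab ls ` (insert (anchor_var e) (collision_vars ?s) \<inter> touched ?s)"
      using b by (auto simp: benign_def)
    define X where "X = {u \<in> touched ?s. lab ls u = lab ls (var e l)}"
    show thesis
    proof (rule that[of X])
      show "X \<subseteq> {..<k * m}" using touched_subset[OF vs] by (auto simp: X_def)
      show "weight (sym_diff a X) ls = weight a ls" for a
      proof (rule weight_shift)
        fix e' t i i' assume e': "(e', t) \<in> set ls" and i: "i < k" "i' < k" "linked t i i'"
        then have es: "e' \<in> set ?s" by force
        have vt: "var e' i \<in> touched ?s" "var e' i' \<in> touched ?s"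
          using es i by (auto simp: touched_def vars_def)
        show "var e' i \<in> X \<longleftrightarrow> var e' i' \<in> X"
        proof (cases "vars e' \<subseteq> collision_vars ?s")
          case True
          then have c: "var e' i \<in> collision_vars ?s" "var e' i' \<in> collision_vars ?s"
            using i by (auto simp: vars_def)
          have "lab ls u \<noteq> lab ls (var e l)" if "u \<in> collision_vars ?s" for u
          proof
            assume "lab ls u = lab ls (var e l)"
            moreover have "u \<in> insert (anchor_var e) (collision_vars ?s) \<inter> touched ?s"
              using that collision_vars_subset[of ?s] by blast
            ultimately show False using nl by (metis imageI)
          qed
          then show ?thesis using c by (auto simp: X_def)
        next
          case False
          then have "lab ls (var e' i) = lab ls (var e' i')"
            using lab_constant_on_blocks[OF vs es refl] e' i by blast
          then show ?thesis using vt by (simp add: X_def)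
        qed
      qed
      show "{l'. l' < k \<and> var e l' \<in> X} = {l}"
      proof -
        have "l' = l" if "l' < k" "var e l' \<in> X" for l'
        proof (rule ccontr)
          assume "l' \<noteq> l"
          then have "l' = anchor e" using that h by (auto simp: hits_def X_def)
          then show False using that nl by (auto simp: X_def)
        qed
        moreover have "var e l \<in> X" using True by (simp add: X_def)
        ultimately show ?thesis using l(1) by blast
      qed
    qed
  qed
qed

text \<open>Conditioned on types that keep the state clean, the planted negations are exactly
  uniform: summed over assignments, each entry contributes the factor \<open>4 / 2 ^ k\<close>, as
  if its negations were \<open>k\<close> fair bits.\<close>

theorem planted_count:
  assumes "valid (map fst ls)" "clean ls"
  shows "(\<Sum>a\<in>Pow {..<k * m}. weight a ls) * 2 ^ (k * length ls) = 2 ^ (k * m) * 4 ^ length ls"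
  using assms
proof (induction ls)
  case Nil
  then show ?case by (simp add: weight_def card_Pow)
next
  case (Cons et ls)
  obtain e t where et [simp]: "et = (e, t)" by (cases et)
  have v: "valid (e # map fst ls)" and b: "benign e ls" and c: "clean ls"
    using Cons.prems by auto
  have vs: "valid (map fst ls)" using v by (auto elim: valid.cases)
  have ve: "anchor e < k" "flips e \<subseteq> {..<k}" using valid_entry[OF v, of e] by auto
  \<comment> \<open>The total weight of the assignments that explain the past together with the
    negations \<open>B\<close> of the new entry; the goal is that this does not depend on
    \<open>B\<close>.\<close>
  define h where "h B = (\<Sum>a\<in>Pow {..<k * m}. weight a ls * coin_choices a e t B)" for B
  have single: "h (sym_diff B {l}) = h B" if l: "l < k" "l \<noteq> anchor e" for B l
  proof -
    obtain X where X: "X \<subseteq> {..<k * m}" "\<And>a. weight (sym_diff a X) ls = weight a ls"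
      "{l'. l' < k \<and> var e l' \<in> X} = {l}"
      by (rule shift_class_exists[OF v b l]) (rule that)
    have "h B = (\<Sum>a\<in>Pow {..<k * m}. weight (sym_diff a X) ls * coin_choices (sym_diff a X) e t (sym_diff B {l}))"
      unfolding h_def X(2) coin_choices_shift[OF X(3)[symmetric]] ..
    also have "\<dots> = h (sym_diff B {l})"
      unfolding h_def
      by (rule sum.reindex_bij_witness[where i = "\<lambda>a. sym_diff a X" and j = "\<lambda>a. sym_diff a X"])
        (use X(1) in auto)
    finally show ?thesis by simp
  qed
  \<comment> \<open>The anchor may be tied to the past, so its bit is toggled by a coin of the new
    entry, at the price of toggling its whole block.\<close>
  define K where "K = {l. l < k \<and> linked t l (anchor e)}"
  have "K = {l. l < k \<and> coin t (anchor e \<in> block t, anchor e \<notin> block t) l}"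
    by (auto simp: K_def coin_def linked_def)
  then have "coin_choices a e t (sym_diff B K) = coin_choices a e t B" for a B
    by (rule coin_choices_coin_flip)
  then have hK: "h (sym_diff B K) = h B" for B by (simp add: h_def)
  have const: "h B = h {}" if "B \<subseteq> {..<k}" for B
  proof (rule sym_diff_invariant_imp_const[where U = "{..<k}" and K = K and r = "anchor e"])
    show "anchor e \<in> K" "K \<subseteq> {..<k}" using ve by (auto simp: K_def linked_def)
  qed (use that single hK in auto)
  have "2 ^ k * h (flips e) = (\<Sum>B\<in>Pow {..<k}. h B)"
  proof -
    have "(\<Sum>B\<in>Pow {..<k}. h B) = (\<Sum>B\<in>Pow {..<k}. h {})"
      by (rule sum.cong[OF refl], rule const) blast
    then show ?thesis by (simp add: card_Pow const[OF ve(2)])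
  qed
  also have "\<dots> = (\<Sum>a\<in>Pow {..<k * m}. weight a ls * (\<Sum>B\<in>Pow {..<k}. coin_choices a e t B))"
    unfolding h_def by (subst sum.swap) (simp add: sum_distrib_left)
  also have "\<dots> = 4 * (\<Sum>a\<in>Pow {..<k * m}. weight a ls)"
    by (simp add: sum_coin_choices sum_distrib_left mult.commute)
  finally have step: "2 ^ k * h (flips e) = 4 * (\<Sum>a\<in>Pow {..<k * m}. weight a ls)" .
  have "(\<Sum>a\<in>Pow {..<k * m}. weight a (et # ls)) = h (flips e)"
    by (simp add: h_def weight_def mult.commute)
  then have "(\<Sum>a\<in>Pow {..<k * m}. weight a (et # ls)) * 2 ^ (k * length (et # ls))
      = (2 ^ k * h (flips e)) * 2 ^ (k * length ls)"
    by (simp add: power_add ac_simps)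
  also have "\<dots> = 4 * ((\<Sum>a\<in>Pow {..<k * m}. weight a ls) * 2 ^ (k * length ls))"
    unfolding step by simp
  also have "\<dots> = 2 ^ (k * m) * 4 ^ length (et # ls)"
    using Cons.IH[OF vs c] by simp
  finally show ?case .
qed

end

section \<open>Bounds on the correlated part of a state\<close>

definition avg :: "'b set \<Rightarrow> ('b \<Rightarrow> real) \<Rightarrow> real" where
  "avg A f = (\<Sum>x\<in>A. f x) / real (card A)"

lemma avg_mono: "(\<And>x. x \<in> A \<Longrightarrow> f x \<le> g x) \<Longrightarrow> avg A f \<le> avg A g"
  unfolding avg_def by (intro divide_right_mono sum_mono) auto

lemma avg_cong: "(\<And>x. x \<in> A \<Longrightarrow> f x = g x) \<Longrightarrow> avg A f = avg A g"
  unfolding avg_def by simp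

lemma avg_add: "avg A (\<lambda>x. f x + g x) = avg A f + avg A g"
  by (simp add: avg_def sum.distrib add_divide_distrib)

lemma avg_cmult: "avg A (\<lambda>x. c * f x) = c * avg A f"
  by (simp add: avg_def sum_distrib_left)

lemma avg_const: "finite A \<Longrightarrow> A \<noteq> {} \<Longrightarrow> avg A (\<lambda>x. c) = c"
  by (simp add: avg_def)

lemma avg_sum: "avg A (\<lambda>x. \<Sum>i\<in>I. f i x) = (\<Sum>i\<in>I. avg A (f i))"
  unfolding avg_def by (subst sum.swap) (simp add: sum_divide_distrib)

lemma avg_of_bool: "finite A \<Longrightarrow> avg A (\<lambda>x. of_bool (P x)) = real (card {x \<in> A. P x}) / real (card A)"
  by (simp add: avg_def sum.If_cases of_bool_def Int_def)

lemma sum_Int_le_card: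
  fixes T :: "nat set"
  assumes "finite T" "finite I"
  shows "(\<Sum>l\<in>I. card {u \<in> T. g u = l}) \<le> card T"
proof -
  have "(\<Sum>l\<in>I. card {u \<in> T. g u = l}) = card (\<Union>l\<in>I. {u \<in> T. g u = l})"
    using assms by (subst card_UN_disjoint) auto
  also have "\<dots> \<le> card T"
    by (rule card_mono[OF assms(1)]) auto
  finally show ?thesis .
qed

context hypermatchings
begin

primrec type_avg :: "entry list \<Rightarrow> ((entry \<times> nat) list \<Rightarrow> real) \<Rightarrow> real" where
  "type_avg [] F = F []"
| "type_avg (e # s) F = (\<Sum>t<k. type_avg s (\<lambda>ls. F ((e, t) # ls))) / real k"

lemma type_avg_mono:
  "(\<And>ls. map fst ls = s \<Longrightarrow> F ls \<le> G ls) \<Longrightarrow> type_avg s F \<le> type_avg s G"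
proof (induction s arbitrary: F G)
  case (Cons e s)
  show ?case
    unfolding type_avg.simps by (intro divide_right_mono sum_mono Cons.IH Cons.prems) auto
qed simp

lemma type_avg_cong:
  "(\<And>ls. map fst ls = s \<Longrightarrow> F ls = G ls) \<Longrightarrow> type_avg s F = type_avg s G"
  by (intro order_antisym type_avg_mono) auto

lemma type_avg_const [simp]: "type_avg s (\<lambda>ls. c) = c"
  using k3 by (induction s) auto

lemma type_avg_add: "type_avg s (\<lambda>ls. F ls + G ls) = type_avg s F + type_avg s G"
  by (induction s arbitrary: F G) (auto simp: sum.distrib add_divide_distrib)

lemma type_avg_cmult: "type_avg s (\<lambda>ls. c * F ls) = c * type_avg s F"
  by (induction s arbitrary: F) (auto simp: sum_distrib_left)

lemma type_avg_sum:
  "finite I \<Longrightarrow> type_avg s (\<lambda>ls. \<Sum>i\<in>I. F i ls) = (\<Sum>i\<in>I. type_avg s (F i))"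
  by (induction I rule: finite_induct) (auto simp: type_avg_add)

lemma type_avg_avg:
  "finite A \<Longrightarrow> type_avg s (\<lambda>ls. avg A (\<lambda>x. F x ls)) = avg A (\<lambda>x. type_avg s (F x))"
  unfolding avg_def using type_avg_cmult[of s "1 / real (card A)"] by (simp add: type_avg_sum)

definition lam :: real where "lam = 1 - 1 / real k"

lemma lam_bounds: "0 < lam" "lam < 1"
  using k3 by (auto simp: lam_def)

text \<open>Some type separates the two positions: \<open>t = l\<close> unless \<open>l'\<close> is
  the cyclic successor of \<open>l\<close>, and then the predecessor of \<open>l\<close>, which
  differs from \<open>l'\<close> because \<open>k\<close> is at least 3.\<close>

lemma card_linked_le:
  assumes "l < k" "l' < k" "l \<noteq> l'"
  shows "card {t. t < k \<and> linked t l l'} \<le> k - 1"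
proof -
  have "\<exists>t<k. \<not> linked t l l'"
  proof (cases "l' = Suc l mod k")
    case False
    then show ?thesis using assms by (intro exI[of _ l]) (auto simp: linked_def block_def)
  next
    case True
    define t where "t = (if l = 0 then k - 1 else l - 1)"
    have t: "t < k" "Suc t mod k = l" using assms by (auto simp: t_def)
    have "l' \<noteq> t"
      using True assms k3 by (cases "Suc l = k") (auto simp: t_def)
    then show ?thesis using t assms by (intro exI[of _ t]) (auto simp: linked_def block_def)
  qed
  then obtain t where "t < k" "\<not> linked t l l'" by blast
  then have "{t. t < k \<and> linked t l l'} \<subseteq> {..<k} - {t}" by auto
  then have "card {t. t < k \<and> linked t l l'} \<le> card ({..<k} - {t})" by (rule card_mono[rotated]) simp
  then show ?thesis using \<open>t < k\<close> by simp
qed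

text \<open>Each further step requires the type of one entry to link a position to a different one,
  the anchor. This has probability at most \<open>lam\<close> and is independent of the types of the
  earlier entries, which govern the rest of the path.\<close>

lemma open_depth_tail:
  assumes "valid s"
  shows "type_avg s (\<lambda>ls. of_bool (R \<le> open_depth ls u)) \<le> lam ^ R"
  using assms
proof (induction s arbitrary: u R rule: list.induct)
  case Nil
  then show ?case using lam_bounds by (cases R) auto
next
  case (Cons e s)
  have v: "valid s" using Cons.prems by (auto elim: valid.cases)
  show ?case
  proof (cases "u \<in> vars e - touched s")
    case False
    have "type_avg (e # s) (\<lambda>ls. of_bool (R \<le> open_depth ls u))
        = (\<Sum>t<k. type_avg s (\<lambda>ls. of_bool (R \<le> open_depth ls u))) / real k"
      unfolding type_avg.simps using False
      by (intro arg_cong2[where f = "(/)"] refl sum.cong type_avg_cong) auto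
    then show ?thesis using Cons.IH[OF v, of R u] k3 by simp
  next
    case new: True
    show ?thesis
    proof (cases R)
      case 0
      then show ?thesis by (simp del: type_avg.simps)
    next
      case (Suc R')
      show ?thesis
      proof (cases "hits e s = {} \<and> anchor_var e \<in> touched s")
        case False
        have "type_avg (e # s) (\<lambda>ls. of_bool (R \<le> open_depth ls u)) = type_avg (e # s) (\<lambda>ls. 0)"
          unfolding type_avg.simps using False new Suc
          by (intro arg_cong2[where f = "(/)"] refl sum.cong type_avg_cong) auto
        then show ?thesis using lam_bounds by (simp del: type_avg.simps)
      next
        case True
        obtain l where l: "l < k" "u = var e l" using new by (auto simp: vars_def)
        have ve: "anchor e < k" "tup e l < m" using valid_entry[OF Cons.prems, of e] l by auto
        have ul: "u div m = l" using ve l by simp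
        have ne: "l \<noteq> anchor e" using True new l by auto
        have "type_avg (e # s) (\<lambda>ls. of_bool (R \<le> open_depth ls u))
          = (\<Sum>t<k. of_bool (linked t l (anchor e)) * type_avg s (\<lambda>ls. of_bool (R' \<le> open_depth ls (anchor_var e)))) / real k"
          unfolding type_avg.simps type_avg_cmult[symmetric] using True new Suc ul
          by (intro arg_cong2[where f = "(/)"] refl sum.cong type_avg_cong) auto
        also have "\<dots> = real (card {t. t < k \<and> linked t l (anchor e)}) / real k
            * type_avg s (\<lambda>ls. of_bool (R' \<le> open_depth ls (anchor_var e)))"
          by (simp add: sum_distrib_right[symmetric] of_bool_def sum.If_cases Int_def)
        also have "\<dots> \<le> lam * lam ^ R'"
        proof (rule mult_mono)
          have "real (card {t. t < k \<and> linked t l (anchor e)}) \<le> real k - 1"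
            using card_linked_le[OF l(1) ve(1) ne] k3 by linarith
          then show "real (card {t. t < k \<and> linked t l (anchor e)}) / real k \<le> lam"
            using k3 by (simp add: lam_def field_simps)
          show "0 \<le> type_avg s (\<lambda>ls. of_bool (R' \<le> open_depth ls (anchor_var e)))"
            using type_avg_mono[of s "\<lambda>_. 0"] by simp
        qed (use Cons.IH[OF v] lam_bounds in auto)
        finally show ?thesis by (simp add: Suc)
      qed
    qed
  qed
qed

text \<open>Entries of one matching are disjoint, so the entries through \<open>w\<close> belong to
  different matchings.\<close>

lemma card_covering_le:
  assumes "valid s"
  shows "card {e \<in> set s. w \<in> vars e} \<le> d"
proof -
  have "inj_on matching {e \<in> set s. w \<in> vars e}"
  proof (rule inj_onI)
    fix e e' assume e: "e \<in> {e \<in> set s. w \<in> vars e}" "e' \<in> {e \<in> set s. w \<in> vars e}"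
      and eq: "matching e = matching e'"
    then obtain l l' where l: "l < k" "w = var e l" "l' < k" "w = var e' l'"
      by (auto simp: vars_def)
    have "tup e l < m" "tup e' l' < m" using valid_entry[OF assms] e l by auto
    then have "l = l'" "tup e l = tup e' l" using l var_div var_mod by metis+
    then have "(matching e, tup e l) = (matching e', tup e' l)" using eq by simp
    then show "e = e'"
      using valid_distinct_tups[OF assms l(1)] e unfolding distinct_map inj_on_def by blast
  qed
  then have "card {e \<in> set s. w \<in> vars e} \<le> card {..<d}"
    by (rule card_inj_on_le) (use valid_entry[OF assms] in auto)
  then show ?thesis by simp
qed

lemma card_comember_Image:
  assumes "valid s"
  shows "card (comember s `` {w}) \<le> k * d"
proof -
  have "comember s `` {w} = (\<Union>e\<in>{e \<in> set s. w \<in> vars e}. vars e)"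
    by (auto simp: comember_def)
  also have "card \<dots> \<le> (\<Sum>e\<in>{e \<in> set s. w \<in> vars e}. card (vars e))"
    by (rule card_UN_le) simp
  also have "\<dots> \<le> (\<Sum>e\<in>{e \<in> set s. w \<in> vars e}. k)"
    by (rule sum_mono) (rule card_vars_le)
  also have "\<dots> \<le> k * d"
    using card_covering_le[OF assms, of w] by simp
  finally show ?thesis .
qed

lemma finite_comember: "finite (comember s)"
proof -
  have "comember s \<subseteq> touched s \<times> touched s" by (auto simp: comember_def touched_def)
  then show ?thesis by (rule finite_subset) simp
qed

lemma card_relpow_Image:
  assumes "valid s"
  shows "finite ((comember s ^^ n) `` {w}) \<and> card ((comember s ^^ n) `` {w}) \<le> (k * d) ^ n"
proof (induction n)
  case (Suc n)
  let ?A = "(comember s ^^ n) `` {w}"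
  have fin: "finite (comember s `` B)" for B
    using finite_comember by (rule finite_Image)
  have eq: "(comember s ^^ Suc n) `` {w} = (\<Union>v\<in>?A. comember s `` {v})" by auto
  have "card (\<Union>v\<in>?A. comember s `` {v}) \<le> (\<Sum>v\<in>?A. card (comember s `` {v}))"
    by (rule card_UN_le) (use Suc in blast)
  also have "\<dots> \<le> (\<Sum>v\<in>?A. k * d)"
    by (rule sum_mono) (rule card_comember_Image[OF assms])
  also have "\<dots> \<le> (k * d) ^ Suc n"
    using Suc by (simp add: mult.commute)
  finally show ?case unfolding eq using Suc fin by blast
qed simp

text \<open>The touched variables that must not be hit by the entry queried at \<open>x\<close>: a
  single hit outside this set is benign.\<close>

definition risky :: "(entry \<times> nat) list \<Rightarrow> nat \<Rightarrow> nat set" where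
  "risky ls x = {u \<in> touched (map fst ls).
     lab ls u \<in> lab ls ` (insert x (collision_vars (map fst ls)) \<inter> touched (map fst ls))}"

lemma finite_collision_vars [simp]: "finite (collision_vars s)"
  using collision_vars_subset finite_subset finite_touched by blast

text \<open>A risky variable shares its label with a source \<open>w\<close>, either
  \<open>x\<close> or a collision variable. If one of the two has depth at least \<open>R\<close>, a
  crude count is used. Otherwise their distance is at most \<open>2 * (R - 1) + 1\<close>, padded by
  loops to \<open>2 * R\<close>, and bounded degree limits the number of such variables.\<close>

lemma card_risky_le:
  assumes "valid (map fst ls)"
  defines "s \<equiv> map fst ls"
  shows "real (card (risky ls x)) \<le> (\<Sum>u\<in>touched s. of_bool (R \<le> open_depth ls u))
    + (\<Sum>w\<in>insert x (collision_vars s). of_bool (R \<le> open_depth ls w) * real (card (touched s)) + real ((k * d) ^ (2 * R)))"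
proof -
  let ?near = "\<lambda>w. if R \<le> open_depth ls w then touched s else (comember s ^^ (2 * R)) `` {w}"
  let ?deep = "{u \<in> touched s. R \<le> open_depth ls u}"
  let ?W = "insert x (collision_vars s)"
  have fin: "finite (?near w)" for w using card_relpow_Image[of s] assms by simp
  have "risky ls x \<subseteq> ?deep \<union> (\<Union>w\<in>?W. ?near w)"
  proof
    fix u assume u: "u \<in> risky ls x"
    then obtain w where w: "w \<in> ?W" "w \<in> touched s" "lab ls u = lab ls w" and ut: "u \<in> touched s"
      unfolding risky_def s_def by blast
    show "u \<in> ?deep \<union> (\<Union>w\<in>?W. ?near w)"
    proof (cases "R \<le> open_depth ls u \<or> R \<le> open_depth ls w")
      case True
      then show ?thesis using w ut by auto
    next
      case False
      let ?n = "open_depth ls w + open_depth ls u + 1"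
      have "(w, u) \<in> comember s ^^ ?n"
        using lab_eq_imp_near[OF assms(1), of w u] w ut by (simp add: s_def)
      moreover have "(u, u) \<in> comember s" using ut by (auto simp: comember_def touched_def)
      then have "(u, u) \<in> comember s ^^ i" for i
        by (induction i) auto
      ultimately have "(w, u) \<in> comember s ^^ (?n + (2 * R - ?n))"
        unfolding relpow_add by blast
      moreover have "?n + (2 * R - ?n) = 2 * R" using False by simp
      ultimately have "u \<in> ?near w" using False by simp
      then show ?thesis using w(1) by blast
    qed
  qed
  moreover have "finite (\<Union>w\<in>?W. ?near w)"
    by (rule finite_UN_I) (simp, rule fin)
  ultimately have "card (risky ls x) \<le> card (?deep \<union> (\<Union>w\<in>?W. ?near w))"
    by (intro card_mono) simp_all
  also have "\<dots> \<le> card ?deep + (\<Sum>w\<in>?W. card (?near w))"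
    by (rule order_trans[OF card_Un_le add_left_mono[OF card_UN_le]]) simp
  finally have "real (card (risky ls x)) \<le> real (card ?deep) + (\<Sum>w\<in>?W. real (card (?near w)))"
    by (simp flip: of_nat_sum of_nat_add)
  moreover have "real (card ?deep) = (\<Sum>u\<in>touched s. of_bool (R \<le> open_depth ls u))"
    by (simp add: of_bool_def sum.If_cases Int_def)
  moreover have "real (card (?near w)) \<le> of_bool (R \<le> open_depth ls w) * real (card (touched s)) + real ((k * d) ^ (2 * R))" for w
    using card_relpow_Image[of s "2 * R" w] assms by (auto simp flip: of_nat_power of_nat_mult)
  ultimately show ?thesis by (smt (verit, best) sum_mono)
qed

lemma type_avg_risky_le:
  assumes v: "valid s" and len: "length s \<le> q"
  shows "type_avg s (\<lambda>ls. real (card (risky ls x))) \<le> real (k * q) * lam ^ R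
    + (1 + real (card (collision_vars s))) * (real (k * q) * lam ^ R + real ((k * d) ^ (2 * R)))"
proof -
  let ?W = "insert x (collision_vars s)"
  let ?N = "real ((k * d) ^ (2 * R))"
  have t: "real (card (touched s)) \<le> real (k * q)"
    using card_touched_le[of s] len by (meson le_trans mult_le_mono2 of_nat_mono)
  have L: "0 \<le> lam ^ R" using lam_bounds by simp
  have "type_avg s (\<lambda>ls. real (card (risky ls x))) \<le> type_avg s (\<lambda>ls.
      (\<Sum>u\<in>touched s. of_bool (R \<le> open_depth ls u))
      + (\<Sum>w\<in>?W. of_bool (R \<le> open_depth ls w) * real (card (touched s)) + ?N))"
    by (rule type_avg_mono) (use card_risky_le v in blast)
  also have "\<dots> = (\<Sum>u\<in>touched s. type_avg s (\<lambda>ls. of_bool (R \<le> open_depth ls u)))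
      + (\<Sum>w\<in>?W. real (card (touched s)) * type_avg s (\<lambda>ls. of_bool (R \<le> open_depth ls w)) + ?N)"
    by (simp add: type_avg_add type_avg_sum type_avg_cmult[symmetric] mult.commute del: sum_of_bool_eq)
  also have "\<dots> \<le> (\<Sum>u\<in>touched s. lam ^ R) + (\<Sum>w\<in>?W. real (k * q) * lam ^ R + ?N)"
    by (intro add_mono sum_mono mult_mono open_depth_tail[OF v] t order_refl)
      (use type_avg_mono[of s "\<lambda>_. 0"] in auto)
  also have "\<dots> \<le> real (k * q) * lam ^ R + (1 + real (card (collision_vars s))) * (real (k * q) * lam ^ R + ?N)"
  proof (rule add_mono)
    show "(\<Sum>u\<in>touched s. lam ^ R) \<le> real (k * q) * lam ^ R"
      using t L by (simp add: mult_right_mono)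
    have "real (card ?W) \<le> 1 + real (card (collision_vars s))"
      using card_insert_le_m1 by (simp add: card_insert_if)
    then show "(\<Sum>w\<in>?W. real (k * q) * lam ^ R + ?N) \<le> (1 + real (card (collision_vars s))) * (real (k * q) * lam ^ R + ?N)"
      using L by (simp only: sum_constant) (intro mult_right_mono, simp_all)
  qed
  finally show ?thesis .
qed

end

section \<open>Probability that a random extension is not benign\<close>

lemma of_bool_le_add:
  "(P \<Longrightarrow> Q \<or> R) \<Longrightarrow> (of_bool P :: real) \<le> of_bool Q + of_bool R"
  by auto

lemma ratio_cancel:
  fixes a b f v :: real
  assumes "a * f = b * v" "0 < f" "0 < v"
  shows "a / v = b / f"
  using assms by (simp add: field_simps)

lemma ratio_product:
  fixes a b c f v :: real
  assumes "a * (f * f) = b * c * v" "0 < f" "0 < v"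
  shows "a / v = b / f * (c / f)"
  using assms by (simp add: field_simps)

context hypermatchings
begin

definition used :: "entry list \<Rightarrow> nat \<Rightarrow> nat" where
  "used s j = length (filter (\<lambda>e. matching e = j) s)"

lemma used_le: "used s j \<le> length s"
  by (simp add: used_def)

lemma card_free_slots:
  assumes "valid s" "l < k"
  shows "card (free_slots s j l) = m - used s j"
proof -
  let ?T = "{tup e l | e. e \<in> set s \<and> matching e = j}"
  have "distinct (map (\<lambda>e. tup e l) (filter (\<lambda>e. matching e = j) s))"
    using valid_distinct_tups[OF assms] by (auto simp: distinct_map inj_on_def)
  from distinct_card[OF this] have "card (set (map (\<lambda>e. tup e l) (filter (\<lambda>e. matching e = j) s))) = used s j"
    by (simp only: used_def length_map)
  moreover have "set (map (\<lambda>e. tup e l) (filter (\<lambda>e. matching e = j) s)) = ?T" by auto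
  ultimately have "card ?T = used s j" by simp
  moreover have "?T \<subseteq> {..<m}" using valid_entry assms by auto
  ultimately show ?thesis
    unfolding free_slots_def by (subst card_Diff_subset) (auto intro: finite_subset)
qed

lemma finite_free_slots [simp]: "finite (free_slots s j l)"
  by (simp add: free_slots_def)

lemma finite_tuple_choices [simp]: "finite (tuple_choices s x j)"
  unfolding tuple_choices_def by (intro finite_PiE) auto

lemma finite_extensions [simp]: "finite (extensions s x j)"
  by (simp add: extensions_def)

lemma card_tuple_choices:
  assumes "valid s" "x < k * m"
  shows "card (tuple_choices s x j) = (m - used s j) ^ (k - 1)"
proof -
  have x: "x div m < k" using assms(2) by (simp add: less_mult_imp_div_less)
  have "card (tuple_choices s x j) = (\<Prod>l<k. if l = x div m then 1 else m - used s j)"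
    unfolding tuple_choices_def by (subst card_PiE) (auto intro!: prod.cong card_free_slots[OF assms(1)])
  also have "\<dots> = (\<Prod>l\<in>{..<k} - {x div m}. m - used s j)"
    using x by (subst prod.remove[of _ "x div m"]) (auto intro!: prod.cong)
  finally show ?thesis using x by simp
qed

lemma inj_on_extension: "inj_on (\<lambda>(v, B). Entry j y v B) A"
  by (auto simp: inj_on_def)

lemma card_extensions:
  assumes "valid s" "x < k * m"
  shows "card (extensions s x j) = (m - used s j) ^ (k - 1) * 2 ^ k"
  unfolding extensions_def
  by (simp add: card_image[OF inj_on_extension] card_cartesian_product card_tuple_choices[OF assms] card_Pow)

lemma avg_extensions_tup:
  "avg (extensions s x j) (\<lambda>e. f (tup e)) = avg (tuple_choices s x j) f"
proof -
  have "(\<Sum>e\<in>extensions s x j. f (tup e)) = (\<Sum>(v, B)\<in>tuple_choices s x j \<times> Pow {..<k}. f v)"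
    unfolding extensions_def by (subst sum.reindex[OF inj_on_extension]) (auto intro: sum.cong)
  also have "\<dots> = 2 ^ k * (\<Sum>v\<in>tuple_choices s x j. f v)"
    by (simp add: sum.cartesian_product[symmetric] card_Pow sum_distrib_left)
  finally show ?thesis
    by (simp add: avg_def extensions_def card_image[OF inj_on_extension] card_cartesian_product card_Pow)
qed

text \<open>A position other than the anchor is uniform on its free slots, of which at least
  \<open>m - q\<close> remain.\<close>

lemma slot_prob_le:
  assumes v: "valid s" "x < k * m" and len: "length s \<le> q" "q < m"
    and l: "l < k" "l \<noteq> x div m" and T: "finite T"
  shows "avg (extensions s x j) (\<lambda>e. of_bool (var e l \<in> T))
    \<le> real (card {u \<in> T. u div m = l}) / real (m - q)"
proof -
  let ?V = "tuple_choices s x j" and ?f = "m - used s j"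
  let ?T = "{r. l * m + r \<in> T}"
  have f: "0 < ?f" "m - q \<le> ?f" using used_le[of s j] len by linarith+
  have V: "card ?V > 0" using f by (simp add: card_tuple_choices[OF v])
  have "card {g \<in> ?V. g l \<in> ?T} * ?f = card (free_slots s j l \<inter> ?T) * card ?V"
    using card_PiE_coordinate[of "{..<k}" l "\<lambda>l. if l = x div m then {x mod m} else free_slots s j l" ?T] l
      card_free_slots[OF v(1) l(1), of j] unfolding tuple_choices_def by simp
  then have "real (card {g \<in> ?V. g l \<in> ?T}) * real ?f = real (card (free_slots s j l \<inter> ?T)) * real (card ?V)"
    by (simp only: of_nat_mult[symmetric])
  then have "real (card {g \<in> ?V. g l \<in> ?T}) / real (card ?V) = real (card (free_slots s j l \<inter> ?T)) / real ?f"
    using f V by (intro ratio_cancel) simp_all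
  moreover have "card (free_slots s j l \<inter> ?T) \<le> card {u \<in> T. u div m = l}"
    by (rule card_inj_on_le[where f = "\<lambda>r. l * m + r"]) (use T in \<open>auto simp: inj_on_def free_slots_def\<close>)
  moreover have "avg (extensions s x j) (\<lambda>e. of_bool (var e l \<in> T)) = real (card {g \<in> ?V. g l \<in> ?T}) / real (card ?V)"
    using avg_extensions_tup[of s x j "\<lambda>g. of_bool (l * m + g l \<in> T)"]
    by (simp add: var_def avg_of_bool)
  ultimately show ?thesis
    using f len by (auto intro!: frac_le)
qed

lemma slot_pair_prob_le:
  assumes v: "valid s" "x < k * m" and len: "length s \<le> q" "q < m"
    and l: "l < k" "l \<noteq> x div m" "l' < k" "l' \<noteq> x div m" "l \<noteq> l'" and T: "finite T"
  shows "avg (extensions s x j) (\<lambda>e. of_bool (var e l \<in> T \<and> var e l' \<in> T))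
    \<le> real (card {u \<in> T. u div m = l}) / real (m - q) * (real (card {u \<in> T. u div m = l'}) / real (m - q))"
proof -
  let ?V = "tuple_choices s x j" and ?f = "m - used s j"
  let ?T = "\<lambda>l. {r. l * m + r \<in> T}"
  have f: "0 < ?f" "m - q \<le> ?f" using used_le[of s j] len by linarith+
  have V: "card ?V > 0" using f by (simp add: card_tuple_choices[OF v])
  let ?A = "card {g \<in> ?V. g l \<in> ?T l \<and> g l' \<in> ?T l'}"
  have "?A * (?f * ?f) = card (free_slots s j l \<inter> ?T l) * card (free_slots s j l' \<inter> ?T l') * card ?V"
    using card_PiE_coordinate2[of "{..<k}" l l' "\<lambda>l. if l = x div m then {x mod m} else free_slots s j l" "?T l" "?T l'"] l
      card_free_slots[OF v(1), of _ j] unfolding tuple_choices_def by simp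
  then have "real ?A * (real ?f * real ?f) = real (card (free_slots s j l \<inter> ?T l)) * real (card (free_slots s j l' \<inter> ?T l')) * real (card ?V)"
    by (simp only: of_nat_mult[symmetric])
  then have "real ?A / real (card ?V) = real (card (free_slots s j l \<inter> ?T l)) / real ?f * (real (card (free_slots s j l' \<inter> ?T l')) / real ?f)"
    using f V by (intro ratio_product) simp_all
  moreover have "card (free_slots s j l \<inter> ?T l) \<le> card {u \<in> T. u div m = l}" for l
    by (rule card_inj_on_le[where f = "\<lambda>r. l * m + r"]) (use T in \<open>auto simp: inj_on_def free_slots_def\<close>)
  then have "real (card (free_slots s j l \<inter> ?T l)) / real ?f \<le> real (card {u \<in> T. u div m = l}) / real (m - q)" for l
    using f len by (intro frac_le) auto
  then have "real (card (free_slots s j l \<inter> ?T l)) / real ?f * (real (card (free_slots s j l' \<inter> ?T l')) / real ?f)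
      \<le> real (card {u \<in> T. u div m = l}) / real (m - q) * (real (card {u \<in> T. u div m = l'}) / real (m - q))"
    by (intro mult_mono) auto
  moreover have "avg (extensions s x j) (\<lambda>e. of_bool (var e l \<in> T \<and> var e l' \<in> T)) = real ?A / real (card ?V)"
    using avg_extensions_tup[of s x j "\<lambda>g. of_bool (l * m + g l \<in> T \<and> l' * m + g l' \<in> T)"]
    by (simp add: var_def avg_of_bool)
  ultimately show ?thesis by simp
qed

text \<open>A union bound over positions. Different positions draw from disjoint classes, so the
  counts add up to at most \<open>card T\<close>, without a factor \<open>k\<close>.\<close>

lemma some_slot_prob_le:
  assumes v: "valid s" "x < k * m" and len: "length s \<le> q" "q < m" and T: "finite T"
  shows "avg (extensions s x j) (\<lambda>e. of_bool (\<exists>l<k. l \<noteq> x div m \<and> var e l \<in> T))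
    \<le> real (card T) / real (m - q)"
proof -
  let ?I = "{..<k} - {x div m}"
  have "avg (extensions s x j) (\<lambda>e. of_bool (\<exists>l<k. l \<noteq> x div m \<and> var e l \<in> T))
      \<le> avg (extensions s x j) (\<lambda>e. \<Sum>l\<in>?I. of_bool (var e l \<in> T))"
  proof (rule avg_mono)
    fix e
    show "of_bool (\<exists>l<k. l \<noteq> x div m \<and> var e l \<in> T) \<le> (\<Sum>l\<in>?I. of_bool (var e l \<in> T) :: real)"
    proof (cases "\<exists>l<k. l \<noteq> x div m \<and> var e l \<in> T")
      case True
      then obtain l where l: "l \<in> ?I" "var e l \<in> T" by auto
      have "(of_bool (var e l \<in> T) :: real) \<le> (\<Sum>l\<in>?I. of_bool (var e l \<in> T))"
        by (rule member_le_sum) (use l in auto)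
      then show ?thesis using True l by (simp del: sum_of_bool_eq)
    next
      case False
      then have z: "of_bool (\<exists>l<k. l \<noteq> x div m \<and> var e l \<in> T) = (0::real)" by simp
      show ?thesis unfolding z by (intro sum_nonneg) simp_all
    qed
  qed
  also have "\<dots> = (\<Sum>l\<in>?I. avg (extensions s x j) (\<lambda>e. of_bool (var e l \<in> T)))"
    by (rule avg_sum)
  also have "\<dots> \<le> (\<Sum>l\<in>?I. real (card {u \<in> T. u div m = l}) / real (m - q))"
    by (intro sum_mono slot_prob_le[OF v len _ _ T]) auto
  also have "\<dots> = real (\<Sum>l\<in>?I. card {u \<in> T. u div m = l}) / real (m - q)"
    by (simp add: sum_divide_distrib)
  also have "\<dots> \<le> real (card T) / real (m - q)"
    using sum_Int_le_card[OF T, of ?I "\<lambda>u. u div m"]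
      by (intro divide_right_mono) (simp_all del: of_nat_sum)
  finally show ?thesis .
qed

text \<open>Two positions are filled independently, so the double sum of products is at most the
  square of the single sum.\<close>

lemma two_slots_prob_le:
  assumes v: "valid s" "x < k * m" and len: "length s \<le> q" "q < m" and T: "finite T"
  shows "avg (extensions s x j)
      (\<lambda>e. of_bool (\<exists>l<k. \<exists>l'<k. l \<noteq> l' \<and> l \<noteq> x div m \<and> l' \<noteq> x div m \<and> var e l \<in> T \<and> var e l' \<in> T))
    \<le> (real (card T) / real (m - q))\<^sup>2"
proof -
  let ?I = "{..<k} - {x div m}"
  let ?P = "\<lambda>e. \<exists>l<k. \<exists>l'<k. l \<noteq> l' \<and> l \<noteq> x div m \<and> l' \<noteq> x div m \<and> var e l \<in> T \<and> var e l' \<in> T"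
  let ?c = "\<lambda>l. real (card {u \<in> T. u div m = l}) / real (m - q)"
  have "avg (extensions s x j) (\<lambda>e. of_bool (?P e))
      \<le> avg (extensions s x j) (\<lambda>e. \<Sum>l\<in>?I. \<Sum>l'\<in>?I - {l}. of_bool (var e l \<in> T \<and> var e l' \<in> T))"
  proof (rule avg_mono)
    fix e
    show "of_bool (?P e) \<le> (\<Sum>l\<in>?I. \<Sum>l'\<in>?I - {l}. of_bool (var e l \<in> T \<and> var e l' \<in> T) :: real)"
    proof (cases "?P e")
      case True
      then obtain l l' where l: "l \<in> ?I" "l' \<in> ?I - {l}" "var e l \<in> T" "var e l' \<in> T" by blast
      have "(of_bool (var e l \<in> T \<and> var e l' \<in> T) :: real) \<le> (\<Sum>l'\<in>?I - {l}. of_bool (var e l \<in> T \<and> var e l' \<in> T))"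
        by (rule member_le_sum) (use l in auto)
      also have "\<dots> \<le> (\<Sum>l\<in>?I. \<Sum>l'\<in>?I - {l}. of_bool (var e l \<in> T \<and> var e l' \<in> T))"
        by (rule member_le_sum) (use l in \<open>auto simp: sum_nonneg simp del: sum_of_bool_eq\<close>)
      finally show ?thesis using l by (simp del: sum_of_bool_eq)
    next
      case False
      then have z: "of_bool (?P e) = (0::real)" by simp
      show ?thesis unfolding z by (intro sum_nonneg) simp_all
    qed
  qed
  also have "\<dots> = (\<Sum>l\<in>?I. \<Sum>l'\<in>?I - {l}. avg (extensions s x j) (\<lambda>e. of_bool (var e l \<in> T \<and> var e l' \<in> T)))"
    by (simp only: avg_sum)
  also have "\<dots> \<le> (\<Sum>l\<in>?I. \<Sum>l'\<in>?I - {l}. ?c l * ?c l')"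
    by (intro sum_mono slot_pair_prob_le[OF v len _ _ _ _ _ T]) auto
  also have "\<dots> \<le> (\<Sum>l\<in>?I. \<Sum>l'\<in>?I. ?c l * ?c l')"
    by (intro sum_mono sum_mono2) auto
  also have "\<dots> = (\<Sum>l\<in>?I. ?c l)\<^sup>2"
    by (simp only: power2_eq_square sum_product)
  also have "\<dots> \<le> (real (card T) / real (m - q))\<^sup>2"
  proof (rule power_mono)
    have "(\<Sum>l\<in>?I. ?c l) = real (\<Sum>l\<in>?I. card {u \<in> T. u div m = l}) / real (m - q)"
      by (simp add: sum_divide_distrib)
    also have "\<dots> \<le> real (card T) / real (m - q)"
      using sum_Int_le_card[OF T, of ?I "\<lambda>u. u div m"]
      by (intro divide_right_mono) (simp_all del: of_nat_sum)
    finally show "(\<Sum>l\<in>?I. ?c l) \<le> real (card T) / real (m - q)" .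
  qed (simp add: sum_nonneg)
  finally show ?thesis .
qed

lemma extensions_nonempty:
  assumes "valid s" "x < k * m" "length s < m"
  shows "extensions s x j \<noteq> {}"
proof -
  have "card (extensions s x j) > 0"
    using used_le[of s j] assms by (simp add: card_extensions)
  then show ?thesis by auto
qed

lemma not_benign_cases:
  assumes "e \<in> extensions s x j" "x < k * m" "map fst ls = s" "\<not> benign e ls"
  shows "(\<exists>l<k. l \<noteq> x div m \<and> var e l \<in> risky ls x) \<or>
    (\<exists>l<k. \<exists>l'<k. l \<noteq> l' \<and> l \<noteq> x div m \<and> l' \<noteq> x div m \<and> var e l \<in> touched s \<and> var e l' \<in> touched s)"
proof -
  note e = extensionsD(2,9)[OF assms(1,2)]
  obtain l where l: "l \<in> hits e s" using assms(3,4) by (auto simp: benign_def)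
  show ?thesis
  proof (cases "hits e s = {l}")
    case True
    then have "var e l \<in> risky ls x"
      using assms(3,4) l e by (auto simp: benign_def risky_def hits_def)
    then show ?thesis using l e by (auto simp: hits_def)
  next
    case False
    then obtain l' where "l' \<in> hits e s" "l' \<noteq> l" using l by auto
    then have "l < k" "l' < k" "l \<noteq> l'" "l \<noteq> x div m" "l' \<noteq> x div m" "var e l \<in> touched s" "var e l' \<in> touched s"
      using l e(1) by (simp_all add: hits_def)
    then show ?thesis by blast
  qed
qed

text \<open>The fraction of type choices for which \<open>planted_count\<close> says nothing about
  the negations of \<open>s\<close>.\<close>

definition dirty_frac :: "entry list \<Rightarrow> real" where
  "dirty_frac s = type_avg s (\<lambda>ls. of_bool (\<not> clean ls))"

lemma dirty_frac_Cons:
  "dirty_frac (e # s) \<le> dirty_frac s + type_avg s (\<lambda>ls. of_bool (\<not> benign e ls))"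
proof -
  have "dirty_frac (e # s) = type_avg s (\<lambda>ls. of_bool (\<not> (clean ls \<and> benign e ls)))"
    using k3 by (simp add: dirty_frac_def)
  also have "\<dots> \<le> type_avg s (\<lambda>ls. of_bool (\<not> clean ls) + of_bool (\<not> benign e ls))"
    by (rule type_avg_mono) auto
  finally show ?thesis by (simp add: type_avg_add dirty_frac_def)
qed

end

text \<open>\<open>q\<close> bounds the number of queries; \<open>R\<close> is the depth at which open paths are cut off.\<close>

locale bounded_exploration = hypermatchings +
  fixes q R :: nat
  assumes q_less: "q < m"
begin

text \<open>Bounds the chance that a new entry hits the component of one given source. With
  probability at most \<open>lam ^ R\<close> the source is deep and every touched variable is
  charged; otherwise only those within distance \<open>2 * R\<close>.\<close>

definition reach_rate :: real where
  "reach_rate = (real (k * q) * lam ^ R + real ((k * d) ^ (2 * R))) / real (m - q)"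

definition touch_rate :: real where
  "touch_rate = real (k * q) / real (m - q)"

text \<open>The risk of one entry apart from earlier collisions: hitting a deep variable, hitting
  the component of the anchor, or hitting two touched variables at once.\<close>

definition base_rate :: real where
  "base_rate = touch_rate * lam ^ R + reach_rate + touch_rate\<^sup>2"

lemma rates_nonneg: "0 \<le> reach_rate" "0 \<le> touch_rate" "0 \<le> base_rate"
  using lam_bounds by (auto simp: reach_rate_def touch_rate_def base_rate_def intro!: add_nonneg_nonneg divide_nonneg_nonneg)

lemma avg_not_benign_le:
  assumes v: "valid s" "x < k * m" and len: "length s \<le> q"
  shows "avg (extensions s x j) (\<lambda>e. type_avg s (\<lambda>ls. of_bool (\<not> benign e ls)))
    \<le> base_rate + reach_rate * real (card (collision_vars s))"
proof -
  let ?E = "extensions s x j"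
  have t: "real (card (touched s)) \<le> real (k * q)"
    using card_touched_le[of s] len by (meson le_trans mult_le_mono2 of_nat_mono)
  \<comment> \<open>The new entry is averaged with the old types fixed, since only then is
    \<open>risky\<close> a fixed set; the average over types then meets just the size of that
    set.\<close>
  have "avg ?E (\<lambda>e. type_avg s (\<lambda>ls. of_bool (\<not> benign e ls)))
      = type_avg s (\<lambda>ls. avg ?E (\<lambda>e. of_bool (\<not> benign e ls)))"
    by (simp add: type_avg_avg)
  also have "\<dots> \<le> type_avg s (\<lambda>ls. (1 / real (m - q)) * real (card (risky ls x)) + touch_rate\<^sup>2)"
  proof (rule type_avg_mono)
    fix ls :: "(entry \<times> nat) list" assume ls: "map fst ls = s"
    have "avg ?E (\<lambda>e. of_bool (\<not> benign e ls))
        \<le> avg ?E (\<lambda>e. of_bool (\<exists>l<k. l \<noteq> x div m \<and> var e l \<in> risky ls x)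
          + of_bool (\<exists>l<k. \<exists>l'<k. l \<noteq> l' \<and> l \<noteq> x div m \<and> l' \<noteq> x div m \<and> var e l \<in> touched s \<and> var e l' \<in> touched s))"
    proof (rule avg_mono)
      fix e assume "e \<in> ?E"
      then show "of_bool (\<not> benign e ls) \<le> (of_bool (\<exists>l<k. l \<noteq> x div m \<and> var e l \<in> risky ls x)
          + of_bool (\<exists>l<k. \<exists>l'<k. l \<noteq> l' \<and> l \<noteq> x div m \<and> l' \<noteq> x div m \<and> var e l \<in> touched s \<and> var e l' \<in> touched s) :: real)"
        by (intro of_bool_le_add) (rule not_benign_cases[OF _ v(2) ls])
    qed
    also have "\<dots> \<le> real (card (risky ls x)) / real (m - q) + (real (card (touched s)) / real (m - q))\<^sup>2"
      unfolding avg_add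
      by (intro add_mono some_slot_prob_le[OF v len q_less] two_slots_prob_le[OF v len q_less]) (auto simp: risky_def)
    also have "\<dots> \<le> (1 / real (m - q)) * real (card (risky ls x)) + touch_rate\<^sup>2"
      unfolding touch_rate_def using t by (intro add_mono power_mono divide_right_mono) auto
    finally show "avg ?E (\<lambda>e. of_bool (\<not> benign e ls)) \<le> (1 / real (m - q)) * real (card (risky ls x)) + touch_rate\<^sup>2" .
  qed
  also have "\<dots> = (1 / real (m - q)) * type_avg s (\<lambda>ls. real (card (risky ls x))) + touch_rate\<^sup>2"
    unfolding type_avg_add type_avg_cmult by simp
  also have "\<dots> \<le> (1 / real (m - q)) * (real (k * q) * lam ^ R
    + (1 + real (card (collision_vars s))) * (real (k * q) * lam ^ R + real ((k * d) ^ (2 * R)))) + touch_rate\<^sup>2"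
    by (intro add_mono mult_left_mono type_avg_risky_le v len) auto
  also have "\<dots> = base_rate + reach_rate * real (card (collision_vars s))"
    unfolding base_rate_def reach_rate_def touch_rate_def by (simp add: field_simps add_divide_distrib)
  finally show ?thesis .
qed

text \<open>An entry adds at most \<open>k\<close> collision variables, and only if one of its
  positions hits a touched variable.\<close>

lemma avg_collision_vars_le:
  assumes v: "valid s" "x < k * m" and len: "length s \<le> q"
  shows "avg (extensions s x j) (\<lambda>e. real (card (collision_vars (e # s))))
    \<le> real (card (collision_vars s)) + real k * touch_rate"
proof -
  let ?E = "extensions s x j"
  have t: "real (card (touched s)) \<le> real (k * q)"
    using card_touched_le[of s] len by (meson le_trans mult_le_mono2 of_nat_mono)
  have "avg ?E (\<lambda>e. real (card (collision_vars (e # s))))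
      \<le> avg ?E (\<lambda>e. real (card (collision_vars s)) + real k * of_bool (\<exists>l<k. l \<noteq> x div m \<and> var e l \<in> touched s))"
  proof (rule avg_mono)
    fix e assume e: "e \<in> ?E"
    have "hits e s \<noteq> {} \<longleftrightarrow> (\<exists>l<k. l \<noteq> x div m \<and> var e l \<in> touched s)"
      using extensionsD(2)[OF e v(2)] by (auto simp: hits_def)
    moreover have "card (collision_vars s \<union> vars e) \<le> card (collision_vars s) + k"
      by (rule order_trans[OF card_Un_le]) (simp add: card_vars_le)
    ultimately show "real (card (collision_vars (e # s)))
        \<le> real (card (collision_vars s)) + real k * of_bool (\<exists>l<k. l \<noteq> x div m \<and> var e l \<in> touched s)"
      by (cases "hits e s = {}") auto
  qed
  also have "\<dots> = real (card (collision_vars s)) + real k * avg ?E (\<lambda>e. of_bool (\<exists>l<k. l \<noteq> x div m \<and> var e l \<in> touched s))"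
    unfolding avg_add avg_cmult
    by (subst avg_const) (use extensions_nonempty[OF v] len q_less in auto)
  also have "\<dots> \<le> real (card (collision_vars s)) + real k * (real (card (touched s)) / real (m - q))"
    by (intro add_left_mono mult_left_mono some_slot_prob_le[OF v len q_less]) auto
  also have "\<dots> \<le> real (card (collision_vars s)) + real k * touch_rate"
    unfolding touch_rate_def using t by (intro add_left_mono mult_left_mono divide_right_mono) auto
  finally show ?thesis .
qed

end

section \<open>Decision trees on random instances\<close>

primrec run :: "(nat \<Rightarrow> nat \<Rightarrow> cstr option) \<Rightarrow> dtree \<Rightarrow> nat \<Rightarrow> bool" where
  "run orc (Output b) = (\<lambda>r. b)"
| "run orc (Query x i next) =
     (\<lambda>r. case r of 0 \<Rightarrow> False | Suc r' \<Rightarrow> run orc (next (orc x i)) r')"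

lemma run_eq_accepts:
  "queries I t \<le> r \<Longrightarrow> run (oracle_answer I) t r = accepts I t"
  by (induction t arbitrary: r) (auto split: nat.split)

context hypermatchings
begin

definition entry_cstr :: "entry \<Rightarrow> cstr" where
  "entry_cstr e = (map (var e) [0..<k], map (\<lambda>l. l \<in> flips e) [0..<k])"

text \<open>Expectation of \<open>G\<close> at the leaf reached when each newly queried constraint is sampled on demand;
  as in \<open>run\<close>, a tree that exceeds \<open>r\<close> queries rejects.\<close>

primrec lazy_value ::
  "(bool \<Rightarrow> entry list \<Rightarrow> real) \<Rightarrow> dtree \<Rightarrow> nat \<Rightarrow> entry list \<Rightarrow> real" where
  "lazy_value G (Output b) = (\<lambda>r s. G b s)"
| "lazy_value G (Query x i next) = (\<lambda>r s. case r of 0 \<Rightarrow> G False s | Suc r' \<Rightarrow>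
     if x < k * m \<and> 1 \<le> i \<and> i \<le> d then
       (case find (covers x (i - 1)) s of
          Some e \<Rightarrow> lazy_value G (next (Some (entry_cstr e))) r' s
        | None \<Rightarrow> avg (extensions s x (i - 1))
            (\<lambda>e. lazy_value G (next (Some (entry_cstr e))) r' (e # s)))
     else lazy_value G (next None) r' s)"

lemma lazy_value_add:
  "lazy_value (\<lambda>b s. G b s + H b s) t r s = lazy_value G t r s + lazy_value H t r s"
  by (induction t arbitrary: r s) (auto simp: avg_add split: nat.split option.split)

lemma valid_extend:
  "\<lbrakk>valid s; x < k * m; 1 \<le> i; i \<le> d; find (covers x (i - 1)) s = None; e \<in> extensions s x (i - 1)\<rbrakk>
    \<Longrightarrow> valid (e # s)"
  by (rule valid.Cons[of s x "i - 1"]) (auto simp: find_None_iff)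

lemma lazy_value_const:
  assumes "valid s" "length s + r < m"
  shows "lazy_value (\<lambda>b s. c) t r s = c"
  using assms
proof (induction t arbitrary: r s)
  case (Query x i nxt)
  show ?case
  proof (cases r)
    case (Suc r')
    show ?thesis
    proof (cases "x < k * m \<and> 1 \<le> i \<and> i \<le> d \<and> find (covers x (i - 1)) s = None")
      case True
      have "avg (extensions s x (i - 1)) (\<lambda>e. lazy_value (\<lambda>b s. c) (nxt (Some (entry_cstr e))) r' (e # s))
          = avg (extensions s x (i - 1)) (\<lambda>e. c)"
        by (intro avg_cong Query.IH valid_extend[of s x i]) (use True Query.prems Suc in auto)
      also have "\<dots> = c"
        by (rule avg_const) (use extensions_nonempty Query.prems True Suc in auto)
      finally show ?thesis using True Suc by simp
    next
      case False
      then show ?thesis using Query Suc by (auto split: option.split)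
    qed
  qed simp
qed simp

end

section \<open>Expected fraction of dirty types at a leaf\<close>

context bounded_exploration
begin

text \<open>The right side is a potential for the induction on the tree. A query costs at most
  \<open>base_rate\<close> plus \<open>reach_rate\<close> for each collision variable, and the
  expected number of these grows by at most \<open>k * touch_rate\<close> per query. Accumulated
  over \<open>r\<close> queries, that growth gives the quadratic term.\<close>

theorem lazy_dirty_le:
  assumes "valid s" "length s + r \<le> q"
  shows "lazy_value (\<lambda>b. dirty_frac) t r s \<le> dirty_frac s + real r * base_rate
    + reach_rate * (real r * real (card (collision_vars s)) + (real r)\<^sup>2 * (real k * touch_rate))"
  using assms
proof (induction t arbitrary: r s)
  case (Output b)
  have "0 \<le> real r * base_rate + reach_rate * (real r * real (card (collision_vars s)) + (real r)\<^sup>2 * (real k * touch_rate))"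
    using rates_nonneg by (intro add_nonneg_nonneg mult_nonneg_nonneg) auto
  then show ?case by simp
next
  case (Query x i nxt)
  let ?Z = "\<lambda>s. real (card (collision_vars s))"
  let ?V = "\<lambda>r s. dirty_frac s + real r * base_rate + reach_rate * (real r * ?Z s + (real r)\<^sup>2 * (real k * touch_rate))"
  show ?case
  proof (cases r)
    case 0
    then show ?thesis by simp
  next
    case (Suc r')
    have mono: "?V r' s \<le> ?V r s"
      using rates_nonneg Suc by (intro add_mono mult_right_mono mult_left_mono) (auto intro!: power_mono)
    show ?thesis
    proof (cases "x < k * m \<and> 1 \<le> i \<and> i \<le> d \<and> find (covers x (i - 1)) s = None")
      case False
      have "lazy_value (\<lambda>b. dirty_frac) (nxt c) r' s \<le> ?V r s" for c
        using Query.IH[of "nxt c" s r'] Query.prems Suc mono by force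
      then show ?thesis using False Suc by (auto split: option.split)
    next
      case True
      let ?E = "extensions s x (i - 1)"
      have len: "length s \<le> q" "length s < m" using Query.prems q_less by auto
      have ne: "?E \<noteq> {}" using extensions_nonempty Query.prems(1) True len by blast
      have rk: "0 \<le> real r' * reach_rate" using rates_nonneg by simp
      define c where "c = dirty_frac s + real r' * base_rate + reach_rate * (real r')\<^sup>2 * (real k * touch_rate)"
      have "lazy_value (\<lambda>b. dirty_frac) (Query x i nxt) r s
          = avg ?E (\<lambda>e. lazy_value (\<lambda>b. dirty_frac) (nxt (Some (entry_cstr e))) r' (e # s))"
        using True Suc by simp
      also have "\<dots> \<le> avg ?E (\<lambda>e. ?V r' (e # s))"
        by (intro avg_mono Query.IH valid_extend[of s x i]) (use True Query.prems Suc in auto)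
      also have "\<dots> \<le> avg ?E (\<lambda>e. c
          + type_avg s (\<lambda>ls. of_bool (\<not> benign e ls)) + (real r' * reach_rate) * ?Z (e # s))"
        by (intro avg_mono) (use dirty_frac_Cons in \<open>simp add: c_def algebra_simps\<close>)
      also have "\<dots> = c
          + avg ?E (\<lambda>e. type_avg s (\<lambda>ls. of_bool (\<not> benign e ls))) + (real r' * reach_rate) * avg ?E (\<lambda>e. ?Z (e # s))"
        unfolding avg_add avg_cmult using ne by (subst avg_const) auto
      also have "\<dots> \<le> c
          + (base_rate + reach_rate * ?Z s) + (real r' * reach_rate) * (?Z s + real k * touch_rate)"
        by (intro add_mono mult_left_mono avg_not_benign_le avg_collision_vars_le rk order_refl)
          (use True Query.prems len in auto)
      also have "\<dots> = dirty_frac s + real r * base_rate + reach_rate * (real r * ?Z s + ((real r')\<^sup>2 + real r') * (real k * touch_rate))"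
        unfolding Suc c_def by (simp add: algebra_simps)
      \<comment> \<open>The slack used is \<open>r'^2 + r' \<le> (r' + 1)^2\<close>.\<close>
      also have "\<dots> \<le> ?V r s"
        using rates_nonneg Suc
        by (intro add_left_mono mult_left_mono mult_right_mono) (auto simp: power2_eq_square algebra_simps)
      finally show ?thesis .
    qed
  qed
qed

corollary lazy_dirty_bound:
  "lazy_value (\<lambda>b. dirty_frac) t q [] \<le> real q * base_rate + (real q)\<^sup>2 * real k * reach_rate * touch_rate"
  using lazy_dirty_le[OF valid.Nil, of q t] by (simp add: dirty_frac_def algebra_simps)

end

section \<open>Random matchings and the chain rule for revealed states\<close>

context hypermatchings
begin

text \<open>A perfect matching between \<open>k\<close> classes is given by \<open>k - 1\<close>
  permutations: class 0 indexes the hyperedges and carries the identity in \<open>slot_map\<close>.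
  This is why \<open>key\<close> identifies a hyperedge by its matching and its index in class
  0.\<close>

definition matching_space :: "(nat \<times> nat \<Rightarrow> nat \<Rightarrow> nat) set" where
  "matching_space = PiE ({..<d} \<times> {1..<k}) (\<lambda>_. {p. p permutes {..<m}})"

definition slot_map :: "(nat \<times> nat \<Rightarrow> nat \<Rightarrow> nat) \<Rightarrow> nat \<Rightarrow> nat \<Rightarrow> nat \<Rightarrow> nat" where
  "slot_map M j l = (if l = 0 then id else M (j, l))"

definition tuple_at :: "(nat \<times> nat \<Rightarrow> nat \<Rightarrow> nat) \<Rightarrow> nat \<Rightarrow> nat \<Rightarrow> nat \<Rightarrow> nat" where
  "tuple_at M j i = (\<lambda>l\<in>{..<k}. slot_map M j l i)"

definition keys :: "(nat \<times> nat) set" where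
  "keys = {..<d} \<times> {..<m}"

definition key :: "entry \<Rightarrow> nat \<times> nat" where
  "key e = (matching e, tup e 0)"

definition shape_at :: "(nat \<times> nat \<Rightarrow> nat \<Rightarrow> nat) \<Rightarrow> entry \<Rightarrow> bool" where
  "shape_at M e \<longleftrightarrow> tuple_at M (matching e) (tup e 0) = tup e"

definition consistent ::
  "(nat \<times> nat \<Rightarrow> nat \<Rightarrow> nat) \<times> (nat \<times> nat \<Rightarrow> nat set) \<Rightarrow> entry list \<Rightarrow> bool" where
  "consistent I s \<longleftrightarrow> (\<forall>e\<in>set s. shape_at (fst I) e \<and> snd I (key e) = flips e)"

definition index_of :: "(nat \<times> nat \<Rightarrow> nat \<Rightarrow> nat) \<Rightarrow> nat \<Rightarrow> nat \<Rightarrow> nat" where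
  "index_of M j x = inv (slot_map M j (x div m)) (x mod m)"

definition constraint_at ::
  "(nat \<times> nat \<Rightarrow> nat \<Rightarrow> nat) \<times> (nat \<times> nat \<Rightarrow> nat set) \<Rightarrow> nat \<times> nat \<Rightarrow> cstr" where
  "constraint_at I ji = (map (\<lambda>l. l * m + slot_map (fst I) (fst ji) l (snd ji)) [0..<k],
     map (\<lambda>l. l \<in> snd I ji) [0..<k])"

text \<open>Every variable below \<open>k * m\<close> lies in one hyperedge of each matching. Oracle
  indices start at 1, so index \<open>i\<close> asks for matching \<open>i - 1\<close>.\<close>

definition answer ::
  "(nat \<times> nat \<Rightarrow> nat \<Rightarrow> nat) \<times> (nat \<times> nat \<Rightarrow> nat set) \<Rightarrow> nat \<Rightarrow> nat \<Rightarrow> cstr option" where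
  "answer I x i = (if x < k * m \<and> 1 \<le> i \<and> i \<le> d
     then Some (constraint_at I (i - 1, index_of (fst I) (i - 1) x)) else None)"

lemma slot_map_permutes:
  "M \<in> matching_space \<Longrightarrow> j < d \<Longrightarrow> l < k \<Longrightarrow> slot_map M j l permutes {..<m}"
  by (fastforce simp: slot_map_def matching_space_def PiE_iff permutes_id)

lemma shape_atD:
  assumes "shape_at M e" "l < k"
  shows "slot_map M (matching e) l (tup e 0) = tup e l"
  using assms by (metis lessThan_iff restrict_apply' shape_at_def tuple_at_def)

lemma answer_consistent:
  assumes "fst I \<in> matching_space" "consistent I s" "e \<in> set s" "matching e = j" "j < d"
    and "x < k * m" "tup e (x div m) = x mod m"
  shows "answer I x (Suc j) = Some (entry_cstr e)"
proof -
  have x: "x div m < k" using assms(6) by (simp add: less_mult_imp_div_less)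
  have sh: "shape_at (fst I) e" and fl: "snd I (key e) = flips e"
    using assms(2,3) by (auto simp: consistent_def)
  have "slot_map (fst I) j (x div m) (tup e 0) = x mod m"
    using shape_atD[OF sh x] assms by simp
  then have "index_of (fst I) j x = tup e 0"
    unfolding index_of_def using permutes_inverses(2)[OF slot_map_permutes[OF assms(1,5) x]] by metis
  moreover have "constraint_at I (j, tup e 0) = entry_cstr e"
    using fl shape_atD[OF sh] assms(4)
    by (auto simp: constraint_at_def entry_cstr_def var_def key_def)
  ultimately show ?thesis using assms by (simp add: answer_def)
qed

text \<open>The slot maps are injective, so the queried variable determines its hyperedge in
  matching \<open>j\<close>, and with it the whole entry. Different answers to one query are
  therefore disjoint events.\<close>

lemma consistent_extension_unique:
  assumes M: "fst I \<in> matching_space" and x: "x < k * m" "j < d"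
    and e: "e \<in> extensions s x j" "e' \<in> extensions s x j"
    and c: "consistent I (e # s)" "consistent I (e' # s)"
  shows "e = e'"
proof -
  note E = extensionsD[OF e(1) x(1)] and E' = extensionsD[OF e(2) x(1)]
  have xl: "x div m < k" using x by (simp add: less_mult_imp_div_less)
  have sh: "shape_at (fst I) e" "shape_at (fst I) e'" using c by (auto simp: consistent_def)
  have "slot_map (fst I) j (x div m) (tup e 0) = slot_map (fst I) j (x div m) (tup e' 0)"
    using shape_atD[OF sh(1) xl] shape_atD[OF sh(2) xl] E(1,6) E'(1,6) by simp
  then have z: "tup e 0 = tup e' 0"
    using permutes_inj[OF slot_map_permutes[OF M x(2) xl]] by (simp add: inj_eq)
  then have "tup e = tup e'" using sh E(1) E'(1) by (metis shape_at_def)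
  moreover have "flips e = flips e'"
    using c z E(1) E'(1) by (simp add: consistent_def key_def)
  ultimately show ?thesis using E(1,2) E'(1,2) by (simp add: entry.expand)
qed

definition state_prob :: "entry list \<Rightarrow> real" where
  "state_prob s = real (card {M \<in> matching_space. \<forall>e\<in>set s. shape_at M e})
     / real (card matching_space) / 2 ^ (k * length s)"

text \<open>The condition splits over pairs of a matching and a class: each permutation has
  \<open>used s j\<close> prescribed values, distinct by validity, and is otherwise free.\<close>

lemma card_shape:
  assumes "valid s"
  shows "card {M \<in> matching_space. \<forall>e\<in>set s. shape_at M e} = (\<Prod>j<d. fact (m - used s j) ^ (k - 1))"
proof -
  let ?S = "\<lambda>(j, l). {p. p permutes {..<m} \<and> (\<forall>e\<in>set s. matching e = j \<longrightarrow> p (tup e 0) = tup e l)}"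
  have v: "matching e < d" "tup e \<in> extensional {..<k}" if "e \<in> set s" for e
    using valid_entry[OF assms that] by auto
  have sh: "shape_at M e \<longleftrightarrow> (\<forall>l\<in>{1..<k}. M (matching e, l) (tup e 0) = tup e l)"
    if "e \<in> set s" for M e
  proof -
    have "shape_at M e \<longleftrightarrow> (\<forall>l<k. slot_map M (matching e) l (tup e 0) = tup e l)"
      using v(2)[OF that] unfolding shape_at_def tuple_at_def
      by (auto simp: fun_eq_iff extensional_def restrict_def)
    also have "\<dots> \<longleftrightarrow> (\<forall>l\<in>{1..<k}. M (matching e, l) (tup e 0) = tup e l)"
      by (auto simp: slot_map_def Ball_def)
    finally show ?thesis .
  qed
  have "{M \<in> matching_space. \<forall>e\<in>set s. shape_at M e} = PiE ({..<d} \<times> {1..<k}) ?S"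
  proof (rule set_eqI)
    fix M
    have "M \<in> {M \<in> matching_space. \<forall>e\<in>set s. shape_at M e} \<longleftrightarrow>
        M \<in> extensional ({..<d} \<times> {1..<k}) \<and> (\<forall>j<d. \<forall>l\<in>{1..<k}. M (j, l) permutes {..<m}) \<and>
        (\<forall>e\<in>set s. \<forall>l\<in>{1..<k}. M (matching e, l) (tup e 0) = tup e l)"
      by (auto simp only: matching_space_def PiE_iff sh mem_Collect_eq lessThan_iff mem_Sigma_iff)
    also have "\<dots> \<longleftrightarrow> M \<in> PiE ({..<d} \<times> {1..<k}) ?S"
      unfolding PiE_iff using v(1) by (simp only: split_paired_Ball_Sigma prod.case mem_Collect_eq lessThan_iff) blast
    finally show "M \<in> {M \<in> matching_space. \<forall>e\<in>set s. shape_at M e} \<longleftrightarrow> M \<in> PiE ({..<d} \<times> {1..<k}) ?S" .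
  qed
  then have "card {M \<in> matching_space. \<forall>e\<in>set s. shape_at M e} = (\<Prod>jl\<in>{..<d} \<times> {1..<k}. card (?S jl))"
    by (simp add: card_PiE)
  also have "\<dots> = (\<Prod>jl\<in>{..<d} \<times> {1..<k}. fact (m - used s (fst jl)))"
  proof (rule prod.cong[OF refl])
    fix jl assume "jl \<in> {..<d} \<times> {1..<k}"
    then obtain j l where jl: "jl = (j, l)" "l < k" by auto
    let ?f = "filter (\<lambda>e. matching e = j) s"
    let ?xs = "map (\<lambda>e. (tup e 0, tup e l)) ?f"
    have "distinct (map (\<lambda>e. tup e l) ?f)" if "l < k" for l
      using valid_distinct_tups[OF assms that] by (auto simp: distinct_map inj_on_def)
    then have "distinct (map fst ?xs)" "distinct (map snd ?xs)"
      using jl(2) k3 by (simp_all add: o_def)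
    moreover have "set (map fst ?xs) \<subseteq> {..<m}" "set (map snd ?xs) \<subseteq> {..<m}"
      using valid_entry[OF assms] jl(2) by auto
    ultimately have "card {p. p permutes {..<m} \<and> (\<forall>(x, y)\<in>set ?xs. p x = y)} = fact (m - length ?xs)"
      using card_permutes_extending_list[of "{..<m}" ?xs] by simp
    moreover have "{p. p permutes {..<m} \<and> (\<forall>(x, y)\<in>set ?xs. p x = y)} = ?S jl"
      by (auto simp: jl)
    ultimately show "card (?S jl) = fact (m - used s (fst jl))"
      by (simp add: jl used_def)
  qed
  also have "\<dots> = (\<Prod>j<d. fact (m - used s j) ^ (k - 1))"
  proof -
    have "(\<Prod>jl\<in>{..<d} \<times> {1..<k}. fact (m - used s (fst jl)) :: nat)
        = (\<Prod>j<d. \<Prod>l\<in>{1..<k}. fact (m - used s j))"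
      by (subst prod.cartesian_product) (simp add: split_def)
    then show ?thesis by simp
  qed
  finally show ?thesis .
qed

text \<open>The chain rule for lazy sampling: a new entry of matching \<open>j\<close> turns
  \<open>fact (m - used s j)\<close> into the factorial of one less in \<open>k - 1\<close> classes
  and adds \<open>k\<close> free bits, which matches the number of extensions.\<close>

lemma state_prob_extension:
  assumes v: "valid s" "valid (e # s)" and e: "e \<in> extensions s x j" "x < k * m" "j < d" and len: "length s < m"
  shows "state_prob (e # s) * real (card (extensions s x j)) = state_prob s"
proof -
  have j: "matching e = j" using extensionsD(1)[OF e(1,2)] .
  have u: "used (e # s) i = (if i = j then Suc (used s j) else used s i)" for i
    by (simp add: used_def j)
  have lt: "used s j < m" using used_le[of s j] len by simp
  let ?c = "\<lambda>s. card {M \<in> matching_space. \<forall>e\<in>set s. shape_at M e}"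
  have "?c (e # s) * (m - used s j) ^ (k - 1)
      = fact (m - Suc (used s j)) ^ (k - 1) * (m - used s j) ^ (k - 1) * (\<Prod>i\<in>{..<d} - {j}. fact (m - used s i) ^ (k - 1))"
    unfolding card_shape[OF v(2)] using e(3)
    by (subst prod.remove[of _ j]) (auto simp: u intro!: prod.cong)
  also have "fact (m - Suc (used s j)) * (m - used s j) = (fact (m - used s j) :: nat)"
    using lt by (metis Suc_diff_Suc fact_Suc mult.commute of_nat_id)
  then have "fact (m - Suc (used s j)) ^ (k - 1) * (m - used s j) ^ (k - 1) = (fact (m - used s j) :: nat) ^ (k - 1)"
    by (metis power_mult_distrib)
  also have "fact (m - used s j) ^ (k - 1) * (\<Prod>i\<in>{..<d} - {j}. fact (m - used s i) ^ (k - 1)) = ?c s"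
    unfolding card_shape[OF v(1)] using e(3) by (subst (2) prod.remove[of _ j]) auto
  finally have c: "real (?c (e # s)) * real ((m - used s j) ^ (k - 1)) = real (?c s)"
    by (simp only: of_nat_mult[symmetric])
  have "state_prob (e # s) * real (card (extensions s x j))
     = real (?c (e # s)) * real ((m - used s j) ^ (k - 1)) / real (card matching_space) / 2 ^ (k * length s)"
    by (simp add: state_prob_def card_extensions[OF v(1) e(2)] power_add)
  then show ?thesis unfolding c by (simp add: state_prob_def)
qed

end

text \<open>Entries with distinct keys constrain different coordinates, so their conditions factor
  out one at a time.\<close>

lemma card_PiE_prescribed:
  fixes key :: "'e \<Rightarrow> 'i" and C :: "'e \<Rightarrow> 'v set"
  assumes "finite K" and "distinct (map key s)" "key ` set s \<subseteq> K" "\<And>e. C e \<subseteq> T"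
  shows "card {f \<in> PiE K (\<lambda>_. T). \<forall>e\<in>set s. f (key e) \<in> C e} * card T ^ length s
    = prod_list (map (\<lambda>e. card (C e)) s) * card (PiE K (\<lambda>_. T))"
  using assms(2,3)
proof (induction s)
  case (Cons e s)
  let ?A = "\<lambda>s. {f \<in> PiE K (\<lambda>_. T). \<forall>e\<in>set s. f (key e) \<in> C e}"
  let ?S = "\<lambda>i. {y \<in> T. \<forall>e\<in>set s. key e = i \<longrightarrow> y \<in> C e}"
  have A: "?A s = PiE K ?S" using Cons.prems(2) by (auto simp: PiE_iff extensional_def)
  have "key e' \<noteq> key e" if "e' \<in> set s" for e'
    using Cons.prems(1) imageI[OF that, of key] by auto
  then have S: "?S (key e) = T" by blast
  have "?A (e # s) = {f \<in> PiE K ?S. f (key e) \<in> C e}" unfolding A[symmetric] by auto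
  moreover have "card {f \<in> PiE K ?S. f (key e) \<in> C e} * card (?S (key e))
      = card (?S (key e) \<inter> C e) * card (PiE K ?S)"
    by (rule card_PiE_coordinate) (use assms(1) Cons.prems(2) in auto)
  moreover have "T \<inter> C e = C e" using assms(4) by blast
  ultimately have step: "card (?A (e # s)) * card T = card (C e) * card (?A s)"
    unfolding S A by simp
  have "card (?A (e # s)) * card T ^ length (e # s) = (card (?A (e # s)) * card T) * card T ^ length s"
    by simp
  also have "\<dots> = card (C e) * (card (?A s) * card T ^ length s)"
    unfolding step by simp
  also have "card (?A s) * card T ^ length s = prod_list (map (\<lambda>e. card (C e)) s) * card (PiE K (\<lambda>_. T))"
    by (rule Cons.IH) (use Cons.prems in auto)
  finally show ?case by (simp add: mult.assoc)
qed simp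

context hypermatchings
begin

lemma lazy_value_mono:
  "(\<And>b s. G b s \<le> H b s) \<Longrightarrow> lazy_value G t r s \<le> lazy_value H t r s"
proof (induction t arbitrary: r s)
  case (Query x i nxt)
  show ?case
    by (auto simp: Query intro!: avg_mono split: nat.split option.split)
qed simp

text \<open>Transfers lazy sampling to instances drawn in advance. It is used with \<open>g\<close>
  constantly 1 for random instances and with \<open>1 - dirty_frac\<close> for planted ones. A lower
  bound at the final states suffices, because the states a tree can end in are disjoint events whose
  bounds add up.\<close>

lemma run_prob_ge:
  assumes fin: "finite W" "W \<noteq> {}" and M: "\<And>w. w \<in> W \<Longrightarrow> fst (F w) \<in> matching_space"
    and g: "\<And>s. valid s \<Longrightarrow> length s \<le> q \<Longrightarrow> state_prob s * g s \<le> avg W (\<lambda>w. of_bool (consistent (F w) s))"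
    and s: "valid s" "length s + r \<le> q" "q < m"
  shows "state_prob s * lazy_value (\<lambda>b s. of_bool (b = b0) * g s) t r s
    \<le> avg W (\<lambda>w. of_bool (consistent (F w) s \<and> run (answer (F w)) t r = b0))"
  using s(1,2)
proof (induction t arbitrary: r s)
  case (Output b)
  then show ?case using g[of s] by (cases "b = b0") (simp_all add: avg_def)
next
  case (Query x i nxt)
  show ?case
  proof (cases r)
    case 0
    then show ?thesis using g[of s] Query.prems by (cases b0) (simp_all add: avg_def)
  next
    case (Suc r')
    show ?thesis
    proof (cases "x < k * m \<and> 1 \<le> i \<and> i \<le> d")
      case False
      then have "answer I x i = None" for I by (auto simp: answer_def)
      then show ?thesis using Query.IH[of "nxt None" s r'] Query.prems False Suc by auto
    next
      case x: True
      show ?thesis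
      proof (cases "find (covers x (i - 1)) s")
        case (Some e)
        then have e: "e \<in> set s" "covers x (i - 1) e"
          by (auto simp: find_Some_iff)
        have i: "i - 1 < d" using x by auto
        have "answer (F w) x i = Some (entry_cstr e)" if "w \<in> W" "consistent (F w) s" for w
          using answer_consistent[OF M[OF that(1)] that(2) e(1), of "i - 1" x] e(2) x i by (simp add: covers_def)
        then have "avg W (\<lambda>w. of_bool (consistent (F w) s \<and> run (answer (F w)) (Query x i nxt) r = b0))
            = avg W (\<lambda>w. of_bool (consistent (F w) s \<and> run (answer (F w)) (nxt (Some (entry_cstr e))) r' = b0))"
          using Suc by (intro avg_cong) auto
        then show ?thesis
          using Query.IH[of "nxt (Some (entry_cstr e))" s r'] Query.prems Suc x Some by simp
      next
        case None
        let ?E = "extensions s x (i - 1)"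
        let ?ev = "\<lambda>e w. consistent (F w) (e # s) \<and> run (answer (F w)) (nxt (Some (entry_cstr e))) r' = b0"
        let ?t = "Query x i nxt"
        have len: "length s < m" using Query.prems s(3) by simp
        have card: "real (card ?E) > 0"
          using extensions_nonempty[OF Query.prems(1) _ len, of x] x by (simp add: card_gt_0_iff)
        have v: "valid (e # s)" if "e \<in> ?E" for e
          using valid_extend that Query.prems(1) x None by blast
        have i: "i - 1 < d" "Suc (i - 1) = i" using x by auto
        have "state_prob s * lazy_value (\<lambda>b s. of_bool (b = b0) * g s) ?t r s
            = (\<Sum>e\<in>?E. (state_prob s / real (card ?E)) * lazy_value (\<lambda>b s. of_bool (b = b0) * g s) (nxt (Some (entry_cstr e))) r' (e # s))"
          using x None Suc by (simp add: avg_def sum_distrib_left sum_divide_distrib)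
        also have "\<dots> \<le> (\<Sum>e\<in>?E. avg W (\<lambda>w. of_bool (?ev e w)))"
        proof (rule sum_mono)
          fix e assume e: "e \<in> ?E"
          have "state_prob s / real (card ?E) = state_prob (e # s)"
            using state_prob_extension[OF Query.prems(1) v[OF e] e _ i(1) len] x card
            by (intro eq_divide_imp[symmetric]) auto
          then show "(state_prob s / real (card ?E)) * lazy_value (\<lambda>b s. of_bool (b = b0) * g s) (nxt (Some (entry_cstr e))) r' (e # s)
              \<le> avg W (\<lambda>w. of_bool (?ev e w))"
            using Query.IH[of "nxt (Some (entry_cstr e))" "e # s" r'] v[OF e] Query.prems(2) Suc by simp
        qed
        also have "\<dots> = avg W (\<lambda>w. \<Sum>e\<in>?E. of_bool (?ev e w))"
          by (simp only: avg_sum)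
        \<comment> \<open>A given instance is consistent with at most one extension, and for that
          one the oracle returns exactly the answer on which the tree branches.\<close>
        also have "\<dots> \<le> avg W (\<lambda>w. of_bool (consistent (F w) s \<and> run (answer (F w)) ?t r = b0))"
        proof (rule avg_mono)
          fix w assume w: "w \<in> W"
          show "(\<Sum>e\<in>?E. of_bool (?ev e w)) \<le> (of_bool (consistent (F w) s \<and> run (answer (F w)) ?t r = b0) :: real)"
          proof (cases "\<exists>e\<in>?E. ?ev e w")
            case True
            then obtain e where e: "e \<in> ?E" "?ev e w" by blast
            have uniq: "e' = e" if "e' \<in> ?E" "?ev e' w" for e'
              using consistent_extension_unique[OF M[OF w] _ i(1)] e that x by blast
            have "(\<Sum>e\<in>?E. of_bool (?ev e w)) = (\<Sum>e'\<in>?E. if e' = e then 1 else (0::real))"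
            proof (rule sum.cong[OF refl])
              fix e' assume e': "e' \<in> ?E"
              show "of_bool (?ev e' w) = (if e' = e then 1 else (0::real))"
              proof (cases "e' = e")
                case True
                then show ?thesis using e(2) by simp
              next
                case False
                then have "\<not> ?ev e' w" using uniq e' by blast
                then show ?thesis using False by simp
              qed
            qed
            also have "\<dots> = 1" using e(1) by simp
            finally have sum1: "(\<Sum>e\<in>?E. of_bool (?ev e w)) = (1::real)" .
            have "answer (F w) x i = Some (entry_cstr e)"
              using answer_consistent[OF M[OF w], of "e # s" e "i - 1" x] e x i
                extensionsD(1,6)[OF e(1)] by simp
            moreover have "consistent (F w) s" using e(2) by (simp add: consistent_def)
            ultimately show ?thesis using e(2) Suc unfolding sum1 by simp
          next
            case False
            then have "(\<Sum>e\<in>?E. of_bool (?ev e w)) = (\<Sum>e\<in>?E. (0::real))"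
              by (intro sum.cong) auto
            then show ?thesis by simp
          qed
        qed
        finally show ?thesis .
      qed
    qed
  qed
qed

definition random_space :: "((nat \<times> nat \<Rightarrow> nat \<Rightarrow> nat) \<times> (nat \<times> nat \<Rightarrow> nat set)) set" where
  "random_space = matching_space \<times> PiE keys (\<lambda>_. Pow {..<k})"

lemma finite_keys [simp]: "finite keys" and card_keys: "card keys = d * m"
  by (simp_all add: keys_def)

lemma finite_matching_space [simp]: "finite matching_space"
  unfolding matching_space_def by (intro finite_PiE) (auto simp: finite_permutations)

lemma matching_space_nonempty: "matching_space \<noteq> {}"
  unfolding matching_space_def by (auto simp: PiE_eq_empty_iff intro: permutes_id)

lemma card_matching_space: "card matching_space > 0"
  using matching_space_nonempty by (simp add: card_gt_0_iff)

lemma finite_random_space [simp]: "finite random_space"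
  unfolding random_space_def by (intro finite_cartesian_product finite_PiE) auto

lemma random_space_nonempty: "random_space \<noteq> {}"
  unfolding random_space_def using matching_space_nonempty by (auto simp: PiE_eq_empty_iff)

lemma valid_keys:
  assumes "valid s"
  shows "distinct (map key s)" "key ` set s \<subseteq> keys"
  using valid_distinct_tups[OF assms, of 0] valid_entry[OF assms] k3
  by (auto simp: key_def[abs_def] keys_def)

lemma consistent_Collect:
  "{I \<in> A \<times> B. consistent I s} =
     {M \<in> A. \<forall>e\<in>set s. shape_at M e} \<times> {b \<in> B. \<forall>e\<in>set s. b (key e) = flips e}"
  by (auto simp: consistent_def)

lemma random_consistent_prob:
  assumes "valid s"
  shows "avg random_space (\<lambda>I. of_bool (consistent I s)) = state_prob s"
proof -
  let ?B = "PiE keys (\<lambda>_. Pow {..<k})"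
  have B: "card ?B > 0" by (auto simp: card_gt_0_iff PiE_eq_empty_iff intro: finite_PiE)
  have "card {b \<in> ?B. \<forall>e\<in>set s. b (key e) \<in> {flips e} \<inter> Pow {..<k}} * card (Pow {..<k}) ^ length s
      = prod_list (map (\<lambda>e. card ({flips e} \<inter> Pow {..<k})) s) * card ?B"
    by (rule card_PiE_prescribed) (use valid_keys[OF assms] in auto)
  moreover have "{b \<in> ?B. \<forall>e\<in>set s. b (key e) \<in> {flips e} \<inter> Pow {..<k}} = {b \<in> ?B. \<forall>e\<in>set s. b (key e) = flips e}"
    using valid_entry[OF assms] by auto
  moreover have "prod_list (map (\<lambda>e. card ({flips e} \<inter> Pow {..<k})) s) = prod_list (map (\<lambda>e. 1) s)"
    using valid_entry[OF assms] by (intro arg_cong[where f = prod_list] map_cong) auto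
  moreover have "prod_list (map (\<lambda>e. 1 :: nat) s) = 1"
    by (induction s) auto
  ultimately have "card {b \<in> ?B. \<forall>e\<in>set s. b (key e) = flips e} * 2 ^ (k * length s) = card ?B"
    by (simp add: card_Pow power_mult)
  from arg_cong[OF this, of real]
  have eq: "real (card {b \<in> ?B. \<forall>e\<in>set s. b (key e) = flips e}) * 2 ^ (k * length s) = real (card ?B)"
    by (simp only: of_nat_mult of_nat_power of_nat_numeral)
  have "avg random_space (\<lambda>I. of_bool (consistent I s))
      = real (card {M \<in> matching_space. \<forall>e\<in>set s. shape_at M e}) / real (card matching_space)
        * (real (card {b \<in> ?B. \<forall>e\<in>set s. b (key e) = flips e}) / real (card ?B))"
    by (subst avg_of_bool[OF finite_random_space])
      (simp add: random_space_def consistent_Collect card_cartesian_product)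
  also have "real (card {b \<in> ?B. \<forall>e\<in>set s. b (key e) = flips e}) / real (card ?B) = 1 / 2 ^ (k * length s)"
    by (rule ratio_cancel) (use B eq in simp_all)
  finally show ?thesis by (simp add: state_prob_def)
qed

end

section \<open>Planted instances as seen through revealed states\<close>

context planted_hypermatchings
begin

text \<open>Besides matchings and assignment, each hyperedge carries its hidden type and its two
  coins; everything is uniform and independent.\<close>

definition planted_space ::
  "((nat \<times> nat \<Rightarrow> nat \<Rightarrow> nat) \<times> nat set \<times> (nat \<times> nat \<Rightarrow> nat \<times> bool \<times> bool)) set" where
  "planted_space = matching_space \<times> Pow {..<k * m} \<times> PiE keys (\<lambda>_. {..<k} \<times> UNIV)"

definition planted_instance ::
  "(nat \<times> nat \<Rightarrow> nat \<Rightarrow> nat) \<times> nat set \<times> (nat \<times> nat \<Rightarrow> nat \<times> bool \<times> bool)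
    \<Rightarrow> (nat \<times> nat \<Rightarrow> nat \<Rightarrow> nat) \<times> (nat \<times> nat \<Rightarrow> nat set)" where
  "planted_instance w = (case w of (M, a, \<theta>) \<Rightarrow> (M, \<lambda>ji.
     {l. l < k \<and> ((l * m + slot_map M (fst ji) l (snd ji) \<in> a) \<noteq>
        (z (fst (\<theta> ji)) l \<noteq> coin (fst (\<theta> ji)) (snd (\<theta> ji)) l))}))"

lemma finite_planted_space [simp]: "finite planted_space"
  unfolding planted_space_def by (intro finite_cartesian_product finite_PiE) auto

lemma planted_space_nonempty: "planted_space \<noteq> {}"
  unfolding planted_space_def using matching_space_nonempty k3
  by (auto simp: PiE_eq_empty_iff lessThan_empty_iff)

definition solutions :: "nat set \<Rightarrow> entry \<Rightarrow> (nat \<times> bool \<times> bool) set" where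
  "solutions a e = {tc \<in> {..<k} \<times> UNIV. planted_flips a e (fst tc) (snd tc) = flips e}"

text \<open>Whether the shapes fit depends on the matchings alone; once they fit, the negations
  depend only on the assignment and \<theta>. Hence the product form.\<close>

lemma consistent_planted:
  "{w \<in> planted_space. consistent (planted_instance w) s} =
     {M \<in> matching_space. \<forall>e\<in>set s. shape_at M e} \<times>
     (SIGMA a:Pow {..<k * m}. {\<theta> \<in> PiE keys (\<lambda>_. {..<k} \<times> UNIV). \<forall>e\<in>set s. key e \<in> keys \<longrightarrow> \<theta> (key e) \<in> solutions a e})"
  if "valid s"
proof -
  have eq: "snd (planted_instance (M, a, \<theta>)) (key e) = flips e \<longleftrightarrow> \<theta> (key e) \<in> solutions a e"
    if "shape_at M e" "\<theta> \<in> PiE keys (\<lambda>_. {..<k} \<times> UNIV)" "key e \<in> keys" for M a \<theta> e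
  proof -
    have "snd (planted_instance (M, a, \<theta>)) (key e) = planted_flips a e (fst (\<theta> (key e))) (snd (\<theta> (key e)))"
      using shape_atD[OF that(1)] by (auto simp: planted_instance_def planted_flips_def key_def var_def)
    moreover have "\<theta> (key e) \<in> {..<k} \<times> UNIV" using that by (rule_tac PiE_mem)
    ultimately show ?thesis by (simp add: solutions_def)
  qed
  have ks: "key e \<in> keys" if "e \<in> set s" for e
    using valid_keys(2)[OF \<open>valid s\<close>] that by auto
  show ?thesis
  proof (rule set_eqI)
    fix w :: "(nat \<times> nat \<Rightarrow> nat \<Rightarrow> nat) \<times> nat set \<times> (nat \<times> nat \<Rightarrow> nat \<times> bool \<times> bool)"
    obtain M a \<theta> where w: "w = (M, a, \<theta>)" by (cases w)
    have M: "fst (planted_instance (M, a, \<theta>)) = M" by (simp add: planted_instance_def)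
    define A where "A e \<longleftrightarrow> snd (planted_instance (M, a, \<theta>)) (key e) = flips e" for e
    have "A e \<longleftrightarrow> \<theta> (key e) \<in> solutions a e"
      if "\<theta> \<in> PiE keys (\<lambda>_. {..<k} \<times> UNIV)" "e \<in> set s" "shape_at M e" for e
      unfolding A_def using eq that ks by blast
    then show "w \<in> {w \<in> planted_space. consistent (planted_instance w) s} \<longleftrightarrow> w \<in>
      {M \<in> matching_space. \<forall>e\<in>set s. shape_at M e} \<times>
      (SIGMA a:Pow {..<k * m}. {\<theta> \<in> PiE keys (\<lambda>_. {..<k} \<times> UNIV). \<forall>e\<in>set s. key e \<in> keys \<longrightarrow> \<theta> (key e) \<in> solutions a e})"
      unfolding w consistent_def planted_space_def mem_Collect_eq mem_Sigma_iff M A_def[symmetric]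
      using ks by blast
  qed
qed

text \<open>Each factor is a sum over the type of one entry. Expanding the product gives a sum over
  all type choices, which \<open>type_avg\<close> divides by \<open>k ^ length s\<close>.\<close>

lemma prod_solutions:
  "real (prod_list (map (\<lambda>e. card (solutions a e)) s)) = real k ^ length s * type_avg s (\<lambda>ls. real (weight a ls))"
proof (induction s)
  case Nil
  then show ?case by (simp add: weight_def)
next
  case (Cons e s)
  have "solutions a e = (SIGMA t:{..<k}. {c. planted_flips a e t c = flips e})"
  proof (rule set_eqI)
    fix tc
    show "tc \<in> solutions a e \<longleftrightarrow> tc \<in> (SIGMA t:{..<k}. {c. planted_flips a e t c = flips e})"
      by (cases tc) (simp only: solutions_def mem_Collect_eq mem_Sigma_iff UNIV_I simp_thms prod.sel)
  qed
  then have "card (solutions a e) = (\<Sum>t<k. coin_choices a e t (flips e))"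
    by (simp add: coin_choices_def)
  moreover have "type_avg (e # s) (\<lambda>ls. real (weight a ls))
      = (\<Sum>t<k. real (coin_choices a e t (flips e)) * type_avg s (\<lambda>ls. real (weight a ls))) / real k"
    by (simp add: weight_def type_avg_cmult)
  ultimately show ?case
    using k3 Cons by (simp add: sum_distrib_right[symmetric])
qed

lemma clean_weight_ge:
  assumes "valid s" "map fst ls = s"
  shows "of_bool (clean ls) * (2 ^ (k * m) * 4 ^ length s / 2 ^ (k * length s)) \<le> real (\<Sum>a\<in>Pow {..<k * m}. weight a ls)"
proof (cases "clean ls")
  case True
  have "real (\<Sum>a\<in>Pow {..<k * m}. weight a ls) * 2 ^ (k * length ls) = 2 ^ (k * m) * 4 ^ length ls"
  proof -
    have "(\<Sum>a\<in>Pow {..<k * m}. weight a ls) * 2 ^ (k * length ls) = 2 ^ (k * m) * 4 ^ length ls"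
      using planted_count[of ls] assms True by blast
    from arg_cong[OF this, of real] show ?thesis
      by (simp only: of_nat_mult of_nat_power of_nat_numeral)
  qed
  moreover have "length ls = length s" using assms(2) by auto
  ultimately show ?thesis using True by (simp add: field_simps)
qed (simp add: sum_nonneg)

text \<open>Clean type choices contribute exactly what a random instance would, by
  \<open>planted_count\<close>; dirty ones contribute a nonnegative amount and are dropped.\<close>

lemma planted_consistent_prob:
  assumes "valid s"
  shows "state_prob s * (1 - dirty_frac s) \<le> avg planted_space (\<lambda>w. of_bool (consistent (planted_instance w) s))"
proof -
  let ?n = "length s"
  let ?T = "{..<k} \<times> (UNIV :: (bool \<times> bool) set)"
  let ?B = "PiE keys (\<lambda>_. ?T)"
  let ?A = "\<lambda>a. {\<theta> \<in> ?B. \<forall>e\<in>set s. key e \<in> keys \<longrightarrow> \<theta> (key e) \<in> solutions a e}"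
  let ?P = "Pow {..<k * m}"
  have cT: "card ?T = 4 * k" by (simp add: card_cartesian_product card_UNIV_bool flip: UNIV_Times_UNIV)
  have finT: "finite ?T" by simp
  have B: "real (card ?B) > 0"
    using k3 finT by (auto simp: card_gt_0_iff PiE_eq_empty_iff lessThan_empty_iff intro!: finite_PiE)
  have A: "real (card (?A a)) = type_avg s (\<lambda>ls. real (weight a ls)) * real (card ?B) / 4 ^ ?n" for a
  proof -
    have "?A a = {\<theta> \<in> ?B. \<forall>e\<in>set s. \<theta> (key e) \<in> solutions a e}"
      using valid_keys(2)[OF assms] by auto
    moreover have "card {\<theta> \<in> ?B. \<forall>e\<in>set s. \<theta> (key e) \<in> solutions a e} * card ?T ^ ?n
        = prod_list (map (\<lambda>e. card (solutions a e)) s) * card ?B"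
      by (rule card_PiE_prescribed) (use valid_keys[OF assms] in \<open>auto simp: solutions_def\<close>)
    ultimately have "real (card (?A a)) * real (4 * k) ^ ?n
        = real (prod_list (map (\<lambda>e. card (solutions a e)) s)) * real (card ?B)"
      unfolding cT by (simp only: of_nat_mult[symmetric] of_nat_power[symmetric])
    then have "real (card (?A a)) * real (4 * k) ^ ?n
        = real k ^ ?n * type_avg s (\<lambda>ls. real (weight a ls)) * real (card ?B)"
      unfolding prod_solutions .
    then show ?thesis
      using k3 by (simp add: power_mult_distrib field_simps)
  qed
  have "(1 - dirty_frac s) * (2 ^ (k * m) * 4 ^ ?n / 2 ^ (k * ?n))
      = type_avg s (\<lambda>ls. of_bool (clean ls) * (2 ^ (k * m) * 4 ^ ?n / 2 ^ (k * ?n)))"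
  proof -
    have "type_avg s (\<lambda>ls. of_bool (clean ls)) + dirty_frac s = type_avg s (\<lambda>ls. 1)"
      unfolding dirty_frac_def type_avg_add[symmetric] by (rule type_avg_cong) auto
    then have "1 - dirty_frac s = type_avg s (\<lambda>ls. of_bool (clean ls))" by simp
    then show ?thesis
      using type_avg_cmult[of s "2 ^ (k * m) * 4 ^ ?n / 2 ^ (k * ?n)" "\<lambda>ls. of_bool (clean ls)"]
      by (simp only: mult.commute)
  qed
  also have "\<dots> \<le> type_avg s (\<lambda>ls. real (\<Sum>a\<in>?P. weight a ls))"
    by (rule type_avg_mono) (rule clean_weight_ge[OF assms])
  also have "\<dots> = (\<Sum>a\<in>?P. type_avg s (\<lambda>ls. real (weight a ls)))"
    by (simp add: type_avg_sum)
  finally have main: "(1 - dirty_frac s) * (2 ^ (k * m) * 4 ^ ?n / 2 ^ (k * ?n))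
      \<le> (\<Sum>a\<in>?P. type_avg s (\<lambda>ls. real (weight a ls)))" .
  have "(1 - dirty_frac s) / 2 ^ (k * ?n)
      = (1 - dirty_frac s) * (2 ^ (k * m) * 4 ^ ?n / 2 ^ (k * ?n)) / 4 ^ ?n / 2 ^ (k * m)"
    by simp
  also have "\<dots> \<le> (\<Sum>a\<in>?P. type_avg s (\<lambda>ls. real (weight a ls))) / 4 ^ ?n / 2 ^ (k * m)"
    by (intro divide_right_mono main) auto
  also have "\<dots> = (\<Sum>a\<in>?P. real (card (?A a))) / (2 ^ (k * m) * real (card ?B))"
    unfolding A using B by (simp add: sum_divide_distrib[symmetric] sum_distrib_right[symmetric])
  finally have Q: "(1 - dirty_frac s) / 2 ^ (k * ?n) \<le> (\<Sum>a\<in>?P. real (card (?A a))) / (2 ^ (k * m) * real (card ?B))" .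
  have finA: "finite (?A a)" for a
    using finT by (auto intro!: finite_subset[OF _ finite_PiE[of keys "\<lambda>_. ?T"]])
  have "avg planted_space (\<lambda>w. of_bool (consistent (planted_instance w) s))
      = real (card {M \<in> matching_space. \<forall>e\<in>set s. shape_at M e}) / real (card matching_space)
        * ((\<Sum>a\<in>?P. real (card (?A a))) / (2 ^ (k * m) * real (card ?B)))"
    unfolding avg_of_bool[OF finite_planted_space] consistent_planted[OF assms]
    using finA by (simp add: planted_space_def card_cartesian_product card_Pow)
  then show ?thesis
    using mult_left_mono[OF Q, of "real (card {M \<in> matching_space. \<forall>e\<in>set s. shape_at M e}) / real (card matching_space)"]
    by (simp add: state_prob_def)
qed

end

locale planted_exploration = bounded_exploration + planted_hypermatchings
begin

text \<open>No tree can reject planted instances rarely and also accept random ones rarely.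
  Rejecting leaves are charged to the planted law, with weight \<open>1 - dirty_frac\<close>, and
  accepting leaves to the random law; together they miss at most the expected
  \<open>dirty_frac\<close>.\<close>

theorem planted_indistinguishable:
  "1 - (real q * base_rate + (real q)\<^sup>2 * real k * reach_rate * touch_rate)
    \<le> avg planted_space (\<lambda>w. of_bool (\<not> run (answer (planted_instance w)) t q))
      + avg random_space (\<lambda>I. of_bool (run (answer I) t q))"
proof -
  have sp: "state_prob [] = 1" using matching_space_nonempty by (simp add: state_prob_def)
  have c: "consistent I []" for I by (simp add: consistent_def)
  have pM: "fst (planted_instance w) \<in> matching_space" if "w \<in> planted_space" for w
    using that by (auto simp: planted_space_def planted_instance_def)
  have rM: "fst I \<in> matching_space" if "I \<in> random_space" for I
    using that by (auto simp: random_space_def)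
  have "state_prob [] * lazy_value (\<lambda>b s. of_bool (b = False) * (1 - dirty_frac s)) t q []
      \<le> avg planted_space (\<lambda>w. of_bool (consistent (planted_instance w) [] \<and> run (answer (planted_instance w)) t q = False))"
    by (rule run_prob_ge[OF finite_planted_space planted_space_nonempty pM _ valid.Nil _ q_less])
      (simp_all add: planted_consistent_prob)
  then have 1: "lazy_value (\<lambda>b s. of_bool (b = False) * (1 - dirty_frac s)) t q []
      \<le> avg planted_space (\<lambda>w. of_bool (\<not> run (answer (planted_instance w)) t q))"
    by (simp add: sp c)
  have "state_prob [] * lazy_value (\<lambda>b s. of_bool (b = True) * 1) t q []
      \<le> avg random_space (\<lambda>I. of_bool (consistent I [] \<and> run (answer I) t q = True))"
    by (rule run_prob_ge[OF finite_random_space random_space_nonempty rM _ valid.Nil _ q_less])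
      (simp_all add: random_consistent_prob)
  then have 2: "lazy_value (\<lambda>b s. of_bool (b = True)) t q []
      \<le> avg random_space (\<lambda>I. of_bool (run (answer I) t q))"
    by (simp add: sp c)
  have df: "0 \<le> dirty_frac s" for s
    unfolding dirty_frac_def using type_avg_mono[of s "\<lambda>_. 0"] by simp
  have "1 = lazy_value (\<lambda>b s. 1) t q []"
    using lazy_value_const[OF valid.Nil, of q 1 t] q_less by simp
  \<comment> \<open>Pointwise: a rejecting leaf gives exactly 1, an accepting one at least
    1.\<close>
  also have "\<dots> \<le> lazy_value (\<lambda>b s. (of_bool (b = False) * (1 - dirty_frac s) + of_bool (b = True)) + dirty_frac s) t q []"
    by (rule lazy_value_mono) (use df in \<open>auto split: bool.split\<close>)
  also have "\<dots> = lazy_value (\<lambda>b s. of_bool (b = False) * (1 - dirty_frac s)) t q []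
      + lazy_value (\<lambda>b s. of_bool (b = True)) t q [] + lazy_value (\<lambda>b. dirty_frac) t q []"
    unfolding lazy_value_add ..
  finally show ?thesis using 1 2 lazy_dirty_bound[of t] by linarith
qed

end

section \<open>Instances of the constraint satisfaction problem\<close>

lemma avg_fst:
  assumes "finite A" "finite B" "B \<noteq> {}"
  shows "avg (A \<times> B) (\<lambda>w. f (fst w)) = avg A f"
proof -
  have "(\<Sum>w\<in>A \<times> B. f (fst w)) = (\<Sum>x\<in>A. \<Sum>y\<in>B. f x)"
    by (subst sum.cartesian_product) (simp add: split_def)
  also have "\<dots> = real (card B) * (\<Sum>x\<in>A. f x)"
    by (simp add: sum_distrib_left)
  finally show ?thesis
    using assms by (simp add: avg_def card_cartesian_product)
qed

lemma avg_Times: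
  assumes "finite A" "finite B"
  shows "avg (A \<times> B) f = avg A (\<lambda>x. avg B (\<lambda>y. f (x, y)))"
  by (simp add: avg_def sum.cartesian_product card_cartesian_product sum_divide_distrib mult.commute)

context hypermatchings
begin

text \<open>The variables from \<open>k * m\<close> on stay isolated; they absorb the remainder when
  \<open>k\<close> does not divide \<open>n\<close>.\<close>

definition csp_of ::
  "nat \<Rightarrow> (nat \<times> nat \<Rightarrow> nat \<Rightarrow> nat) \<times> (nat \<times> nat \<Rightarrow> nat set) \<Rightarrow> csp" where
  "csp_of n I = \<lparr>nvars = n, cstrs = constraint_at I ` keys, incidence = (\<lambda>x.
     if x < k * m then map (\<lambda>j. constraint_at I (j, index_of (fst I) j x)) [0..<d] else [])\<rparr>"

text \<open>Since constraints form a set, two matchings sharing a hyperedge could make constraints coincide.\<close>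

definition degenerate :: "(nat \<times> nat \<Rightarrow> nat \<Rightarrow> nat) \<Rightarrow> bool" where
  "degenerate M \<longleftrightarrow> (\<exists>j<d. \<exists>j'<d. \<exists>i<m. j \<noteq> j' \<and> tuple_at M j i = tuple_at M j' i)"

text \<open>The empty instance stands in for degenerate matchings, so every outcome is a legal
  instance and every planted outcome is satisfiable.\<close>

definition csp_or_empty ::
  "nat \<Rightarrow> (nat \<times> nat \<Rightarrow> nat \<Rightarrow> nat) \<times> (nat \<times> nat \<Rightarrow> nat set) \<Rightarrow> csp" where
  "csp_or_empty n I =
     (if degenerate (fst I) then \<lparr>nvars = n, cstrs = {}, incidence = (\<lambda>x. [])\<rparr> else csp_of n I)"

lemma slot_map_less:
  assumes "M \<in> matching_space" "j < d" "l < k" "i < m"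
  shows "slot_map M j l i < m"
  using permutes_in_image[OF slot_map_permutes[OF assms(1-3)], of i] assms(4) by simp

lemma slot_less:
  assumes "M \<in> matching_space" "j < d" "l < k" "i < m"
  shows "l * m + slot_map M j l i < k * m"
proof -
  have "l * m + slot_map M j l i < Suc l * m" using slot_map_less[OF assms] by simp
  also have "\<dots> \<le> k * m" using assms(3) by (intro mult_le_mono1) simp
  finally show ?thesis .
qed

lemma index_of_less:
  assumes "M \<in> matching_space" "j < d" "x < k * m"
  shows "index_of M j x < m"
proof -
  have "x div m < k" using assms(3) by (simp add: less_mult_imp_div_less)
  then have "inv (slot_map M j (x div m)) permutes {..<m}"
    using slot_map_permutes[OF assms(1,2)] permutes_inv by blast
  then show ?thesis
    unfolding index_of_def using permutes_in_image[of _ "{..<m}" "x mod m"] m_pos by fastforce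
qed

lemma index_of_eq_iff:
  assumes "M \<in> matching_space" "j < d" "x < k * m" "i < m"
  shows "(\<exists>l<k. x = l * m + slot_map M j l i) \<longleftrightarrow> i = index_of M j x"
proof
  assume "\<exists>l<k. x = l * m + slot_map M j l i"
  then obtain l where l: "l < k" "x = l * m + slot_map M j l i" by blast
  then have "x div m = l" "x mod m = slot_map M j l i"
    using slot_map_less[OF assms(1,2) l(1) assms(4)] by simp_all
  then show "i = index_of M j x"
    unfolding index_of_def using permutes_inverses(2)[OF slot_map_permutes[OF assms(1,2) l(1)], of i] by simp
next
  assume i: "i = index_of M j x"
  have l: "x div m < k" using assms(3) by (simp add: less_mult_imp_div_less)
  have "slot_map M j (x div m) i = x mod m"
    unfolding i index_of_def using permutes_inverses(1)[OF slot_map_permutes[OF assms(1,2) l]] by simp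
  then show "\<exists>l<k. x = l * m + slot_map M j l i"
    using l by (intro exI[of _ "x div m"]) simp
qed

text \<open>The variables alone identify the hyperedge: the one in class 0 gives the index, and
  nondegeneracy then gives the matching. Hence negations cannot matter for whether two constraints
  coincide.\<close>

lemma constraint_at_inj:
  assumes M: "fst I \<in> matching_space" and nd: "\<not> degenerate (fst I)"
    and k: "ji \<in> keys" "ji' \<in> keys" and eq: "fst (constraint_at I ji) = fst (constraint_at I ji')"
  shows "ji = ji'"
proof -
  obtain j i j' i' where ji: "ji = (j, i)" "ji' = (j', i')" by (cases ji, cases ji')
  have lt: "j < d" "j' < d" "i < m" "i' < m" using k by (auto simp: ji keys_def)
  have sl: "slot_map (fst I) j l i = slot_map (fst I) j' l i'" if "l < k" for l
    using eq that by (auto simp: constraint_at_def ji)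
  from sl[of 0] have "i = i'" using k3 by (simp add: slot_map_def)
  moreover have "tuple_at (fst I) j i = tuple_at (fst I) j' i'"
    unfolding tuple_at_def using sl by (intro restrict_ext) auto
  ultimately have "j = j'" using nd lt unfolding degenerate_def by blast
  then show ?thesis using \<open>i = i'\<close> by (simp add: ji)
qed

lemma csp_of_instance:
  assumes M: "fst I \<in> matching_space" and nd: "\<not> degenerate (fst I)" and n: "k * m \<le> n"
  shows "csp_of n I \<in> csp_instances k d n"
proof -
  have len: "length (fst (constraint_at I ji)) = k" "length (snd (constraint_at I ji)) = k" for ji
    by (simp_all add: constraint_at_def)
  have mem: "x \<in> set (fst (constraint_at I (j, i))) \<longleftrightarrow> (\<exists>l<k. x = l * m + slot_map (fst I) j l i)" for x j i
    by (auto simp: constraint_at_def)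
  have small: "x < k * m" if "x \<in> set (fst (constraint_at I (j, i)))" "j < d" "i < m" for x j i
    using that slot_less[OF M] by (auto simp: mem)
  have inc: "distinct (incidence (csp_of n I) x) \<and>
      set (incidence (csp_of n I) x) = {c \<in> cstrs (csp_of n I). x \<in> set (fst c)} \<and>
      length (incidence (csp_of n I) x) \<le> d" for x
  proof (cases "x < k * m")
    case True
    have "inj_on (\<lambda>j. constraint_at I (j, index_of (fst I) j x)) {0..<d}"
    proof (rule inj_onI)
      fix j j' assume j: "j \<in> {0..<d}" "j' \<in> {0..<d}"
        and eq: "constraint_at I (j, index_of (fst I) j x) = constraint_at I (j', index_of (fst I) j' x)"
      have "(j, index_of (fst I) j x) = (j', index_of (fst I) j' x)"
        by (rule constraint_at_inj[OF M nd]) (use j eq index_of_less[OF M _ True] in \<open>simp_all add: keys_def\<close>)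
      then show "j = j'" by simp
    qed
    moreover have "constraint_at I ji \<in> (\<lambda>j. constraint_at I (j, index_of (fst I) j x)) ` {0..<d}"
      if "ji \<in> keys" "x \<in> set (fst (constraint_at I ji))" for ji
      using that index_of_eq_iff[OF M _ True] by (cases ji) (auto simp: keys_def mem)
    moreover have "x \<in> set (fst (constraint_at I (j, index_of (fst I) j x)))" "(j, index_of (fst I) j x) \<in> keys" if "j < d" for j
      using index_of_eq_iff[OF M that True index_of_less[OF M that True]] index_of_less[OF M that True] that
      by (auto simp: mem keys_def)
    ultimately show ?thesis
      using True by (auto simp: csp_of_def distinct_map)
  next
    case False
    have "x \<notin> set (fst c)" if c: "c \<in> cstrs (csp_of n I)" for c
    proof -
      obtain j i where "c = constraint_at I (j, i)" "j < d" "i < m"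
        using c by (auto simp: csp_of_def keys_def)
      then show ?thesis using small False by blast
    qed
    moreover have "incidence (csp_of n I) x = []" using False by (simp add: csp_of_def)
    ultimately show ?thesis by simp
  qed
  have "length (fst c) = k \<and> length (snd c) = k \<and> set (fst c) \<subseteq> {..<n}" if "c \<in> cstrs (csp_of n I)" for c
    using that small n len by (fastforce simp: csp_of_def keys_def)
  then show ?thesis
    using inc by (auto simp: csp_instances_def split_def) (simp add: csp_of_def)
qed

lemma oracle_answer_csp_of:
  assumes "k * m \<le> n"
  shows "oracle_answer (csp_of n I) = answer I"
proof (intro ext)
  fix x i
  show "oracle_answer (csp_of n I) x i = answer I x i"
    using assms by (auto simp: oracle_answer_def answer_def csp_of_def)
qed

lemma csp_or_empty_instance:
  assumes "fst I \<in> matching_space" "k * m \<le> n"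
  shows "csp_or_empty n I \<in> csp_instances k d n"
  using csp_of_instance[OF assms(1) _ assms(2)] unfolding csp_or_empty_def
  by (auto simp: csp_instances_def)

lemma accepts_csp_or_empty:
  assumes "k * m \<le> n" "\<not> degenerate (fst I)" "queries (csp_or_empty n I) t \<le> q"
  shows "accepts (csp_or_empty n I) t = run (answer I) t q"
  using run_eq_accepts[OF assms(3)] assms(2) by (simp add: csp_or_empty_def oracle_answer_csp_of[OF assms(1)])

text \<open>Both matchings contain a given tuple with probability
  \<open>1 / m ^ (2 * (k - 1))\<close>, and \<open>m ^ (k - 1)\<close> tuples start with
  \<open>i\<close>. The probability is read off from \<open>state_prob\<close> of a state with two
  entries.\<close>

lemma two_edges_prob:
  assumes "j < d" "j' < d" "j \<noteq> j'" "i < m" "1 < m"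
  shows "real (card {M \<in> matching_space. tuple_at M j i = tuple_at M j' i}) \<le> real (card matching_space) / real m ^ (k - 1)"
proof -
  let ?V = "tuple_choices [] i j"
  \<comment> \<open>Variable \<open>i\<close> lies in class 0, so it is its own index. The empty set
    of negations is an arbitrary choice: \<open>shape_at\<close> does not look at it.\<close>
  let ?e = "\<lambda>j v. Entry j 0 v {}"
  have x: "i < k * m" "i div m = 0" "i mod m = i" using assms(4) k3 by (auto intro: less_le_trans)
  have used: "used [] j = 0" for j by (simp add: used_def)
  have V: "card ?V = m ^ (k - 1)" using card_tuple_choices[OF valid.Nil x(1)] used by simp
  have v0: "v 0 = i" if "v \<in> ?V" for v
    using PiE_mem[OF that[unfolded tuple_choices_def], of 0] k3 x by simp
  have count: "real (card {M \<in> matching_space. tuple_at M j i = v \<and> tuple_at M j' i = v}) * (real m ^ (k - 1) * real m ^ (k - 1)) = real (card matching_space)"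
    if v: "v \<in> ?V" for v
  proof -
    have e1: "?e j v \<in> extensions [] i j" using v x by (auto simp: extensions_def)
    have v1: "valid [?e j v]" by (rule valid.Cons[OF valid.Nil x(1) assms(1) _ e1]) simp
    have "free_slots [?e j v] j' l = free_slots [] j l" for l
      using assms(3) by (auto simp: free_slots_def)
    then have tc: "tuple_choices [?e j v] i j' = ?V" by (simp add: tuple_choices_def cong: if_cong)
    have e2: "?e j' v \<in> extensions [?e j v] i j'" using v x tc by (auto simp: extensions_def)
    have v2: "valid [?e j' v, ?e j v]"
      by (rule valid.Cons[OF v1 x(1) assms(2) _ e2]) (use assms(3) in \<open>simp add: covers_def\<close>)
    have u1: "used [?e j v] j' = 0" using assms(3) by (simp add: used_def)
    have s0: "state_prob [] = 1" using matching_space_nonempty by (simp add: state_prob_def)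
    have p1: "state_prob [?e j v] * real (card (extensions [] i j)) = state_prob []"
      by (rule state_prob_extension[OF valid.Nil v1 e1 x(1) assms(1)]) (use assms(5) in simp)
    have p2: "state_prob [?e j' v, ?e j v] * real (card (extensions [?e j v] i j')) = state_prob [?e j v]"
      by (rule state_prob_extension[OF v1 v2 e2 x(1) assms(2)]) (use assms(5) in simp)
    have ce: "card (extensions [] i j) = m ^ (k - 1) * 2 ^ k" "card (extensions [?e j v] i j') = m ^ (k - 1) * 2 ^ k"
      using card_extensions[OF valid.Nil x(1)] card_extensions[OF v1 x(1)] used u1 by simp_all
    have "{M \<in> matching_space. \<forall>e\<in>set [?e j' v, ?e j v]. shape_at M e}
        = {M \<in> matching_space. tuple_at M j i = v \<and> tuple_at M j' i = v}"
      using v0[OF v] by (auto simp: shape_at_def)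
    then have a: "state_prob [?e j' v, ?e j v] * 2 ^ (2 * k) * real (card matching_space)
        = real (card {M \<in> matching_space. tuple_at M j i = v \<and> tuple_at M j' i = v})"
      using matching_space_nonempty unfolding state_prob_def by (simp add: power_mult[symmetric] mult.commute mult_2_right)
    have b: "state_prob [?e j' v, ?e j v] * 2 ^ (2 * k) * (real m ^ (k - 1) * real m ^ (k - 1)) = 1"
    proof -
      have "state_prob [?e j' v, ?e j v] * 2 ^ (2 * k) * (real m ^ (k - 1) * real m ^ (k - 1))
          = (state_prob [?e j' v, ?e j v] * real (m ^ (k - 1) * 2 ^ k)) * real (m ^ (k - 1) * 2 ^ k)"
        by (simp add: power_add mult_2)
      also have "\<dots> = 1" by (simp only: p2[unfolded ce] p1[unfolded ce] s0)
      finally show ?thesis .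
    qed
    have "real (card {M \<in> matching_space. tuple_at M j i = v \<and> tuple_at M j' i = v}) * (real m ^ (k - 1) * real m ^ (k - 1))
        = (state_prob [?e j' v, ?e j v] * 2 ^ (2 * k) * (real m ^ (k - 1) * real m ^ (k - 1))) * real (card matching_space)"
      unfolding a[symmetric] by (simp only: mult_ac)
    then show ?thesis unfolding b by simp
  qed
  have mp: "0 < real m ^ (k - 1)" using assms(5) by simp
  have each: "real (card {M \<in> matching_space. tuple_at M j i = v \<and> tuple_at M j' i = v})
      = real (card matching_space) / (real m ^ (k - 1) * real m ^ (k - 1))" if "v \<in> ?V" for v
    using count[OF that] mp by (intro eq_divide_imp) auto
  have "{M \<in> matching_space. tuple_at M j i = tuple_at M j' i}
      \<subseteq> (\<Union>v\<in>?V. {M \<in> matching_space. tuple_at M j i = v \<and> tuple_at M j' i = v})"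
  proof
    fix M assume M: "M \<in> {M \<in> matching_space. tuple_at M j i = tuple_at M j' i}"
    have "tuple_at M j i \<in> ?V"
      unfolding tuple_choices_def
    proof (rule PiE_I)
      fix l assume l: "l \<in> {..<k}"
      have "slot_map M j l i < m" using M slot_map_less[of M j l i] assms(1,4) l by simp
      then show "tuple_at M j i l \<in> (if l = i div m then {i mod m} else free_slots [] j l)"
        using l x by (cases "l = 0") (simp_all add: tuple_at_def free_slots_def slot_map_def)
    qed (simp add: tuple_at_def)
    then show "M \<in> (\<Union>v\<in>?V. {M \<in> matching_space. tuple_at M j i = v \<and> tuple_at M j' i = v})"
      using M by auto
  qed
  then have "card {M \<in> matching_space. tuple_at M j i = tuple_at M j' i}
      \<le> card (\<Union>v\<in>?V. {M \<in> matching_space. tuple_at M j i = v \<and> tuple_at M j' i = v})"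
    by (rule card_mono[rotated]) simp
  also have "\<dots> \<le> (\<Sum>v\<in>?V. card {M \<in> matching_space. tuple_at M j i = v \<and> tuple_at M j' i = v})"
    by (rule card_UN_le) simp
  finally have "real (card {M \<in> matching_space. tuple_at M j i = tuple_at M j' i})
      \<le> (\<Sum>v\<in>?V. real (card {M \<in> matching_space. tuple_at M j i = v \<and> tuple_at M j' i = v}))"
    by (simp only: of_nat_sum[symmetric] of_nat_le_iff)
  also have "\<dots> = (\<Sum>v\<in>?V. real (card matching_space) / (real m ^ (k - 1) * real m ^ (k - 1)))"
    by (rule sum.cong[OF refl each])
  also have "\<dots> = real (card matching_space) / real m ^ (k - 1)"
    using mp by (simp add: V)
  finally show ?thesis .
qed

text \<open>A union bound over fewer than \<open>d^2 * m\<close> coincidences, each of probability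
  at most \<open>1 / m^2\<close> because \<open>k\<close> is at least 3.\<close>

lemma degenerate_prob:
  assumes "1 < m"
  shows "avg matching_space (\<lambda>M. of_bool (degenerate M)) \<le> (real d)\<^sup>2 / real m"
proof -
  let ?I = "{(j, j'). j < d \<and> j' < d \<and> j \<noteq> j'} \<times> {..<m}"
  let ?A = "\<lambda>((j, j'), i). {M \<in> matching_space. tuple_at M j i = tuple_at M j' i}"
  have sub: "{(j, j'). j < d \<and> j' < d \<and> j \<noteq> j'} \<subseteq> {..<d} \<times> {..<d}" by auto
  then have fin: "finite {(j, j'). j < d \<and> j' < d \<and> j \<noteq> j'}" by (rule finite_subset) simp
  have "card ?I \<le> card (({..<d} \<times> {..<d}) \<times> {..<m})"
    by (rule card_mono) (use sub in auto)
  then have cI: "real (card ?I) \<le> (real d)\<^sup>2 * real m"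
    by (simp add: card_cartesian_product power2_eq_square flip: of_nat_mult)
  have "{M \<in> matching_space. degenerate M} \<subseteq> (\<Union>p\<in>?I. ?A p)"
  proof
    fix M assume "M \<in> {M \<in> matching_space. degenerate M}"
    then obtain j j' i where "M \<in> matching_space" "j < d" "j' < d" "j \<noteq> j'" "i < m" "tuple_at M j i = tuple_at M j' i"
      unfolding degenerate_def by blast
    then have "((j, j'), i) \<in> ?I" "M \<in> ?A ((j, j'), i)" by auto
    then show "M \<in> (\<Union>p\<in>?I. ?A p)" by (rule UN_I)
  qed
  then have "card {M \<in> matching_space. degenerate M} \<le> card (\<Union>p\<in>?I. ?A p)"
    by (rule card_mono[rotated]) (use fin in auto)
  also have "\<dots> \<le> (\<Sum>p\<in>?I. card (?A p))"
    by (rule card_UN_le) (use fin in simp)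
  finally have "real (card {M \<in> matching_space. degenerate M}) \<le> (\<Sum>p\<in>?I. real (card (?A p)))"
    by (simp only: of_nat_sum[symmetric] of_nat_le_iff)
  also have "\<dots> \<le> (\<Sum>p\<in>?I. real (card matching_space) / real m ^ (k - 1))"
    by (rule sum_mono) (use two_edges_prob assms in auto)
  also have "\<dots> \<le> (real d)\<^sup>2 * real m * (real (card matching_space) / real m ^ (k - 1))"
    using mult_right_mono[OF cI, of "real (card matching_space) / real m ^ (k - 1)"] by simp
  also have "\<dots> \<le> (real d)\<^sup>2 * real m * (real (card matching_space) / real m ^ 2)"
  proof -
    have "real m ^ 2 \<le> real m ^ (k - 1)" using assms k3 by (intro power_increasing) auto
    then show ?thesis using assms by (intro mult_left_mono divide_left_mono) auto
  qed
  also have "\<dots> = (real d)\<^sup>2 / real m * real (card matching_space)"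
    using assms by (simp add: power2_eq_square)
  finally show ?thesis
    using card_matching_space by (simp add: avg_of_bool divide_le_eq)
qed

definition local_input :: "nat set \<Rightarrow> (nat \<times> nat \<Rightarrow> nat \<Rightarrow> nat) \<Rightarrow> nat \<times> nat \<Rightarrow> nat set \<Rightarrow> bool list" where
  "local_input a M ji B =
     map (\<lambda>l. (l * m + slot_map M (fst ji) l (snd ji) \<in> a) \<noteq> (l \<in> B)) [0..<k]"

lemma bij_betw_local_input: "bij_betw (local_input a M ji) (Pow {..<k}) (cube k)"
proof (rule bij_betwI[where g = "\<lambda>x. {l. l < k \<and> (l * m + slot_map M (fst ji) l (snd ji) \<in> a) \<noteq> x ! l}"])
  show "local_input a M ji \<in> Pow {..<k} \<rightarrow> cube k"
    by (auto simp: local_input_def cube_def)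
next
  show "(\<lambda>x. {l. l < k \<and> (l * m + slot_map M (fst ji) l (snd ji) \<in> a) \<noteq> x ! l}) \<in> cube k \<rightarrow> Pow {..<k}"
    by auto
next
  fix B assume "B \<in> Pow {..<k}"
  then show "{l. l < k \<and> (l * m + slot_map M (fst ji) l (snd ji) \<in> a) \<noteq> local_input a M ji B ! l} = B"
    by (auto simp: local_input_def)
next
  fix x assume "x \<in> cube k"
  then show "local_input a M ji {l. l < k \<and> (l * m + slot_map M (fst ji) l (snd ji) \<in> a) \<noteq> x ! l} = x"
    by (intro nth_equalityI) (auto simp: local_input_def cube_def)
qed

lemma card_local_violations:
  "card {B \<in> Pow {..<k}. \<not> P (local_input a M ji B)} = card (unsat_inputs k P)"
proof -
  have "bij_betw (local_input a M ji) {B \<in> Pow {..<k}. \<not> P (local_input a M ji B)} (unsat_inputs k P)"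
    using bij_betw_local_input[of a M ji] unfolding unsat_inputs_def bij_betw_def inj_on_def by auto
  then show ?thesis by (rule bij_betw_same_card)
qed

lemma cstr_sat_constraint_at:
  "cstr_sat P f (constraint_at I ji) \<longleftrightarrow> P (map (\<lambda>l. f (l * m + slot_map (fst I) (fst ji) l (snd ji)) \<noteq> (l \<in> snd I ji)) [0..<k])"
  by (simp add: cstr_sat_def constraint_at_def zip_map_map zip_same_conv_map o_def)

definition violations :: "(bool list \<Rightarrow> bool) \<Rightarrow> (nat \<times> nat \<Rightarrow> nat \<Rightarrow> nat) \<Rightarrow> nat set \<Rightarrow> (nat \<times> nat \<Rightarrow> nat set) \<Rightarrow> nat" where
  "violations P M a b = card {ji \<in> keys. \<not> P (local_input a M ji (b ji))}"

text \<open>Whatever is removed must contain every constraint violated by the assignment that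
  satisfies the rest, and distinct keys give distinct constraints.\<close>

lemma far_csp_of:
  assumes M: "fst I \<in> matching_space" and nd: "\<not> degenerate (fst I)"
    and viol: "\<And>a. a \<subseteq> {..<k * m} \<Longrightarrow> \<epsilon> * real d * real n / real k \<le> real (violations P (fst I) a (snd I))"
  shows "far k P d \<epsilon> (csp_of n I)"
  unfolding far_def
proof (intro allI impI)
  fix S assume S: "S \<subseteq> cstrs (csp_of n I) \<and> satisfiable P (cstrs (csp_of n I) - S)"
  then obtain f where f: "\<And>c. c \<in> cstrs (csp_of n I) - S \<Longrightarrow> cstr_sat P f c"
    by (auto simp: satisfiable_def)
  define a where "a = {v. v < k * m \<and> f v}"
  let ?W = "{ji \<in> keys. \<not> P (local_input a (fst I) ji (snd I ji))}"
  have cs: "cstrs (csp_of n I) = constraint_at I ` keys" by (simp add: csp_of_def)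
  have sat: "cstr_sat P f (constraint_at I ji) \<longleftrightarrow> P (local_input a (fst I) ji (snd I ji))" if "ji \<in> keys" for ji
  proof -
    have "(l * m + slot_map (fst I) (fst ji) l (snd ji) \<in> a) = f (l * m + slot_map (fst I) (fst ji) l (snd ji))" if "l < k" for l
      using slot_less[OF M _ that] \<open>ji \<in> keys\<close> by (auto simp: a_def keys_def)
    then have "local_input a (fst I) ji (snd I ji) = map (\<lambda>l. f (l * m + slot_map (fst I) (fst ji) l (snd ji)) \<noteq> (l \<in> snd I ji)) [0..<k]"
      by (simp add: local_input_def)
    then show ?thesis by (simp add: cstr_sat_constraint_at)
  qed
  have sub: "constraint_at I ` ?W \<subseteq> S"
  proof
    fix c assume "c \<in> constraint_at I ` ?W"
    then obtain ji where ji: "ji \<in> ?W" "c = constraint_at I ji" by blast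
    then have "\<not> cstr_sat P f c" "c \<in> cstrs (csp_of n I)" using sat by (auto simp: cs)
    then show "c \<in> S" using f by blast
  qed
  have fS: "finite S" using S cs finite_keys by (metis finite_imageI finite_subset)
  have inj: "inj_on (constraint_at I) ?W"
    using constraint_at_inj[OF M nd] by (intro inj_onI) (metis (no_types, lifting) mem_Collect_eq)
  have "card ?W \<le> card S" using card_mono[OF fS sub] unfolding card_image[OF inj] .
  then have "violations P (fst I) a (snd I) \<le> card S" by (simp add: violations_def)
  moreover have "a \<subseteq> {..<k * m}" by (auto simp: a_def)
  ultimately show "real (card S) \<ge> \<epsilon> * real d * real (nvars (csp_of n I)) / real k"
    using viol[of a] by (simp add: csp_of_def)
qed

end

section \<open>Tail bound for violations and distance from satisfiability\<close>

text \<open>Multiplying by \<open>exp x \<ge> 1 + x\<close> reduces this to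
  \<open>(1 + x) * (1 - x + x^2) = 1 + x^3 \<ge> 1\<close>.\<close>

lemma exp_minus_le:
  fixes x :: real
  assumes "0 \<le> x"
  shows "exp (- x) \<le> 1 - x + x\<^sup>2"
proof -
  have "1 \<le> 1 + x ^ 3" using assms by simp
  also have "\<dots> = (1 + x) * (1 - x + x\<^sup>2)" by (simp add: algebra_simps power2_eq_square power3_eq_cube)
  also have "\<dots> \<le> exp x * (1 - x + x\<^sup>2)"
  proof (rule mult_right_mono)
    have "0 \<le> (1 - x)\<^sup>2 + x" using assms by (intro add_nonneg_nonneg) auto
    then show "0 \<le> 1 - x + x\<^sup>2" using assms by (simp add: power2_eq_square algebra_simps)
  qed (rule exp_ge_add_one_self)
  finally show ?thesis by (simp add: exp_minus field_simps)
qed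

context hypermatchings
begin

definition unsat_ratio :: "(bool list \<Rightarrow> bool) \<Rightarrow> real" where
  "unsat_ratio P = real (card (unsat_inputs k P)) / 2 ^ k"

lemma unsat_ratio_bounds: "0 \<le> unsat_ratio P" "unsat_ratio P \<le> 1"
proof -
  \<comment> \<open>The arguments of \<open>local_input\<close> are dummies: any choice gives a
    bijection from the subsets of \<open>{..<k}\<close> onto the cube.\<close>
  have fin: "finite (cube k)" using bij_betw_finite[OF bij_betw_local_input[of "{}" "\<lambda>_. id" "(0,0)"]] by simp
  have "card (cube k) = 2 ^ k" using bij_betw_same_card[OF bij_betw_local_input[of "{}" "\<lambda>_. id" "(0,0)"]] by (simp add: card_Pow)
  moreover have "card (unsat_inputs k P) \<le> card (cube k)" by (rule card_mono[OF fin]) (auto simp: unsat_inputs_def)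
  ultimately have "real (card (unsat_inputs k P)) \<le> 2 ^ k" by (metis of_nat_le_iff of_nat_numeral of_nat_power)
  then show "0 \<le> unsat_ratio P" "unsat_ratio P \<le> 1" by (simp_all add: unsat_ratio_def)
qed

text \<open>A Chernoff bound. For fixed matchings and assignment the local inputs are independent
  and uniform on the cube, so the moment generating function of the number of violations is an exact
  power.\<close>

lemma few_violations_prob:
  assumes "0 < \<eta>"
  shows "avg (PiE keys (\<lambda>_. Pow {..<k})) (\<lambda>b. of_bool (real (violations P M a b) \<le> (unsat_ratio P - \<eta>) * real (d * m)))
    \<le> exp (- (\<eta>\<^sup>2 * real (d * m) / 4))"
proof -
  let ?B = "PiE keys (\<lambda>_. Pow {..<k})" and ?N = "real (d * m)" and ?p = "unsat_ratio P"
  \<comment> \<open>The final exponent per constraint is \<open>h^2 - h * \<eta>\<close>, which is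
    smallest here.\<close>
  define h where "h = \<eta> / 2"
  define x where "x = exp (- h)"
  have lam: "0 < h" using assms by (simp add: h_def)
  let ?w = "\<lambda>ji B. if \<not> P (local_input a M ji B) then x else 1"
  have xv: "x ^ violations P M a b = (\<Prod>ji\<in>keys. ?w ji (b ji))" for b
    by (simp add: violations_def prod.If_cases Int_def)
  have one: "(\<Sum>B\<in>Pow {..<k}. ?w ji B) = 2 ^ k * (1 - ?p * (1 - x))" for ji
  proof -
    have "(\<Sum>B\<in>Pow {..<k}. ?w ji B) = (\<Sum>B\<in>Pow {..<k}. 1 - (1 - x) * of_bool (\<not> P (local_input a M ji B)))"
      by (rule sum.cong) auto
    also have "\<dots> = 2 ^ k - (1 - x) * (\<Sum>B\<in>Pow {..<k}. of_bool (\<not> P (local_input a M ji B)))"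
      unfolding sum_subtractf sum_distrib_left[symmetric] by (simp add: card_Pow)
    also have "(\<Sum>B\<in>Pow {..<k}. of_bool (\<not> P (local_input a M ji B))) = real (card {B \<in> Pow {..<k}. \<not> P (local_input a M ji B)})"
      by (simp add: Int_def)
    also have "2 ^ k - (1 - x) * \<dots> = 2 ^ k * (1 - ?p * (1 - x))"
      unfolding card_local_violations by (simp add: unsat_ratio_def field_simps)
    finally show ?thesis .
  qed
  have "(\<Sum>b\<in>?B. x ^ violations P M a b) = (\<Prod>ji\<in>keys. \<Sum>B\<in>Pow {..<k}. ?w ji B)"
    unfolding xv by (rule prod_sum_PiE[symmetric]) auto
  also have "\<dots> = (2 ^ k * (1 - ?p * (1 - x))) ^ (d * m)"
    unfolding one by (simp add: card_keys)
  finally have mgf: "avg ?B (\<lambda>b. x ^ violations P M a b) = (1 - ?p * (1 - x)) ^ (d * m)"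
    by (simp add: avg_def card_PiE card_keys card_Pow power_mult_distrib)
  have "1 - ?p * (1 - x) \<le> exp (- (?p * (1 - x)))"
    using exp_ge_add_one_self[of "- (?p * (1 - x))"] by simp
  also have "\<dots> \<le> exp (- (?p * (h - h\<^sup>2)))"
    using exp_minus_le[of h] lam unsat_ratio_bounds[of P] by (auto simp: x_def intro!: mult_left_mono)
  finally have base: "1 - ?p * (1 - x) \<le> exp (- (?p * (h - h\<^sup>2)))" .
  have "?p * (1 - x) \<le> 1 * 1"
    using unsat_ratio_bounds[of P] lam by (intro mult_mono) (auto simp: x_def)
  then have "(1 - ?p * (1 - x)) ^ (d * m) \<le> exp (- (?p * (h - h\<^sup>2))) ^ (d * m)"
    by (intro power_mono base) simp
  also have "\<dots> = exp (- (?p * (h - h\<^sup>2)) * ?N)"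
    by (simp add: exp_of_nat_mult[symmetric] mult.commute)
  finally have mgf_le: "avg ?B (\<lambda>b. x ^ violations P M a b) \<le> exp (- (?p * (h - h\<^sup>2)) * ?N)"
    unfolding mgf .
  have "avg ?B (\<lambda>b. of_bool (real (violations P M a b) \<le> (?p - \<eta>) * ?N))
      \<le> avg ?B (\<lambda>b. exp (h * ((?p - \<eta>) * ?N)) * x ^ violations P M a b)"
  proof (rule avg_mono)
    fix b
    let ?v = "violations P M a b"
    have "exp (h * ((?p - \<eta>) * ?N)) * x ^ ?v = exp (h * ((?p - \<eta>) * ?N - real ?v))"
      unfolding x_def exp_of_nat_mult[symmetric] exp_add[symmetric] by (simp add: algebra_simps)
    moreover have "1 \<le> exp (h * ((?p - \<eta>) * ?N - real ?v))" if "real ?v \<le> (?p - \<eta>) * ?N"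
      using that lam by simp
    ultimately show "of_bool (real ?v \<le> (?p - \<eta>) * ?N) \<le> exp (h * ((?p - \<eta>) * ?N)) * x ^ ?v"
      by (auto simp: of_bool_def)
  qed
  also have "\<dots> \<le> exp (h * ((?p - \<eta>) * ?N)) * exp (- (?p * (h - h\<^sup>2)) * ?N)"
    unfolding avg_cmult by (intro mult_left_mono mgf_le) simp
  also have "\<dots> = exp (h * ((?p - \<eta>) * ?N) - ?p * (h - h\<^sup>2) * ?N)"
    by (simp add: exp_add[symmetric])
  also have "\<dots> \<le> exp (- (\<eta>\<^sup>2 * ?N / 4))"
  proof -
    have "h * ((?p - \<eta>) * ?N) - ?p * (h - h\<^sup>2) * ?N = ?N * (?p * h\<^sup>2) - ?N * (h * \<eta>)"
      by (simp add: algebra_simps power2_eq_square)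
    also have "\<dots> \<le> ?N * (1 * h\<^sup>2) - ?N * (h * \<eta>)"
      using unsat_ratio_bounds[of P] by (intro diff_right_mono mult_left_mono mult_right_mono) auto
    also have "\<dots> = - (\<eta>\<^sup>2 * ?N / 4)"
      by (simp add: h_def power2_eq_square algebra_simps)
    finally show ?thesis by simp
  qed
  finally show ?thesis .
qed

text \<open>Union bound over the assignments of the \<open>k * m\<close> variables that occur in
  constraints.\<close>

lemma not_far_prob:
  assumes "0 < \<eta>" and thr: "\<epsilon> * real d * real n / real k \<le> (unsat_ratio P - \<eta>) * real (d * m)"
  shows "avg random_space (\<lambda>I. of_bool (\<not> degenerate (fst I) \<and> \<not> far k P d \<epsilon> (csp_of n I)))
    \<le> 2 ^ (k * m) * exp (- (\<eta>\<^sup>2 * real (d * m) / 4))"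
proof -
  let ?B = "PiE keys (\<lambda>_. Pow {..<k})" and ?A = "Pow {..<k * m}"
  let ?few = "\<lambda>M a b. of_bool (real (violations P M a b) \<le> (unsat_ratio P - \<eta>) * real (d * m)) :: real"
  have finB: "finite ?B" by (intro finite_PiE) auto
  have "avg random_space (\<lambda>I. of_bool (\<not> degenerate (fst I) \<and> \<not> far k P d \<epsilon> (csp_of n I)))
      \<le> avg random_space (\<lambda>I. \<Sum>a\<in>?A. ?few (fst I) a (snd I))"
  proof (rule avg_mono)
    fix I assume I: "I \<in> random_space"
    then have M: "fst I \<in> matching_space" by (auto simp: random_space_def)
    show "of_bool (\<not> degenerate (fst I) \<and> \<not> far k P d \<epsilon> (csp_of n I)) \<le> (\<Sum>a\<in>?A. ?few (fst I) a (snd I))"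
    proof (cases "\<not> degenerate (fst I) \<and> \<not> far k P d \<epsilon> (csp_of n I)")
      case True
      then obtain a where a: "a \<subseteq> {..<k * m}" "real (violations P (fst I) a (snd I)) < \<epsilon> * real d * real n / real k"
        using far_csp_of[OF M] by (meson not_le)
      then have "?few (fst I) a (snd I) = 1" using thr by simp
      moreover have "?few (fst I) a (snd I) \<le> (\<Sum>a\<in>?A. ?few (fst I) a (snd I))"
        by (rule member_le_sum) (use a in auto)
      ultimately show ?thesis by (simp del: sum_of_bool_eq)
    next
      case False
      then have z: "of_bool (\<not> degenerate (fst I) \<and> \<not> far k P d \<epsilon> (csp_of n I)) = (0::real)" by simp
      show ?thesis unfolding z by (intro sum_nonneg) simp
    qed
  qed
  also have "\<dots> = avg matching_space (\<lambda>M. \<Sum>a\<in>?A. avg ?B (\<lambda>b. ?few M a b))"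
    unfolding random_space_def avg_Times[OF finite_matching_space finB] fst_conv snd_conv avg_sum ..
  also have "\<dots> \<le> avg matching_space (\<lambda>M. \<Sum>a\<in>?A. exp (- (\<eta>\<^sup>2 * real (d * m) / 4)))"
    by (intro avg_mono sum_mono few_violations_prob assms(1))
  also have "\<dots> = 2 ^ (k * m) * exp (- (\<eta>\<^sup>2 * real (d * m) / 4))"
    by (subst avg_const) (simp_all add: matching_space_nonempty card_Pow)
  finally show ?thesis .
qed

end

section \<open>Contradiction with a tester of few queries\<close>

context planted_hypermatchings
begin

lemma satisfiable_planted:
  assumes good: "\<And>t c. t < k \<Longrightarrow> P (map (\<lambda>l. z t l \<noteq> coin t c l) [0..<k])" and w: "w \<in> planted_space"
  shows "satisfiable P (cstrs (csp_or_empty n (planted_instance w)))"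
proof -
  obtain M a \<theta> where we: "w = (M, a, \<theta>)" by (cases w)
  have "cstr_sat P (\<lambda>v. v \<in> a) (constraint_at (planted_instance w) ji)" if "ji \<in> keys" for ji
  proof -
    have "\<theta> ji \<in> {..<k} \<times> UNIV"
      using w that by (auto simp: we planted_space_def intro: PiE_mem)
    then have t: "fst (\<theta> ji) < k" by auto
    have "map (\<lambda>l. (l * m + slot_map (fst (planted_instance w)) (fst ji) l (snd ji) \<in> a) \<noteq> (l \<in> snd (planted_instance w) ji)) [0..<k]
        = map (\<lambda>l. z (fst (\<theta> ji)) l \<noteq> coin (fst (\<theta> ji)) (snd (\<theta> ji)) l) [0..<k]"
      by (rule map_cong[OF refl]) (auto simp: planted_instance_def we)
    then show ?thesis
      using good[OF t, of "snd (\<theta> ji)"] unfolding cstr_sat_constraint_at by (simp only:)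
  qed
  then have "\<forall>c\<in>cstrs (csp_or_empty n (planted_instance w)). cstr_sat P (\<lambda>v. v \<in> a) c"
    by (auto simp: csp_or_empty_def csp_of_def)
  then show ?thesis unfolding satisfiable_def by (rule exI[of _ "\<lambda>v. v \<in> a"])
qed

lemma planted_degenerate_prob:
  assumes "1 < m"
  shows "avg planted_space (\<lambda>w. of_bool (degenerate (fst (planted_instance w)))) \<le> (real d)\<^sup>2 / real m"
proof -
  let ?Y = "Pow {..<k * m} \<times> PiE keys (\<lambda>_. {..<k} \<times> (UNIV :: (bool \<times> bool) set))"
  have "finite ?Y" by (intro finite_cartesian_product finite_PiE) auto
  moreover have "?Y \<noteq> {}" using k3 by (auto simp: PiE_eq_empty_iff lessThan_empty_iff)
  ultimately have "avg (matching_space \<times> ?Y) (\<lambda>w. of_bool (degenerate (fst w))) = avg matching_space (\<lambda>M. of_bool (degenerate M))"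
    by (intro avg_fst) auto
  moreover have "fst (planted_instance w) = fst w" for w
    by (auto simp: planted_instance_def split: prod.split)
  ultimately show ?thesis using degenerate_prob[OF assms] by (simp add: planted_space_def)
qed

lemma random_degenerate_prob:
  assumes "1 < m"
  shows "avg random_space (\<lambda>I. of_bool (degenerate (fst I))) \<le> (real d)\<^sup>2 / real m"
proof -
  have "avg random_space (\<lambda>I. of_bool (degenerate (fst I))) = avg matching_space (\<lambda>M. of_bool (degenerate M))"
    unfolding random_space_def by (intro avg_fst finite_PiE) (auto simp: PiE_eq_empty_iff)
  then show ?thesis using degenerate_prob[OF assms] by simp
qed

end

context planted_exploration
begin

text \<open>\<open>planted_indistinguishable\<close> is averaged over the tester's own randomness. A
  tester errs with probability at most 1/3 on either side, so both sides together reach only 2/3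
  plus the exceptional events: degenerate matchings, counted twice, and random instances that are
  not far.\<close>

theorem no_fast_tester:
  assumes n: "k * m \<le> n" and m1: "1 < m"
    and good: "\<And>t c. t < k \<Longrightarrow> P (map (\<lambda>l. z t l \<noteq> coin t c l) [0..<k])"
    and A: "tester k P d \<epsilon> n A"
    and few: "\<And>I t. I \<in> csp_instances k d n \<Longrightarrow> t \<in> set_pmf A \<Longrightarrow> queries I t \<le> q"
    and eta: "0 < \<eta>" and thr: "\<epsilon> * real d * real n / real k \<le> (unsat_ratio P - \<eta>) * real (d * m)"
    and small: "2 * ((real d)\<^sup>2 / real m) + 2 ^ (k * m) * exp (- (\<eta>\<^sup>2 * real (d * m) / 4))
      + (real q * base_rate + (real q)\<^sup>2 * real k * reach_rate * touch_rate) < 1 / 3"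
  shows False
proof -
  let ?I = "csp_or_empty n" and ?pr = "measure_pmf.prob A"
  let ?S = planted_space and ?R = random_space
  have inst: "?I I \<in> csp_instances k d n" if "fst I \<in> matching_space" for I
    using csp_or_empty_instance[OF that n] .
  have acc: "accepts (?I I) t = run (answer I) t q"
    if "t \<in> set_pmf A" "fst I \<in> matching_space" "\<not> degenerate (fst I)" for I t
    using accepts_csp_or_empty[OF n that(3)] few[OF inst[OF that(2)] that(1)] by blast
  have not_acc: "?pr {t. \<not> accepts J t} = 1 - ?pr {t. accepts J t}" for J
    using measure_pmf.prob_compl[of "{t. accepts J t}" A] by (simp add: Compl_eq_Diff_UNIV[symmetric] Collect_neg_eq)
  have prob_eq: "?pr {t. Q t} = ?pr {t. Q' t}" if "\<And>t. t \<in> set_pmf A \<Longrightarrow> Q t = Q' t" for Q Q'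
    by (rule measure_pmf.finite_measure_eq_AE) (use that in \<open>auto simp: AE_measure_pmf_iff\<close>)
  have le1: "?pr X \<le> 1" for X by simp
  have S: "?pr {t. \<not> run (answer (planted_instance w)) t q} \<le> 1 / 3 + of_bool (degenerate (fst (planted_instance w)))"
    if w: "w \<in> ?S" for w
  proof (cases "degenerate (fst (planted_instance w))")
    case False
    have M: "fst (planted_instance w) \<in> matching_space"
      using w by (auto simp: planted_space_def planted_instance_def)
    have "?pr {t. accepts (?I (planted_instance w)) t} \<ge> 2 / 3"
      using A inst[OF M] satisfiable_planted[of P, OF good w] unfolding tester_def by blast
    moreover have "?pr {t. \<not> run (answer (planted_instance w)) t q} = ?pr {t. \<not> accepts (?I (planted_instance w)) t}"
      by (rule prob_eq) (use acc[OF _ M False] in simp)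
    ultimately show ?thesis using not_acc[of "?I (planted_instance w)"] by simp
  next
    case True
    then have "of_bool (degenerate (fst (planted_instance w))) = (1::real)" by simp
    then show ?thesis using le1[of "{t. \<not> run (answer (planted_instance w)) t q}"] by linarith
  qed
  have R: "?pr {t. run (answer I) t q} \<le> 1 / 3 + of_bool (degenerate (fst I))
      + of_bool (\<not> degenerate (fst I) \<and> \<not> far k P d \<epsilon> (csp_of n I))" if I: "I \<in> ?R" for I
  proof (cases "\<not> degenerate (fst I) \<and> far k P d \<epsilon> (csp_of n I)")
    case True
    have M: "fst I \<in> matching_space" using I by (auto simp: random_space_def)
    have "?I I = csp_of n I" using True by (simp add: csp_or_empty_def)
    then have "?pr {t. \<not> accepts (?I I) t} \<ge> 2 / 3"
      using A inst[OF M] True unfolding tester_def by metis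
    moreover have "?pr {t. run (answer I) t q} = ?pr {t. accepts (?I I) t}"
      by (rule prob_eq) (use acc[OF _ M] True in simp)
    ultimately show ?thesis using not_acc[of "?I I"] True by simp
  next
    case False
    then have "(1::real) \<le> of_bool (degenerate (fst I)) + of_bool (\<not> degenerate (fst I) \<and> \<not> far k P d \<epsilon> (csp_of n I))"
      by auto
    then show ?thesis using le1[of "{t. run (answer I) t q}"] by linarith
  qed
  have intb: "integrable (measure_pmf A) (\<lambda>t. of_bool (Q t) :: real)" for Q
    by (rule measure_pmf.integrable_const_bound[where B = 1]) auto
  have expect: "(\<integral>t. avg X (\<lambda>x. of_bool (Q x t)) \<partial>measure_pmf A) = avg X (\<lambda>x. ?pr {t. Q x t})"
    and int: "integrable (measure_pmf A) (\<lambda>t. avg X (\<lambda>x. of_bool (Q x t)))"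
    for X :: "'x set" and Q
  proof -
    have "(\<integral>t. of_bool (Q x t) \<partial>measure_pmf A) = ?pr {t. Q x t}" for x
    proof -
      have "(\<lambda>t. of_bool (Q x t) :: real) = indicat_real {t. Q x t}" by (auto simp: indicator_def)
      then show ?thesis by simp
    qed
    then show "(\<integral>t. avg X (\<lambda>x. of_bool (Q x t)) \<partial>measure_pmf A) = avg X (\<lambda>x. ?pr {t. Q x t})"
      unfolding avg_def using intb by (subst integral_divide_zero) (simp add: Bochner_Integration.integral_sum del: sum_of_bool_eq)
    show "integrable (measure_pmf A) (\<lambda>t. avg X (\<lambda>x. of_bool (Q x t)))"
      unfolding avg_def by (intro integrable_divide Bochner_Integration.integrable_sum intb)
  qed
  let ?b = "real q * base_rate + (real q)\<^sup>2 * real k * reach_rate * touch_rate"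
  have "1 - ?b \<le> (\<integral>t. avg ?S (\<lambda>w. of_bool (\<not> run (answer (planted_instance w)) t q))
      + avg ?R (\<lambda>I. of_bool (run (answer I) t q)) \<partial>measure_pmf A)"
    by (intro measure_pmf.integral_ge_const Bochner_Integration.integrable_add int AE_I2 planted_indistinguishable)
  also have "\<dots> = avg ?S (\<lambda>w. ?pr {t. \<not> run (answer (planted_instance w)) t q}) + avg ?R (\<lambda>I. ?pr {t. run (answer I) t q})"
    by (subst Bochner_Integration.integral_add) (simp_all only: int expect)
  also have "\<dots> \<le> avg ?S (\<lambda>w. 1 / 3 + of_bool (degenerate (fst (planted_instance w))))
      + avg ?R (\<lambda>I. 1 / 3 + of_bool (degenerate (fst I)) + of_bool (\<not> degenerate (fst I) \<and> \<not> far k P d \<epsilon> (csp_of n I)))"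
    by (intro add_mono avg_mono S R)
  also have "\<dots> \<le> (1 / 3 + (real d)\<^sup>2 / real m) + (1 / 3 + (real d)\<^sup>2 / real m + 2 ^ (k * m) * exp (- (\<eta>\<^sup>2 * real (d * m) / 4)))"
    unfolding avg_add avg_const[OF finite_planted_space planted_space_nonempty] avg_const[OF finite_random_space random_space_nonempty]
    by (intro add_mono order_refl planted_degenerate_prob random_degenerate_prob not_far_prob m1 eta thr)
  finally show False using small by linarith
qed

end

section \<open>Asymptotics\<close>

context bounded_exploration
begin

text \<open>To be read with \<open>A\<close> = n^\<delta>, \<open>h\<close> = n^(1/8) and
  \<open>B\<close> = n^(-\<kappa>), so that \<open>q\<close> is about n^(1/2 + \<delta>). The
  dominant contribution is \<open>q^2 * reach_rate * touch_rate\<close>: its deep part is of order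
  \<open>A ^ 4 * B\<close>, its near part of order \<open>A ^ 3 / h ^ 3\<close>.\<close>

lemma total_rate_le:
  fixes A B h :: real
  assumes q: "real q \<le> h ^ 4 * A" and mq: "h ^ 8 / (4 * real k) \<le> real (m - q)"
    and L: "lam ^ R \<le> B / lam" and D: "real ((k * d) ^ (2 * R)) \<le> h"
    and ge: "1 \<le> A" "1 \<le> h" "0 \<le> B"
  shows "real q * base_rate + (real q)\<^sup>2 * real k * reach_rate * touch_rate
    \<le> 24 * real k ^ 5 / lam * (A ^ 4 * B) + 36 * real k ^ 4 * (A ^ 3 / h ^ 3)"
proof -
  define K where "K = real k"
  have K: "1 \<le> K" using k3 by (simp add: K_def)
  have l0: "0 < lam" using lam_bounds by simp
  have h8: "0 < h ^ 8 / (4 * K)" using ge K by simp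
  define T where "T = 4 * K ^ 2 * A / h ^ 4"
  define G where "G = 4 * K ^ 2 * A * B / (lam * h ^ 4) + 4 * K / h ^ 7"
  have nn: "0 \<le> T" "0 \<le> G" using ge K l0 by (auto simp: T_def G_def)
  have Kq: "real (k * q) \<le> K * (h ^ 4 * A)"
    using q K by (simp add: K_def mult_left_mono)
  have T: "touch_rate \<le> T"
  proof -
    have "touch_rate \<le> K * (h ^ 4 * A) / (h ^ 8 / (4 * K))"
      unfolding touch_rate_def using Kq mq h8 ge K by (intro frac_le) (auto simp: K_def)
    also have "\<dots> = T" using ge K by (simp add: T_def field_simps power2_eq_square flip: power_add)
    finally show ?thesis .
  qed
  have "real (k * q) * lam ^ R + real ((k * d) ^ (2 * R)) \<le> K * (h ^ 4 * A) * (B / lam) + h"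
    by (intro add_mono mult_mono Kq L D) (use K ge l0 in auto)
  then have "reach_rate \<le> (K * (h ^ 4 * A) * (B / lam) + h) / (h ^ 8 / (4 * K))"
    unfolding reach_rate_def using mq h8 ge K l0 by (intro frac_le) (auto simp: K_def)
  also have "\<dots> = G" using ge K l0 by (simp add: G_def field_simps power2_eq_square eval_nat_numeral)
  finally have G: "reach_rate \<le> G" .
  have Lnn: "0 \<le> lam ^ R" using l0 by simp
  have base: "base_rate \<le> T * (B / lam) + G + T\<^sup>2"
    unfolding base_rate_def
    by (intro add_mono mult_mono T L G power_mono) (use rates_nonneg nn Lnn ge l0 in auto)
  have "real q * base_rate + (real q)\<^sup>2 * real k * reach_rate * touch_rate
      \<le> (h ^ 4 * A) * (T * (B / lam) + G + T\<^sup>2) + (h ^ 4 * A)\<^sup>2 * K * G * T"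
    unfolding K_def[symmetric]
    by (intro add_mono mult_mono power_mono q base G T) (use rates_nonneg nn ge K l0 in auto)
  also have "\<dots> = 8 * K ^ 2 / lam * (A ^ 2 * B) + 4 * K * (A / h ^ 3) + 16 * K ^ 4 * (A ^ 3 / h ^ 4)
      + (16 * K ^ 5 / lam * (A ^ 4 * B) + 16 * K ^ 4 * (A ^ 3 / h ^ 3))"
    using ge K l0 by (simp add: T_def G_def field_simps eval_nat_numeral)
  also have "\<dots> \<le> 8 * K ^ 5 / lam * (A ^ 4 * B) + 4 * K ^ 4 * (A ^ 3 / h ^ 3) + 16 * K ^ 4 * (A ^ 3 / h ^ 3)
      + (16 * K ^ 5 / lam * (A ^ 4 * B) + 16 * K ^ 4 * (A ^ 3 / h ^ 3))"
  proof -
    have p: "K ^ 2 \<le> K ^ 5" "K \<le> K ^ 4" "A ^ 2 \<le> A ^ 4" "A \<le> A ^ 3" "h ^ 3 \<le> h ^ 4"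
      using K ge power_increasing[of 1 4 K] power_increasing[of 1 3 A] by (auto intro: power_increasing)
    have "8 * K ^ 2 / lam * (A ^ 2 * B) \<le> 8 * K ^ 5 / lam * (A ^ 4 * B)"
      by (intro mult_mono divide_right_mono p order_refl) (use K ge l0 in auto)
    moreover have "4 * K * (A / h ^ 3) \<le> 4 * K ^ 4 * (A ^ 3 / h ^ 3)"
      by (intro mult_mono divide_right_mono p order_refl) (use K ge l0 in auto)
    moreover have "16 * K ^ 4 * (A ^ 3 / h ^ 4) \<le> 16 * K ^ 4 * (A ^ 3 / h ^ 3)"
      by (intro mult_left_mono divide_left_mono p) (use K ge in auto)
    ultimately show ?thesis by linarith
  qed
  also have "\<dots> = 24 * K ^ 5 / lam * (A ^ 4 * B) + 36 * K ^ 4 * (A ^ 3 / h ^ 3)"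
    by (simp add: field_simps)
  finally show ?thesis by (simp add: K_def)
qed

end

section \<open>Planted patterns for symmetric predicates\<close>

lemma hamming_weight_map: "hamming_weight (map f [0..<k]) = card {l. l < k \<and> f l}"
proof -
  have "hamming_weight (map f [0..<k]) = length (filter f [0..<k])"
    by (simp add: hamming_weight_def filter_map o_def)
  also have "\<dots> = card (set (filter f [0..<k]))"
    by (rule distinct_card[symmetric]) simp
  also have "set (filter f [0..<k]) = {l. l < k \<and> f l}" by auto
  finally show ?thesis .
qed

lemma EQU_cases:
  assumes "x \<in> cube k" "EQU x"
  obtains b where "x = replicate k b"
proof -
  have "x = replicate k (x ! 0)"
  proof (rule nth_equalityI)
    fix i assume i: "i < length x"
    then have "0 < length x" by linarith
    then have "x ! i = x ! 0" using assms(2) i unfolding EQU_def by blast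
    then show "x ! i = replicate k (x ! 0) ! i" using assms(1) i by (simp add: cube_def)
  qed (use assms(1) in \<open>simp add: cube_def\<close>)
  then show thesis by (rule that)
qed

text \<open>If only constant inputs satisfied \<open>P\<close>, one of them would; invariance under
  complement then gives both, and \<open>P\<close> would be \<open>EQU\<close>.\<close>

lemma nonconstant_satisfying_input:
  assumes "card (sat_inputs k P) > 0" "symmetric_predicate k P" "\<not> (\<forall>x\<in>cube k. P x = EQU x)"
  obtains x where "x \<in> cube k" "P x" "\<not> EQU x"
proof (rule ccontr)
  assume "\<not> thesis"
  then have only: "EQU x" if "x \<in> cube k" "P x" for x using that \<open>\<not> thesis\<close> by (meson \<open>\<And>x. \<lbrakk>x \<in> cube k; P x; \<not> EQU x\<rbrakk> \<Longrightarrow> thesis\<close>)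
  obtain x where x: "x \<in> cube k" "EQU x" "\<not> P x" using assms(3) only by blast
  obtain y where y: "y \<in> cube k" "P y" using assms(1) by (auto simp: sat_inputs_def card_gt_0_iff)
  obtain b where b: "x = replicate k b" using EQU_cases[OF x(1,2)] .
  obtain c where c: "y = replicate k c" using EQU_cases[OF y(1) only[OF y]] .
  have "y = x \<or> y = map Not x" using b c by (cases b; cases c) auto
  moreover have "P x = P (map Not x)" using assms(2) x(1) unfolding symmetric_predicate_def by blast
  ultimately show False using x(3) y(2) by metis
qed

text \<open>The pattern takes different values at \<open>t\<close> and \<open>t + 1\<close>, so flipping this pair keeps the Hamming
  weight; flipping the other block is a complementation composed with flipping the pair.\<close>

lemma block_pattern_exists:
  assumes k: "3 \<le> k" and P: "card (sat_inputs k P) > 0" "symmetric_predicate k P" "\<not> (\<forall>x\<in>cube k. P x = EQU x)"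
  shows "\<exists>z :: nat \<Rightarrow> nat \<Rightarrow> bool. \<forall>t<k. \<forall>c c'. P (map (\<lambda>l. z t l \<noteq> (if l \<in> {t, Suc t mod k} then c else c')) [0..<k])"
proof -
  obtain x where x: "x \<in> cube k" "P x" "\<not> EQU x"
    using nonconstant_satisfying_input[OF P] .
  define W where "W = {l. l < k \<and> x ! l}"
  have len: "length x = k" using x(1) by (simp add: cube_def)
  then have xm: "x = map (\<lambda>l. x ! l) [0..<k]" by (metis map_nth)
  have hw: "hamming_weight x = card W" unfolding W_def by (subst xm) (rule hamming_weight_map)
  obtain i i' where i: "i < k" "i' < k" "x ! i" "\<not> x ! i'"
    using x(3) len by (auto simp: EQU_def)
  have finW: "finite W" by (simp add: W_def)
  have "card W > 0" using i finW by (auto simp: W_def card_gt_0_iff)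
  moreover have "W \<subset> {..<k}" using i by (auto simp: W_def)
  then have "card W < k" using psubset_card_mono[of "{..<k}" W] by simp
  \<comment> \<open>A nonconstant input has weight strictly between 0 and \<open>k\<close>. So one 1
    fits into the pair and the remaining \<open>card W - 1\<close> fit outside it.\<close>
  ultimately have w: "card W - 1 \<le> k - 2" "Suc (card W - 1) = card W" by auto
  have "\<exists>z :: nat \<Rightarrow> bool. \<forall>c c'. P (map (\<lambda>l. z l \<noteq> (if l \<in> {t, Suc t mod k} then c else c')) [0..<k])" if t: "t < k" for t
  proof -
    define u where "u = Suc t mod k"
    have u: "u < k" "u \<noteq> t" using k t by (auto simp: u_def mod_Suc)
    have "card ({..<k} - {t, u}) = k - 2" using t u by (simp add: card_Diff_subset)
    then obtain T where T: "T \<subseteq> {..<k} - {t, u}" "card T = card W - 1" "finite T"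
      using w(1) by (metis obtain_subset_with_card_n)
    define z where "z l = (l \<in> insert t T)" for l
    have sym: "P y = P y'" if "y \<in> cube k" "y' \<in> cube k" "hamming_weight y = hamming_weight y'" for y y'
      using P(2) that unfolding symmetric_predicate_def by blast
    have neg: "P y = P (map Not y)" if "y \<in> cube k" for y
      using P(2) that unfolding symmetric_predicate_def by blast
    let ?y = "\<lambda>c c'. map (\<lambda>l. z l \<noteq> (if l \<in> {t, u} then c else c')) [0..<k]"
    have cube: "?y c c' \<in> cube k" for c c' by (simp add: cube_def)
    have base: "P (?y c False)" for c
    proof -
      have "{l. l < k \<and> (z l \<noteq> (if l \<in> {t, u} then c else False))} = insert (if c then u else t) T"
        using T(1) t u by (auto simp: z_def)
      moreover have "card (insert (if c then u else t) T) = card W"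
        using T w(2) by (subst card_insert_disjoint) auto
      ultimately have "hamming_weight (?y c False) = hamming_weight x"
        unfolding hamming_weight_map hw by simp
      then show ?thesis using sym[OF cube x(1)] x(2) by blast
    qed
    have "P (?y c c')" for c c'
    proof (cases c')
      case True
      have eq: "?y c True = map Not (?y (\<not> c) False)" by auto
      have "P (map Not (?y (\<not> c) False))" using neg[OF cube[of "\<not> c" False]] base[of "\<not> c"] by blast
      moreover have "c' = True" using True by simp
      ultimately show ?thesis by (simp only: eq)
    next
      case False
      then have "c' = False" by simp
      then show ?thesis using base[of c] by (simp only:)
    qed
    then have all: "\<forall>c c'. P (?y c c')" by (intro allI)
    show ?thesis
      by (rule exI[of _ z]) (rule all[unfolded u_def])
  qed
  then have "\<forall>t. \<exists>z :: nat \<Rightarrow> bool. t < k \<longrightarrow> (\<forall>c c'. P (map (\<lambda>l. z l \<noteq> (if l \<in> {t, Suc t mod k} then c else c')) [0..<k]))"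
    by blast
  from choice[OF this] show ?thesis .
qed

text \<open>For such thresholds the empty instance is both satisfiable and far.\<close>

lemma nonpositive_threshold_no_tester:
  assumes "\<epsilon> \<le> 0"
  shows "\<not> tester k P d \<epsilon> n A"
proof
  assume A: "tester k P d \<epsilon> n A"
  define I where "I = \<lparr>nvars = n, cstrs = {}, incidence = (\<lambda>x. [])\<rparr>"
  have I: "I \<in> csp_instances k d n" by (simp add: csp_instances_def I_def)
  have "satisfiable P (cstrs I)" by (simp add: satisfiable_def I_def)
  moreover have "far k P d \<epsilon> I"
    unfolding far_def
  proof (intro allI impI)
    fix R
    have "\<epsilon> * real d * real (nvars I) / real k \<le> 0"
      using assms by (intro divide_nonpos_nonneg mult_nonpos_nonneg) auto
    then show "\<epsilon> * real d * real (nvars I) / real k \<le> real (card R)" by linarith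
  qed
  ultimately have "measure_pmf.prob A {t. accepts I t} \<ge> 2 / 3" "measure_pmf.prob A {t. \<not> accepts I t} \<ge> 2 / 3"
    using A I unfolding tester_def by blast+
  moreover have "measure_pmf.prob A {t. \<not> accepts I t} = 1 - measure_pmf.prob A {t. accepts I t}"
    using measure_pmf.prob_compl[of "{t. accepts I t}" A] by (simp add: Compl_eq_Diff_UNIV[symmetric] Collect_neg_eq)
  ultimately show False by simp
qed

section \<open>Choice of parameters for large n\<close>

lemma eventually_fast:
  fixes a b e f g h :: real and N :: nat
  assumes "a < 0" "b < 0" "0 < c0"
  shows "\<forall>\<^sub>F n in sequentially. e * real n powr a + f * real n powr b + g / real n + exp (- (real n / 2)) < c0"
proof -
  have x: "filterlim real at_top sequentially" by (rule filterlim_real_sequentially)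
  have pa: "(\<lambda>n. real n powr a) \<longlonglongrightarrow> 0" "(\<lambda>n. real n powr b) \<longlonglongrightarrow> 0"
    using tendsto_neg_powr[OF assms(1) x] tendsto_neg_powr[OF assms(2) x] by simp_all
  have gn: "(\<lambda>n. g / real n) \<longlonglongrightarrow> 0" by (rule lim_const_over_n)
  have "filterlim (\<lambda>n. real n * (1 / 2)) at_top sequentially"
    using x by (subst mult.commute) (rule filterlim_tendsto_pos_mult_at_top[OF tendsto_const], simp_all)
  then have "filterlim (\<lambda>n. - (real n * (1 / 2))) at_bot sequentially"
    by (simp add: filterlim_uminus_at_bot)
  then have "(\<lambda>n. exp (- (real n * (1 / 2)))) \<longlonglongrightarrow> 0"
    by (rule filterlim_compose[OF exp_at_bot])
  then have ex: "(\<lambda>n. exp (- (real n / 2))) \<longlonglongrightarrow> 0" by simp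
  have "(\<lambda>n. e * real n powr a + f * real n powr b + g / real n + exp (- (real n / 2))) \<longlonglongrightarrow> e * 0 + f * 0 + 0 + 0"
    by (intro tendsto_add tendsto_mult tendsto_const pa gn ex)
  then show ?thesis using assms(3) by (auto dest: order_tendstoD(2))
qed

lemma eventually_powr_le:
  assumes "a < 1" "0 < c"
  shows "\<forall>\<^sub>F n in sequentially. real n powr a \<le> c * real n"
proof -
  have "(\<lambda>n. real n powr (a - 1)) \<longlonglongrightarrow> 0"
    by (rule tendsto_neg_powr[OF _ filterlim_real_sequentially]) (use assms in simp)
  then have "\<forall>\<^sub>F n in sequentially. real n powr (a - 1) < c" using assms(2) by (rule order_tendstoD(2))
  then show ?thesis using eventually_gt_at_top[of 0]
  proof eventually_elim
    case (elim n)
    then have "real n powr a = real n powr (a - 1) * real n" by (simp add: powr_mult_base powr_diff)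
    then show ?case using elim by (simp add: mult_right_mono)
  qed
qed

text \<open>Rounding the exponent down is harmless for \<open>x \<ge> 1\<close> and costs at most
  one factor \<open>1 / x\<close> for \<open>x \<le> 1\<close>.\<close>

lemma log_cutoff:
  fixes n \<rho> x :: real
  assumes n: "1 \<le> n" and rho: "0 \<le> \<rho>" and x: "0 < x"
  defines "R \<equiv> nat \<lfloor>\<rho> * ln n\<rfloor>"
  shows "1 \<le> x \<Longrightarrow> x ^ R \<le> n powr (\<rho> * ln x)" and "x \<le> 1 \<Longrightarrow> x ^ R \<le> n powr (\<rho> * ln x) / x"
proof -
  have nn: "0 \<le> \<rho> * ln n" using n rho by simp
  then have R: "real R \<le> \<rho> * ln n" "\<rho> * ln n - 1 \<le> real R" by (auto simp: R_def)
  have xR: "x ^ R = exp (real R * ln x)" using x by (simp add: exp_of_nat_mult)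
  have np: "n powr (\<rho> * ln x) = exp (\<rho> * ln n * ln x)" using n by (simp add: powr_def mult_ac)
  show "x ^ R \<le> n powr (\<rho> * ln x)" if "1 \<le> x"
    unfolding xR np using R that by (simp add: mult_right_mono)
  show "x ^ R \<le> n powr (\<rho> * ln x) / x" if "x \<le> 1"
  proof -
    have "ln x \<le> 0" using that x by simp
    then have "real R * ln x \<le> (\<rho> * ln n - 1) * ln x" using R by (intro mult_right_mono_neg)
    then have "exp (real R * ln x) \<le> exp (\<rho> * ln n * ln x - ln x)" by (simp add: algebra_simps)
    also have "\<dots> = exp (\<rho> * ln n * ln x) / x" using x by (simp add: exp_diff)
    finally show ?thesis unfolding xR np .
  qed
qed

lemma div_lower_bounds:
  assumes "0 < k" "2 * k \<le> n"
  shows "real n / (2 * real k) \<le> real (n div k)" "real n / real k \<le> real (n div k) + 1" "real n / 2 \<le> real (k * (n div k))"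
proof -
  have "n < k * (n div k) + k" using assms(1) by (metis add.commute div_mult_mod_eq mod_less_divisor mult.commute nat_add_left_cancel_less)
  then have n: "real n \<le> real k * real (n div k) + real k" by (metis less_imp_le of_nat_add of_nat_le_iff of_nat_mult)
  then show "real n / real k \<le> real (n div k) + 1" using assms(1) by (simp add: field_simps)
  have "2 * real k \<le> real n" using assms(2) by (metis of_nat_le_iff of_nat_mult of_nat_numeral)
  then show h: "real n / 2 \<le> real (k * (n div k))" using n by simp
  then show "real n / (2 * real k) \<le> real (n div k)" using assms(1) by (simp add: field_simps)
qed

text \<open>The degree \<open>d\<close> is fixed before \<delta>, and every \<delta> up to \<delta>0
  is covered, so that \<delta> can later be shrunk to meet its required upper bound.\<close>

lemma tester_query_lower_bound:
  fixes \<epsilon> :: real and z :: "nat \<Rightarrow> nat \<Rightarrow> bool"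
  assumes k: "3 \<le> k" and eps: "0 < \<epsilon>"
    and good: "\<forall>t<k. \<forall>c c'. P (map (\<lambda>l. z t l \<noteq> (if l \<in> {t, Suc t mod k} then c else c')) [0..<k])"
  shows "\<exists>\<delta>0>0. \<exists>d\<ge>1. \<forall>\<delta>. 0 < \<delta> \<and> \<delta> \<le> \<delta>0 \<longrightarrow>
    (\<forall>\<^sub>F n in sequentially. \<forall>A. tester k P d (real (card (unsat_inputs k P)) / 2 ^ k - \<epsilon>) n A \<longrightarrow>
       (\<exists>I\<in>csp_instances k d n. \<exists>t\<in>set_pmf A. real n powr (1 / 2 + \<delta>) < real (queries I t)))"
proof -
  \<comment> \<open>With \<eta> = \<epsilon>/2 the tail exponent is
    \<open>\<epsilon>^2 * d * m / 16\<close>. This choice makes it at least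
    \<open>2 * k * m\<close>, which beats the \<open>2 ^ (k * m)\<close> assignments and leaves
    \<open>exp (- (k * m))\<close>.\<close>
  define d where "d = nat \<lceil>32 * real k / \<epsilon>\<^sup>2\<rceil>"
  have d: "32 * real k / \<epsilon>\<^sup>2 \<le> real d" by (simp add: d_def real_nat_ceiling_ge)
  have "0 < 32 * real k / \<epsilon>\<^sup>2" using k eps by simp
  then have "0 < real d" using d by linarith
  then have d1: "1 \<le> d" by simp
  define l where "l = 1 - 1 / real k"
  have l: "0 < l" "l < 1" using k by (auto simp: l_def)
  have D: "3 \<le> real (k * d)" using mult_le_mono[OF k d1] by linarith
  then have lnD: "0 < ln (real (k * d))" by simp
  \<comment> \<open>Chosen so that neighbourhoods of radius \<open>2 * R\<close>, with
    \<open>R\<close> about \<rho> ln n, have size at most n^(1/8). Then \<open>lam ^ R\<close> is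
    about n^(-\<kappa>).\<close>
  define \<rho> where "\<rho> = 1 / (16 * ln (real (k * d)))"
  have rho: "0 < \<rho>" "2 * (\<rho> * ln (real (k * d))) = 1 / 8" using lnD by (auto simp: \<rho>_def)
  define \<kappa> where "\<kappa> = - (\<rho> * ln l)"
  have kap: "0 < \<kappa>" using mult_pos_neg[OF rho(1), of "ln l"] l by (simp add: \<kappa>_def)
  \<comment> \<open>The three exponents listed in \<open>neg\<close> below have to be negative,
    negative and less than 1.\<close>
  define \<delta>0 where "\<delta>0 = min (\<kappa> / 8) (1 / 32)"
  have d0: "0 < \<delta>0" using kap by (simp add: \<delta>0_def)
  have main: "\<forall>\<^sub>F n in sequentially. \<forall>A. tester k P d (real (card (unsat_inputs k P)) / 2 ^ k - \<epsilon>) n A \<longrightarrow>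
       (\<exists>I\<in>csp_instances k d n. \<exists>t\<in>set_pmf A. real n powr (1 / 2 + \<delta>) < real (queries I t))"
    if del: "0 < \<delta>" "\<delta> \<le> \<delta>0" for \<delta>
  proof -
    have neg: "4 * \<delta> - \<kappa> < 0" "3 * \<delta> - 3 / 8 < 0" "1 / 2 + \<delta> < 1"
      using del kap by (auto simp: \<delta>0_def)
    have kk: "0 < 1 / (4 * real k)" using k by simp
    have e1: "\<forall>\<^sub>F n in sequentially. 24 * real k ^ 5 / l * real n powr (4 * \<delta> - \<kappa>) + 36 * real k ^ 4 * real n powr (3 * \<delta> - 3 / 8)
        + (4 * real k * (real d)\<^sup>2) / real n + exp (- (real n / 2)) < 1 / 3"
      by (rule eventually_fast) (use neg in auto)
    have e2: "\<forall>\<^sub>F n in sequentially. real n powr (1 / 2 + \<delta>) \<le> 1 / (4 * real k) * real n"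
      by (rule eventually_powr_le[OF neg(3) kk])
    \<comment> \<open>The summand \<open>4 * k\<close> ensures \<open>m > 1\<close>; the other makes
      \<open>\<epsilon> / 2 * m\<close> at least 1, which pays for rounding \<open>n / k\<close>
      down to \<open>m\<close>.\<close>
    have e3: "\<forall>\<^sub>F n in sequentially. 4 * k + nat \<lceil>4 * real k / \<epsilon>\<rceil> \<le> n"
      by (rule eventually_ge_at_top)
    show ?thesis using e1 e2 e3
    proof eventually_elim
      case (elim n)
      show ?case
      proof (intro allI impI, rule ccontr)
        fix A
        let ?th = "real (card (unsat_inputs k P)) / 2 ^ k - \<epsilon>"
        assume A: "tester k P d ?th n A"
          and "\<not> (\<exists>I\<in>csp_instances k d n. \<exists>t\<in>set_pmf A. real n powr (1 / 2 + \<delta>) < real (queries I t))"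
        then have few: "real (queries I t) \<le> real n powr (1 / 2 + \<delta>)" if "I \<in> csp_instances k d n" "t \<in> set_pmf A" for I t
          using that by (meson not_le)
        define q where "q = nat \<lfloor>real n powr (1 / 2 + \<delta>)\<rfloor>"
        have q: "real q \<le> real n powr (1 / 2 + \<delta>)" by (simp add: q_def)
        have few': "queries I t \<le> q" if "I \<in> csp_instances k d n" "t \<in> set_pmf A" for I t
          using few[OF that] by (simp add: q_def le_nat_floor)
        define m where "m = n div k"
        have nk: "4 * k \<le> n" using elim(3) by simp
        then have nk2: "2 * k \<le> n" by simp
        have n0: "1 \<le> real n" "0 < real n" using nk k by linarith+
        have mb: "real n / (2 * real k) \<le> real m" "real n / real k \<le> real m + 1" "real n / 2 \<le> real (k * m)"
          using div_lower_bounds[of k n] k nk2 unfolding m_def by auto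
        have "4 * real k \<le> real n" using nk by linarith
        then have "2 \<le> real n / (2 * real k)" using k by (simp add: field_simps)
        then have m2: "1 < m" using mb(1) by linarith
        have kmn: "k * m \<le> n" by (simp add: m_def)
        have "real q \<le> real n / (4 * real k)" using q elim(2) by simp
        moreover have "real n / (4 * real k) + real n / (4 * real k) = real n / (2 * real k)" using k by (simp add: field_simps)
        ultimately have qm: "real q + real n / (4 * real k) \<le> real m" using mb(1) by linarith
        have npos: "0 < real n / (4 * real k)" using n0 k by simp
        have q_less: "q < m" using qm npos by linarith
        define R where "R = nat \<lfloor>\<rho> * ln (real n)\<rfloor>"
        interpret planted_exploration k d m q R z
          by unfold_locales (use k m2 d1 q_less in auto)
        define X where "X = real n powr \<delta>"
        define B where "B = real n powr (- \<kappa>)"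
        define h where "h = real n powr (1 / 8)"
        have lam: "lam = l" by (simp add: lam_def l_def)
        have pw: "X ^ j = real n powr (j * \<delta>)" "h ^ j = real n powr (j / 8)" for j :: nat
          using n0 by (simp_all add: X_def h_def powr_powr powr_realpow[symmetric] mult.commute)
        have rate: "real q * base_rate + (real q)\<^sup>2 * real k * reach_rate * touch_rate
            \<le> 24 * real k ^ 5 / lam * (X ^ 4 * B) + 36 * real k ^ 4 * (X ^ 3 / h ^ 3)"
        proof (rule total_rate_le)
          show "real q \<le> h ^ 4 * X" using q by (simp add: pw X_def powr_add)
          show "h ^ 8 / (4 * real k) \<le> real (m - q)" using qm q_less n0 by (simp add: pw)
          show "lam ^ R \<le> B / lam"
            using log_cutoff(2)[OF n0(1) _ l(1), of \<rho>] rho l unfolding lam R_def B_def \<kappa>_def by simp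
          have "real (k * d) ^ R \<le> real n powr (\<rho> * ln (real (k * d)))"
            unfolding R_def by (rule log_cutoff(1)) (use n0 rho D in auto)
          then have "(real (k * d) ^ R)\<^sup>2 \<le> (real n powr (\<rho> * ln (real (k * d))))\<^sup>2"
            by (rule power_mono) simp
          also have "\<dots> = real n powr (2 * (\<rho> * ln (real (k * d))))"
            by (simp only: power2_eq_square powr_add[symmetric] mult_2)
          also have "\<dots> = h" unfolding h_def rho(2) ..
          finally show "real ((k * d) ^ (2 * R)) \<le> h" by (simp only: of_nat_power power_mult[symmetric] mult.commute)
          show "1 \<le> X" "1 \<le> h" using n0 del by (auto simp: X_def h_def ge_one_powr_ge_zero)
          show "0 \<le> B" by (simp add: B_def)
        qed
        have XB: "X ^ 4 * B = real n powr (4 * \<delta> - \<kappa>)" unfolding pw B_def powr_add[symmetric] by simp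
        have Xh: "X ^ 3 / h ^ 3 = real n powr (3 * \<delta> - 3 / 8)" unfolding pw powr_diff[symmetric] by simp
        have sm: "2 * ((real d)\<^sup>2 / real m) + 2 ^ (k * m) * exp (- ((\<epsilon> / 2)\<^sup>2 * real (d * m) / 4))
          + (real q * base_rate + (real q)\<^sup>2 * real k * reach_rate * touch_rate) < 1 / 3"
        proof -
          have "(real d)\<^sup>2 / real m \<le> (real d)\<^sup>2 / (real n / (2 * real k))"
            by (rule divide_left_mono) (use mb(1) n0 k m2 in auto)
          moreover have "2 * ((real d)\<^sup>2 / (real n / (2 * real k))) = (4 * real k * (real d)\<^sup>2) / real n"
            by simp
          ultimately have a: "2 * ((real d)\<^sup>2 / real m) \<le> (4 * real k * (real d)\<^sup>2) / real n"
            by linarith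
          have "32 * real k * real m \<le> real d * \<epsilon>\<^sup>2 * real m"
            using d eps by (intro mult_right_mono) (auto simp: field_simps)
          then have "2 * real (k * m) \<le> (\<epsilon> / 2)\<^sup>2 * real (d * m) / 4"
            by (simp add: power_divide mult_ac)
          then have "exp (- ((\<epsilon> / 2)\<^sup>2 * real (d * m) / 4)) \<le> exp (- (2 * real (k * m)))" by simp
          then have "2 ^ (k * m) * exp (- ((\<epsilon> / 2)\<^sup>2 * real (d * m) / 4)) \<le> exp (real (k * m)) * exp (- (2 * real (k * m)))"
          proof (intro mult_mono)
            have "(2::real) \<le> exp 1" using exp_ge_add_one_self[of 1] by simp
            then have "(2::real) ^ (k * m) \<le> exp 1 ^ (k * m)" by (intro power_mono) auto
            then show "(2::real) ^ (k * m) \<le> exp (real (k * m))" by (simp add: exp_of_nat_mult[symmetric])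
          qed auto
          also have "\<dots> = exp (- real (k * m))" by (simp add: exp_add[symmetric])
          also have "\<dots> \<le> exp (- (real n / 2))" using mb(3) by simp
          finally show ?thesis using rate a elim(1) unfolding XB Xh lam by linarith
        qed
        show False
        \<comment> \<open>Replacing \<open>n / k\<close> by \<open>m + 1\<close> in the farness
          threshold needs a positive factor \<open>?th\<close>; the other case has no tester at
          all.\<close>
        proof (cases "?th \<le> 0")
          case True
          then show False using nonpositive_threshold_no_tester A by blast
        next
          case False
          have up: "unsat_ratio P = real (card (unsat_inputs k P)) / 2 ^ k" by (simp add: unsat_ratio_def)
          have th1: "?th \<le> 1" using unsat_ratio_bounds(2)[of P] eps unfolding up by linarith
          have "4 * real k / \<epsilon> \<le> real n" using elim(3) by linarith
          then have "2 / \<epsilon> \<le> real n / (2 * real k)" using k eps by (simp add: field_simps)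
          then have "2 / \<epsilon> \<le> real m" using mb(1) by linarith
          then have "1 \<le> (\<epsilon> / 2) * real m" using eps by (simp add: field_simps)
          moreover have "?th * (real m + 1) = ?th * real m + ?th" by (simp only: distrib_left mult_1_right)
          moreover have "(?th + \<epsilon> / 2) * real m = ?th * real m + (\<epsilon> / 2) * real m"
            by (rule distrib_right)
          ultimately have *: "?th * (real m + 1) \<le> (?th + \<epsilon> / 2) * real m" using th1 by linarith
          have "?th * real d * real n / real k = real d * (?th * (real n / real k))" by simp
          also have "\<dots> \<le> real d * (?th * (real m + 1))"
            using mb(2) False by (intro mult_left_mono) auto
          also have "\<dots> \<le> real d * ((?th + \<epsilon> / 2) * real m)"
            by (intro mult_left_mono *) auto
          also have "\<dots> = (unsat_ratio P - \<epsilon> / 2) * real (d * m)" by (simp add: up)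
          finally have thr: "?th * real d * real n / real k \<le> (unsat_ratio P - \<epsilon> / 2) * real (d * m)" .
          have gd: "P (map (\<lambda>l. z t l \<noteq> coin t c l) [0..<k])" if "t < k" for t c
            using good that unfolding coin_def block_def by blast
          show False
            by (rule no_fast_tester[where P = P and n = n and A = A and \<epsilon> = ?th and \<eta> = "\<epsilon> / 2"])
              (use kmn m2 gd A few' eps thr sm in auto)
        qed
      qed
    qed
  qed
  show ?thesis using d0 d1 main by blast
qed

theorem theorem7:
  "\<exists>C::real. C > 0 \<and>
    (\<forall>k\<ge>3. \<forall>P. card (sat_inputs k P) > 0 \<and> symmetric_predicate k P \<and>
        \<not> (\<forall>x\<in>cube k. P x = EQU x) \<longrightarrow>
      (\<forall>\<epsilon>::real. \<epsilon> > 0 \<longrightarrow>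
        (\<exists>\<delta>::real. \<exists>d::nat. \<delta> > 0 \<and> d \<ge> 1 \<and>
          (real k / \<epsilon>\<^sup>2 > 1 \<longrightarrow> \<delta> \<le> C * (1 / ln (real k / \<epsilon>\<^sup>2))) \<and>
          (\<exists>c::real. c > 0 \<and>
            (\<forall>\<^sub>F n in sequentially. \<forall>A.
              tester k P d (real (card (unsat_inputs k P)) / 2 ^ k - \<epsilon>) n A \<longrightarrow>
              ereal (c * real n powr (1/2 + \<delta>))
                \<le> ereal_of_enat (query_complexity k d n A))))))"
proof (rule exI[of _ "1::real"], intro conjI allI impI)
  fix k :: nat and P :: "bool list \<Rightarrow> bool" and \<epsilon> :: real
  assume k: "3 \<le> k" and eps: "\<epsilon> > 0"
    and P: "card (sat_inputs k P) > 0 \<and> symmetric_predicate k P \<and> \<not> (\<forall>x\<in>cube k. P x = EQU x)"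
  then obtain z :: "nat \<Rightarrow> nat \<Rightarrow> bool" where "\<forall>t<k. \<forall>c c'. P (map (\<lambda>l. z t l \<noteq> (if l \<in> {t, Suc t mod k} then c else c')) [0..<k])"
    using block_pattern_exists[OF k] by blast
  from tester_query_lower_bound[OF k eps this]
  obtain \<delta>0 d where d: "\<delta>0 > 0" "d \<ge> 1" and lb: "\<And>\<delta>. 0 < \<delta> \<Longrightarrow> \<delta> \<le> \<delta>0 \<Longrightarrow>
    (\<forall>\<^sub>F n in sequentially. \<forall>A. tester k P d (real (card (unsat_inputs k P)) / 2 ^ k - \<epsilon>) n A \<longrightarrow>
       (\<exists>I\<in>csp_instances k d n. \<exists>t\<in>set_pmf A. real n powr (1 / 2 + \<delta>) < real (queries I t)))"
    by blast
  \<comment> \<open>The condition on \<delta> is an upper bound, met by taking a minimum. The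
    logarithm is positive exactly when its argument exceeds 1; otherwise nothing is
    required.\<close>
  define \<delta> where "\<delta> = (if real k / \<epsilon>\<^sup>2 > 1 then min \<delta>0 (1 / ln (real k / \<epsilon>\<^sup>2)) else \<delta>0)"
  have del: "0 < \<delta>" "\<delta> \<le> \<delta>0" using d by (auto simp: \<delta>_def)
  have bound: "real k / \<epsilon>\<^sup>2 > 1 \<longrightarrow> \<delta> \<le> 1 * (1 / ln (real k / \<epsilon>\<^sup>2))" by (simp add: \<delta>_def)
  have "\<forall>\<^sub>F n in sequentially. \<forall>A. tester k P d (real (card (unsat_inputs k P)) / 2 ^ k - \<epsilon>) n A \<longrightarrow>
      ereal (1 * real n powr (1/2 + \<delta>)) \<le> ereal_of_enat (query_complexity k d n A)"
    using lb[OF del]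
  proof eventually_elim
    case (elim n)
    show ?case
    proof (intro allI impI)
      fix A assume "tester k P d (real (card (unsat_inputs k P)) / 2 ^ k - \<epsilon>) n A"
      then obtain I t where It: "I \<in> csp_instances k d n" "t \<in> set_pmf A" "real n powr (1 / 2 + \<delta>) < real (queries I t)"
        using elim by blast
      have "enat (queries I t) \<le> query_complexity k d n A"
        unfolding query_complexity_def by (rule SUP_upper2[OF It(1)], rule SUP_upper[OF It(2)])
      then have "ereal_of_enat (enat (queries I t)) \<le> ereal_of_enat (query_complexity k d n A)"
        by (simp only: ereal_of_enat_le_iff)
      moreover have "ereal (1 * real n powr (1 / 2 + \<delta>)) \<le> ereal_of_enat (enat (queries I t))"
        using It(3) by simp
      ultimately show "ereal (1 * real n powr (1 / 2 + \<delta>)) \<le> ereal_of_enat (query_complexity k d n A)"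
        by (rule order_trans[rotated])
    qed
  qed
  then show "\<exists>\<delta>::real. \<exists>d::nat. \<delta> > 0 \<and> d \<ge> 1 \<and>
          (real k / \<epsilon>\<^sup>2 > 1 \<longrightarrow> \<delta> \<le> 1 * (1 / ln (real k / \<epsilon>\<^sup>2))) \<and>
          (\<exists>c::real. c > 0 \<and>
            (\<forall>\<^sub>F n in sequentially. \<forall>A.
              tester k P d (real (card (unsat_inputs k P)) / 2 ^ k - \<epsilon>) n A \<longrightarrow>
              ereal (c * real n powr (1/2 + \<delta>))
                \<le> ereal_of_enat (query_complexity k d n A)))"
    using del(1) d(2) bound by (intro exI[of _ \<delta>] exI[of _ d] conjI exI[of _ "1::real"]) auto
qed simp

end
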